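(* Let $p\ge1$. There exist no non-trivial $L^p$-harmonic functions on the hypersurfaces $(M^3_\Gamma,h_t)$, for arbitrary $t\in\mathbb R$ and arbitrary curves $\Gamma$. That is, if $w\in C^\infty$ satisfies $\Delta w=0$ and $\int|w|^p\,dM^3_\Gamma<\infty$, then $w\equiv0$.
   Context: Eguchi--Hanson space: $T^*\mathbb P^1(\mathbb C)$ is realized as $H^2=\{(\alpha,\beta,\gamma)\in(\mathbb C^2\setminus\{0\})\times\mathbb C\}/\sim$, where $(\alpha,\beta,\gamma)\sim(A\alpha,A\beta,\gamma/A^2)$ for $A\in\mathbb C^*$; the projection is $p([\alpha,\beta,\gamma])=\alpha/\beta\in\mathbb C\cup\{\infty\}=\mathbb P^1(\mathbb C)$. $M^4\subset H^2$ is the complement of the zero section $\{\gamma=0\}$, identified with $(\mathbb C^2\setminus\{0\})/\{\pm1\}$ by $[\alpha,\beta,\gamma]\mapsto \pm(z_1,z_2)=\pm(\alpha\sqrt\gamma,\beta\sqrt\gamma)$. Put $u_1=|z_1|^2+|z_2|^2$ and $f_t=\sqrt{u_1^2+t^4}+t^2\log\frac{u_1}{\sqrt{u_1^2+t^4}+t^2}$ ($f_0=u_1$). For $t\ne0$ the form $\omega_t=i\partial\bar\partial f_t$ extends to a Kähler form on $H^2$, and $g_t(X,Y)=\omega_t(X,JY)$ is the Eguchi--Hanson metric ($J$ the complex structure); for $t=0$ the metric $g_0$ is degenerate along the zero section. For a smooth curve $\Gamma$ in $\mathbb C$ parametrized by Euclidean arc length, $M^3_\Gamma=p^{-1}(\Gamma)\subset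 H^2$ with the metric $h_t$ induced by $g_t$. For $t=0$ the manifold considered is $(M^3_\Gamma\cap M^4,h_0)$. $\Delta=-\mathrm{div}\,\mathrm{grad}$ is the scalar Laplacian.
   Formalization: "Arbitrary curves" is restricted to closed curves, or open curves both of whose ends have infinite length in the spherical metric |dx|/(1+|x|²); without this the claim fails, e.g. for Γ the real line and t=0. *)

theory Defs
  imports "HOL-Analysis.Analysis"
begin

subsection \<open>Smooth maps\<close>

primrec Ck_on :: "nat \<Rightarrow> 'a::real_normed_vector set \<Rightarrow> ('a \<Rightarrow> 'b::real_normed_vector) \<Rightarrow> bool" where
  "Ck_on 0 S f \<longleftrightarrow> continuous_on S f"
| "Ck_on (Suc k) S f \<longleftrightarrow> (\<forall>x\<in>S. f differentiable (at x)) \<and>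
     (\<forall>v. Ck_on k S (\<lambda>x. frechet_derivative f (at x) v))"

text \<open>The set \<open>S\<close> is meant to be open.\<close>

definition smooth_on :: "'a::real_normed_vector set \<Rightarrow> ('a \<Rightarrow> 'b::real_normed_vector) \<Rightarrow> bool" where
  "smooth_on S f \<longleftrightarrow> (\<forall>k. Ck_on k S f)"


subsection \<open>Riemannian metrics in a global coordinate system\<close>

text \<open>A metric on an open subset of \<open>real ^ 'n\<close> is given by its matrix \<open>G\<close> of coefficients.\<close>

definition pderiv_at :: "'n::finite \<Rightarrow> (real ^ 'n \<Rightarrow> real) \<Rightarrow> real ^ 'n \<Rightarrow> real" where
  "pderiv_at i f y = frechet_derivative f (at y) (axis i 1)"

definition vol_density :: "(real ^ 'n \<Rightarrow> real ^ 'n ^ 'n) \<Rightarrow> real ^ 'n::finite \<Rightarrow> real" where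
  "vol_density G y = sqrt (det (G y))"

definition riem_grad :: "(real ^ 'n \<Rightarrow> real ^ 'n ^ 'n) \<Rightarrow> (real ^ 'n \<Rightarrow> real) \<Rightarrow> real ^ 'n::finite \<Rightarrow> real ^ 'n" where
  "riem_grad G f y = matrix_inv (G y) *v (\<chi> j. pderiv_at j f y)"

definition riem_div :: "(real ^ 'n \<Rightarrow> real ^ 'n ^ 'n) \<Rightarrow> (real ^ 'n \<Rightarrow> real ^ 'n) \<Rightarrow> real ^ 'n::finite \<Rightarrow> real" where
  "riem_div G X y = (\<Sum>i\<in>UNIV. pderiv_at i (\<lambda>z. vol_density G z * X z $ i) y) / vol_density G y"

definition riem_laplacian :: "(real ^ 'n \<Rightarrow> real ^ 'n ^ 'n) \<Rightarrow> (real ^ 'n \<Rightarrow> real) \<Rightarrow> real ^ 'n::finite \<Rightarrow> real" where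
  "riem_laplacian G f y = - riem_div G (riem_grad G f) y"


subsection \<open>The space \<open>H\<^sup>2\<close>, the cotangent bundle of the projective line\<close>

definition h2_rel :: "complex \<times> complex \<times> complex \<Rightarrow> complex \<times> complex \<times> complex \<Rightarrow> bool" where
  "h2_rel = (\<lambda>(\<alpha>, \<beta>, \<gamma>) (\<alpha>', \<beta>', \<gamma>'). (\<alpha>, \<beta>) \<noteq> (0, 0) \<and>
     (\<exists>A. A \<noteq> 0 \<and> \<alpha>' = A * \<alpha> \<and> \<beta>' = A * \<beta> \<and> \<gamma>' = \<gamma> / A\<^sup>2))"

lemma part_equivp_h2_rel: "part_equivp h2_rel"
proof (rule part_equivpI)
  show "\<exists>x. h2_rel x x"
    by (rule exI[of _ "(1, 1, 0)"]) (auto simp: h2_rel_def intro!: exI[of _ 1])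
  show "symp h2_rel"
  proof (rule sympI)
    fix x y assume "h2_rel x y"
    then obtain a b g A where "x = (a, b, g)" "y = (A * a, A * b, g / A\<^sup>2)" "A \<noteq> 0" "(a, b) \<noteq> (0, 0)"
      by (cases x; cases y) (auto simp: h2_rel_def)
    then show "h2_rel y x"
      by (auto simp: h2_rel_def field_simps intro!: exI[of _ "inverse A"])
  qed
  show "transp h2_rel"
  proof (rule transpI)
    fix x y z assume xy: "h2_rel x y" and yz: "h2_rel y z"
    from xy obtain a b g A where x: "x = (a, b, g)" and y: "y = (A * a, A * b, g / A\<^sup>2)"
      and A: "A \<noteq> 0" "(a, b) \<noteq> (0, 0)"
      by (cases x; cases y) (auto simp: h2_rel_def)
    from yz obtain B where "z = (B * (A * a), B * (A * b), g / A\<^sup>2 / B\<^sup>2)" "B \<noteq> 0"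
      unfolding y by (cases z) (auto simp: h2_rel_def)
    with x A show "h2_rel x z"
      by (auto simp: h2_rel_def field_simps intro!: exI[of _ "B * A"])
  qed
qed

quotient_type h2 = "complex \<times> complex \<times> complex" / partial: h2_rel
  by (rule part_equivp_h2_rel)

text \<open>The projection to the Riemann sphere; \<open>None\<close> is the point at infinity.\<close>

lift_definition h2_proj :: "h2 \<Rightarrow> complex option" is
  "\<lambda>(\<alpha>, \<beta>, \<gamma>). if \<beta> = 0 then None else Some (\<alpha> / \<beta>)"
  by (auto simp: h2_rel_def)

lift_definition zero_section :: "h2 \<Rightarrow> bool" is "\<lambda>(\<alpha>, \<beta>, \<gamma>). \<gamma> = 0"
  by (auto simp: h2_rel_def)

lift_definition h2_u1 :: "h2 \<Rightarrow> real" is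
  "\<lambda>(\<alpha>, \<beta>, \<gamma>). (cmod (\<alpha> * csqrt \<gamma>))\<^sup>2 + (cmod (\<beta> * csqrt \<gamma>))\<^sup>2"
  by (auto simp: h2_rel_def norm_mult power_mult_distrib norm_divide norm_power field_simps
      simp flip: norm_power)

definition eh_potential :: "real \<Rightarrow> h2 \<Rightarrow> real" where
  "eh_potential t q = (let u = h2_u1 q; r = sqrt (u\<^sup>2 + t ^ 4) in r + t\<^sup>2 * ln (u / (r + t\<^sup>2)))"

text \<open>A holomorphic chart of \<open>H\<^sup>2\<close>, whose image is the preimage of the finite part
  of the sphere.\<close>

definition h2_chart :: "complex \<times> complex \<Rightarrow> h2" where
  "h2_chart = (\<lambda>(x, \<gamma>). abs_h2 (x, 1, \<gamma>))"


subsection \<open>The Eguchi-Hanson metric\<close>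

definition c2_basis :: "bool \<Rightarrow> complex \<times> complex" where
  "c2_basis j = (if j then (0, 1) else (1, 0))"

definition c2_coord :: "bool \<Rightarrow> complex \<times> complex \<Rightarrow> complex" where
  "c2_coord j = (if j then snd else fst)"

definition c2_J :: "complex \<times> complex \<Rightarrow> complex \<times> complex" where
  "c2_J = (\<lambda>(a, b). (\<i> * a, \<i> * b))"

text \<open>The Wirtinger operators for the two complex coordinates.\<close>

definition c2_del :: "bool \<Rightarrow> (complex \<times> complex \<Rightarrow> complex) \<Rightarrow> complex \<times> complex \<Rightarrow> complex" where
  "c2_del j f q = (frechet_derivative f (at q) (c2_basis j)
     - \<i> * frechet_derivative f (at q) (c2_J (c2_basis j))) / 2"

definition c2_delbar :: "bool \<Rightarrow> (complex \<times> complex \<Rightarrow> complex) \<Rightarrow> complex \<times> complex \<Rightarrow> complex" where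
  "c2_delbar j f q = (frechet_derivative f (at q) (c2_basis j)
     + \<i> * frechet_derivative f (at q) (c2_J (c2_basis j))) / 2"

text \<open>The two-form \<open>i\<close> del delbar \<open>f\<close> evaluated on two real tangent vectors, with the convention
  \<open>(\<xi> \<and> \<eta>)(X, Y) = \<xi> X * \<eta> Y - \<xi> Y * \<eta> X\<close>; its values are real if \<open>f\<close> is real.\<close>

definition i_ddbar :: "(complex \<times> complex \<Rightarrow> real) \<Rightarrow> complex \<times> complex \<Rightarrow>
    complex \<times> complex \<Rightarrow> complex \<times> complex \<Rightarrow> real" where
  "i_ddbar f q X Y = Re (\<i> * (\<Sum>j\<in>UNIV. \<Sum>k\<in>UNIV.
     c2_del j (c2_delbar k (\<lambda>z. complex_of_real (f z))) q *
     (c2_coord j X * cnj (c2_coord k Y) - c2_coord j Y * cnj (c2_coord k X))))"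

text \<open>The coefficients in the chart. The potential is singular along the zero section \<open>\<gamma> = 0\<close>;
  for \<open>t \<noteq> 0\<close> the form extends there continuously, and the extension is the limit. For \<open>t = 0\<close>
  the values on the zero section are never used.\<close>

definition eh_form :: "real \<Rightarrow> complex \<times> complex \<Rightarrow> complex \<times> complex \<Rightarrow> complex \<times> complex \<Rightarrow> real" where
  "eh_form t q X Y =
     (if snd q \<noteq> 0 then i_ddbar (\<lambda>z. eh_potential t (h2_chart z)) q X Y
      else Lim (at q within {z. snd z \<noteq> 0})
             (\<lambda>z. i_ddbar (\<lambda>z'. eh_potential t (h2_chart z')) z X Y))"

definition eh_metric :: "real \<Rightarrow> complex \<times> complex \<Rightarrow> complex \<times> complex \<Rightarrow> complex \<times> complex \<Rightarrow> real" where
  "eh_metric t q X Y = eh_form t q X (c2_J Y)"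


subsection \<open>Curves\<close>

definition unit_speed_curve :: "(real \<Rightarrow> complex) \<Rightarrow> bool" where
  "unit_speed_curve c \<longleftrightarrow> smooth_on UNIV c \<and> (\<forall>s. norm (vector_derivative c (at s)) = 1)"

text \<open>Both ends have infinite length in the spherical metric \<open>|dx| / (1 + |x|\<^sup>2)\<close>
  of the projective line. Without this, an open curve bounds the hypersurface by missing fibres at
  finite distance, and nonzero \<open>L\<^sup>p\<close>-harmonic functions exist for large \<open>p\<close>.\<close>

definition spherically_complete :: "(real \<Rightarrow> complex) \<Rightarrow> bool" where
  "spherically_complete c \<longleftrightarrow>
     filterlim (\<lambda>r. integral {0..r} (\<lambda>s. 1 / (1 + (cmod (c s))\<^sup>2))) at_top at_top \<and>
     filterlim (\<lambda>r. integral {-r..0} (\<lambda>s. 1 / (1 + (cmod (c s))\<^sup>2))) at_top at_top"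

text \<open>A fundamental domain for the translation by \<open>T\<close>. A period \<open>T > 0\<close> stands for a closed curve of
  length \<open>T\<close>, given as a \<open>T\<close>-periodic map; \<open>T = 0\<close> stands for an open curve.\<close>

definition fund_domain :: "real \<Rightarrow> real set" where
  "fund_domain T = (if T = 0 then UNIV else {0..<T})"


subsection \<open>The hypersurfaces\<close>

text \<open>The curve may have self-intersections, so the hypersurface is taken as an immersed one: a
  point is a parameter \<open>s\<close> of the curve with a point of \<open>H\<^sup>2\<close> over \<open>c s\<close>, where for a closed curve
  \<open>s\<close> counts modulo \<open>T\<close> (see \<open>hyp_function\<close>). For a simple curve \<open>snd\<close> identifies it with
  the preimage of the curve in \<open>H\<^sup>2\<close> (see \<open>bij_betw_hypersurface\<close>). For \<open>t = 0\<close>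
  the zero section is removed.\<close>

definition hypersurface :: "(real \<Rightarrow> complex) \<Rightarrow> real \<Rightarrow> (real \<times> h2) set" where
  "hypersurface c t = {(s, q). h2_proj q = Some (c s) \<and> (t = 0 \<longrightarrow> \<not> zero_section q)}"

definition hyp_immersion :: "(real \<Rightarrow> complex) \<Rightarrow> real ^ 3 \<Rightarrow> complex \<times> complex" where
  "hyp_immersion c y = (c (y $ 1), Complex (y $ 2) (y $ 3))"

text \<open>Global coordinates: the arc length of the curve and the two real coordinates of the fibre.\<close>

definition hyp_param :: "(real \<Rightarrow> complex) \<Rightarrow> real ^ 3 \<Rightarrow> real \<times> h2" where
  "hyp_param c y = (y $ 1, h2_chart (hyp_immersion c y))"

definition hyp_coords :: "(real \<Rightarrow> complex) \<Rightarrow> real \<Rightarrow> (real ^ 3) set" where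
  "hyp_coords c t = {y. hyp_param c y \<in> hypersurface c t}"

definition hyp_metric :: "(real \<Rightarrow> complex) \<Rightarrow> real \<Rightarrow> real ^ 3 \<Rightarrow> real ^ 3 ^ 3" where
  "hyp_metric c t y = (\<chi> i j. eh_metric t (hyp_immersion c y)
     (frechet_derivative (hyp_immersion c) (at y) (axis i 1))
     (frechet_derivative (hyp_immersion c) (at y) (axis j 1)))"

text \<open>Invariance under the period, so that \<open>w\<close> lives on the hypersurface over the closed curve;
  no condition if \<open>T = 0\<close>.\<close>

definition hyp_function :: "real \<Rightarrow> (real \<Rightarrow> complex) \<Rightarrow> real \<Rightarrow> (real \<times> h2 \<Rightarrow> real) \<Rightarrow> bool" where
  "hyp_function T c t w \<longleftrightarrow> (\<forall>(s, q) \<in> hypersurface c t. w (s + T, q) = w (s, q))"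

definition hyp_smooth :: "(real \<Rightarrow> complex) \<Rightarrow> real \<Rightarrow> (real \<times> h2 \<Rightarrow> real) \<Rightarrow> bool" where
  "hyp_smooth c t w \<longleftrightarrow> smooth_on (hyp_coords c t) (w \<circ> hyp_param c)"

definition hyp_harmonic :: "(real \<Rightarrow> complex) \<Rightarrow> real \<Rightarrow> (real \<times> h2 \<Rightarrow> real) \<Rightarrow> bool" where
  "hyp_harmonic c t w \<longleftrightarrow>
     (\<forall>y \<in> hyp_coords c t. riem_laplacian (hyp_metric c t) (w \<circ> hyp_param c) y = 0)"

definition hyp_Lp :: "real \<Rightarrow> real \<Rightarrow> (real \<Rightarrow> complex) \<Rightarrow> real \<Rightarrow> (real \<times> h2 \<Rightarrow> real) \<Rightarrow> bool" where
  "hyp_Lp p T c t w \<longleftrightarrow>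
     (\<integral>\<^sup>+ y \<in> {y \<in> hyp_coords c t. y $ 1 \<in> fund_domain T}.
        ennreal (\<bar>w (hyp_param c y)\<bar> powr p * vol_density (hyp_metric c t) y) \<partial>lborel) < \<infinity>"


subsection \<open>Basic facts\<close>

lemma h2_rel_refl [simp]: "h2_rel (a, b, g) (a, b, g) \<longleftrightarrow> (a, b) \<noteq> (0, 0)"
  by (auto simp: h2_rel_def intro!: exI[of _ 1])

lemma h2_rel_chart [simp]: "h2_rel (x, 1, g) (x', 1, g') \<longleftrightarrow> x = x' \<and> g = g'"
  by (auto simp: h2_rel_def intro!: exI[of _ 1])

lemma h2_chart_eq_iff [simp]: "h2_chart q = h2_chart q' \<longleftrightarrow> q = q'"
  using Quotient3_rel[OF Quotient3_h2, of "(fst q, 1, snd q)" "(fst q', 1, snd q')"]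
  by (simp add: h2_chart_def case_prod_beta prod_eq_iff)

lemma h2_proj_chart [simp]: "h2_proj (h2_chart (x, g)) = Some x"
  by (simp add: h2_chart_def h2_proj.abs_eq eq_onp_def)

lemma zero_section_chart [simp]: "zero_section (h2_chart (x, g)) \<longleftrightarrow> g = 0"
  by (simp add: h2_chart_def zero_section.abs_eq)

lemma h2_u1_chart: "h2_u1 (h2_chart (x, g)) = cmod g * (1 + (cmod x)\<^sup>2)"
proof -
  have "(cmod (csqrt g))\<^sup>2 = cmod g"
    by (metis norm_power power2_csqrt)
  then show ?thesis
    by (simp add: h2_chart_def h2_u1.abs_eq norm_mult power_mult_distrib algebra_simps)
qed

lemma h2_proj_eq_Some_iff: "h2_proj q = Some x \<longleftrightarrow> (\<exists>g. q = h2_chart (x, g))"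
proof
  assume q: "h2_proj q = Some x"
  obtain a b g where abg: "q = abs_h2 (a, b, g)" "h2_rel (a, b, g) (a, b, g)"
    using Quotient3_abs_rep[OF Quotient3_h2, of q] Quotient3_rep_reflp[OF Quotient3_h2, of q]
    by (metis prod_cases3)
  have b: "b \<noteq> 0" "x = a / b"
    using q abg by (auto simp: h2_proj.abs_eq split: if_splits)
  have "h2_rel (a, b, g) (x, 1, g * b\<^sup>2)"
    using b by (auto simp: h2_rel_def field_simps intro!: exI[of _ "inverse b"])
  then have "q = h2_chart (x, g * b\<^sup>2)"
    using Quotient3_rel_abs[OF Quotient3_h2] abg by (auto simp: h2_chart_def)
  then show "\<exists>g. q = h2_chart (x, g)" ..
qed auto

lemma hyp_coords_eq: "hyp_coords c t = (if t = 0 then {y. y $ 2 \<noteq> 0 \<or> y $ 3 \<noteq> 0} else UNIV)"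
  by (auto simp: hyp_coords_def hypersurface_def hyp_param_def hyp_immersion_def complex_eq_iff)

lemma bij_betw_hyp_param: "bij_betw (hyp_param c) (hyp_coords c t) (hypersurface c t)"
proof (rule bij_betw_imageI)
  show "inj_on (hyp_param c) (hyp_coords c t)"
    by (auto simp: inj_on_def hyp_param_def hyp_immersion_def vec_eq_iff forall_3)
  show "hyp_param c ` hyp_coords c t = hypersurface c t"
  proof (intro equalityI subsetI)
    fix m assume m: "m \<in> hypersurface c t"
    then obtain s g where sg: "m = (s, h2_chart (c s, g))"
      by (auto simp: hypersurface_def h2_proj_eq_Some_iff)
    have "m = hyp_param c (vector [s, Re g, Im g])"
      by (simp add: sg hyp_param_def hyp_immersion_def)
    with m show "m \<in> hyp_param c ` hyp_coords c t"
      by (auto simp: hyp_coords_def)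
  qed (auto simp: hyp_coords_def)
qed

lemma bij_betw_hypersurface:
  assumes "inj_on c (fund_domain T)"
  shows "bij_betw snd {m \<in> hypersurface c t. fst m \<in> fund_domain T}
    {q. h2_proj q \<in> Some ` c ` fund_domain T \<and> (t = 0 \<longrightarrow> \<not> zero_section q)}"
proof (rule bij_betw_imageI)
  show "inj_on snd {m \<in> hypersurface c t. fst m \<in> fund_domain T}"
    using assms by (auto simp: inj_on_def hypersurface_def)
  show "snd ` {m \<in> hypersurface c t. fst m \<in> fund_domain T} =
      {q. h2_proj q \<in> Some ` c ` fund_domain T \<and> (t = 0 \<longrightarrow> \<not> zero_section q)}"
    by (force simp: hypersurface_def)
qed

end

theory Submission
  imports Defs
begin

text \<open>On the hypersurface over the curve \<open>c\<close> put \<open>P = 1 + |c|\<^sup>2\<close>. Parametrizing the curve by its spherical arc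
  length \<open>x\<close> and the fibre by a horizontally transported coordinate \<open>\<gamma> = exp (2 * y + \<i> * z) / P\<close>, the
  metric becomes independent of the curve and of \<open>x\<close>, and with \<open>k = (exp (4 * y) + t ^ 4) powr (1 / 4)\<close>
  the Laplace equation reads
  \<open>exp (4 * y) / k ^ 3 * w\<^sub>x\<^sub>x + (k * w\<^sub>y)\<^sub>y + 4 * k * w\<^sub>z\<^sub>z = 0\<close>, the volume density being a multiple of
  \<open>exp (4 * y) / k\<close>. Only the complement of the zero section is used.

  For \<open>t \<noteq> 0\<close> take a convex \<open>F\<close> with \<open>F w \<le> |w| powr p\<close>, so that \<open>F w\<close> is subharmonic; testing it against
  cut-offs in \<open>x\<close> (length \<open>n\<close>) and \<open>y\<close> (length \<open>N\<close>), with \<open>N\<close> going to infinity before \<open>n\<close>, the error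
  is dominated by the integral of \<open>|w| powr p\<close>, so the gradient vanishes; here a neighbourhood of the zero section
  costs nothing because \<open>w\<close> is bounded near it.

  For \<open>t = 0\<close> the metric is a cone over a flat surface and the vertex matters. With \<open>a = 3 / p\<close> the function
  \<open>v = exp (a * y) * w\<close> lies in \<open>L\<^sup>p\<close> for the Lebesgue measure and satisfies
  \<open>v\<^sub>x\<^sub>x + v\<^sub>y\<^sub>y + (1 - 2 * a) * v\<^sub>y + 4 * v\<^sub>z\<^sub>z = (a - a\<^sup>2) * v\<close>. If \<open>p \<ge> 3\<close>, then \<open>a - a\<^sup>2 \<ge> 0\<close> and
  the convexity argument applies. If \<open>p < 3\<close>, multiply by \<open>v\<^sub>y\<close>: all terms but \<open>(1 - 2 * a) * v\<^sub>y\<^sup>2\<close> are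
  divergences, and since \<open>z\<close> is an angle the volume grows only quadratically, so that the boundary terms vanish in the
  limit. This needs a bound on \<open>v\<^sup>2\<close>, which for \<open>p < 2\<close> is obtained after averaging \<open>v\<close> over small boxes.\<close>

text \<open>In the chart the metric is \<open>2 * (r / P^2 * ds^2 + P^2 / (4 * r) * |d\<gamma> + (k1
  + i * k2) * \<gamma> * ds|^2)\<close> with \<open>r = k^2\<close>. Putting
  \<open>ds = P * dx\<close> removes \<open>1 / P^2\<close> from the first term, and the transport
  of the fibre coordinate removes the connection term, leaving
  \<open>2 * (k^2 * dx^2 + exp (4 * y) / k^2 * (dy^2 + dz^2 / 4))\<close>. Spherical completeness of
  the curve makes \<open>x\<close> run over the whole line. The obstacle is the end where
  \<open>y\<close> tends to minus infinity. For nonzero \<open>t\<close> the density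
  \<open>exp (4 * y) / k\<close> decays there while the coefficient \<open>k\<close> of the second
  \<open>y\<close>-derivative does not, so the cut-off error in \<open>y\<close> is controlled by a
  pointwise bound on \<open>w\<close> that depends on the range of \<open>x\<close>; this dictates
  the order of the two limits. For \<open>t = 0\<close> the density is a multiple of
  \<open>exp (3 * y)\<close>, whence the weight with \<open>a = 3 / p\<close>. It makes the density
  constant at the price of the zero-order coefficient \<open>a - a^2\<close>, whose sign changes at
  \<open>p = 3\<close>; below that value the drift \<open>2 * a - 1\<close> is positive, and it
  takes over the role of the convexity.\<close>

subsection \<open>Directional derivatives and averages\<close>

text \<open>A relation for a single direction \<open>e\<close>, so that derivatives of every order
  are carried as named functions. Identities between them then come from differentiating one
  function in two ways and applying \<open>dir_deriv_unique\<close>.\<close>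

definition dir_deriv :: "'a::real_normed_vector \<Rightarrow> ('a \<Rightarrow> real) \<Rightarrow> ('a \<Rightarrow> real) \<Rightarrow> bool" where
  "dir_deriv e f f' \<longleftrightarrow> (\<forall>q. ((\<lambda>h. f (q + h *\<^sub>R e)) has_real_derivative f' q) (at 0))"

lemma dir_derivD:
  assumes "dir_deriv e f f'"
  shows "((\<lambda>h. f (q + h *\<^sub>R e)) has_real_derivative f' (q + s *\<^sub>R e)) (at s)"
proof -
  have "((\<lambda>h. f ((q + s *\<^sub>R e) + h *\<^sub>R e)) has_real_derivative f' (q + s *\<^sub>R e)) (at 0)"
    using assms by (simp add: dir_deriv_def)
  then have "((\<lambda>h. f (q + (h + s) *\<^sub>R e)) has_real_derivative f' (q + s *\<^sub>R e)) (at 0)"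
    by (simp add: algebra_simps)
  then show ?thesis
    using DERIV_shift[of "\<lambda>h. f (q + h *\<^sub>R e)" "f' (q + s *\<^sub>R e)" 0 s] by simp
qed

lemma dir_deriv_const: "dir_deriv e (\<lambda>q. c) (\<lambda>q. 0)"
  by (simp add: dir_deriv_def)

lemma dir_deriv_add:
  "dir_deriv e f f' \<Longrightarrow> dir_deriv e g g' \<Longrightarrow> dir_deriv e (\<lambda>q. f q + g q) (\<lambda>q. f' q + g' q)"
  unfolding dir_deriv_def by (auto intro!: derivative_eq_intros)

lemma dir_deriv_diff:
  "dir_deriv e f f' \<Longrightarrow> dir_deriv e g g' \<Longrightarrow> dir_deriv e (\<lambda>q. f q - g q) (\<lambda>q. f' q - g' q)"
  unfolding dir_deriv_def by (auto intro!: derivative_eq_intros)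

lemma dir_deriv_mult:
  assumes "dir_deriv e f f'" "dir_deriv e g g'"
  shows "dir_deriv e (\<lambda>q. f q * g q) (\<lambda>q. f' q * g q + f q * g' q)"
  unfolding dir_deriv_def
proof
  fix q
  show "((\<lambda>h. f (q + h *\<^sub>R e) * g (q + h *\<^sub>R e)) has_real_derivative f' q * g q + f q * g' q) (at 0)"
    using assms unfolding dir_deriv_def
    by (auto intro!: derivative_eq_intros dest!: spec[of _ q])
qed

lemma dir_deriv_compose:
  assumes "dir_deriv e f f'" "\<And>x. (F has_real_derivative F' x) (at x)"
  shows "dir_deriv e (\<lambda>q. F (f q)) (\<lambda>q. F' (f q) * f' q)"
  unfolding dir_deriv_def
proof
  fix q
  show "((\<lambda>h. F (f (q + h *\<^sub>R e))) has_real_derivative F' (f q) * f' q) (at 0)"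
    using assms(1) DERIV_chain2[of F "F' (f q)" "\<lambda>h. f (q + h *\<^sub>R e)" 0 "f' q" UNIV] assms(2)
    unfolding dir_deriv_def by simp
qed

lemma dir_deriv_shift:
  "dir_deriv e f f' \<Longrightarrow> dir_deriv e (\<lambda>q. f (q + d)) (\<lambda>q. f' (q + d))"
  unfolding dir_deriv_def by (subst add.assoc, subst add.commute[of _ d], subst add.assoc[symmetric]) simp

lemma dir_deriv_eq: "dir_deriv e f f' \<Longrightarrow> (\<And>q. f' q = g' q) \<Longrightarrow> dir_deriv e f g'"
  by (simp add: dir_deriv_def)

lemma dir_deriv_unique: "dir_deriv e f f' \<Longrightarrow> dir_deriv e f g' \<Longrightarrow> f' = g'"
  unfolding dir_deriv_def by (meson DERIV_unique ext)

abbreviation dx :: "real \<times> real \<times> real" where "dx \<equiv> (1, 0, 0)"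
abbreviation dy :: "real \<times> real \<times> real" where "dy \<equiv> (0, 1, 0)"
abbreviation dz :: "real \<times> real \<times> real" where "dz \<equiv> (0, 0, 1)"

lemma dir_deriv_coord:
  assumes "\<And>x. (A has_real_derivative A' x) (at x)"
  shows "dir_deriv dx (\<lambda>q. A (fst q)) (\<lambda>q. A' (fst q))"
    "dir_deriv dy (\<lambda>q. A (fst (snd q))) (\<lambda>q. A' (fst (snd q)))"
    "dir_deriv dx (\<lambda>q. A (fst (snd q))) (\<lambda>q. 0)"
    "dir_deriv dy (\<lambda>q. A (fst q)) (\<lambda>q. 0)"
    "dir_deriv dz (\<lambda>q. A (fst q)) (\<lambda>q. 0)"
    "dir_deriv dz (\<lambda>q. A (fst (snd q))) (\<lambda>q. 0)"
proof -
  have "((\<lambda>h. A (x + h)) has_real_derivative A' x) (at 0)" for x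
    using DERIV_shift[of A "A' x" 0 x] assms[of x] by (simp add: add.commute)
  then show "dir_deriv dx (\<lambda>q. A (fst q)) (\<lambda>q. A' (fst q))"
    "dir_deriv dy (\<lambda>q. A (fst (snd q))) (\<lambda>q. A' (fst (snd q)))"
    "dir_deriv dx (\<lambda>q. A (fst (snd q))) (\<lambda>q. 0)"
    "dir_deriv dy (\<lambda>q. A (fst q)) (\<lambda>q. 0)"
    "dir_deriv dz (\<lambda>q. A (fst q)) (\<lambda>q. 0)"
    "dir_deriv dz (\<lambda>q. A (fst (snd q))) (\<lambda>q. 0)"
    by (auto simp: dir_deriv_def)
qed

text \<open>A primitive of \<open>f\<close> along \<open>e\<close>; for small \<open>h\<close> it is a Steklov average, used as a mollifier that
  commutes with all derivatives.\<close>

definition steklov :: "real \<Rightarrow> 'a::real_normed_vector \<Rightarrow> ('a \<Rightarrow> real) \<Rightarrow> 'a \<Rightarrow> real" where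
  "steklov h e f q = integral {0..h} (\<lambda>s. f (q + s *\<^sub>R e))"

lemma continuous_steklov_integrand:
  fixes f :: "'a::real_normed_vector \<Rightarrow> real"
  assumes "continuous_on UNIV f"
  shows "continuous_on S (\<lambda>s. f (q + s *\<^sub>R e))"
  by (rule continuous_on_compose2[OF assms]) (auto intro!: continuous_intros)

lemma continuous_steklov:
  fixes f :: "'a::real_normed_vector \<Rightarrow> real"
  assumes "continuous_on UNIV f"
  shows "continuous_on UNIV (steklov h e f)"
proof -
  have "continuous_on UNIV (\<lambda>q. integral (cbox 0 h) (\<lambda>s. f (q + s *\<^sub>R e)))"
    by (rule integral_continuous_on_param)
      (auto intro!: continuous_intros continuous_on_compose2[OF assms] simp: split_beta)
  then show ?thesis by (simp add: steklov_def[abs_def])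
qed

lemma dir_deriv_steklov:
  assumes d: "dir_deriv d f f'" and c: "continuous_on UNIV f" "continuous_on UNIV f'"
  shows "dir_deriv d (steklov h e f) (steklov h e f')"
  unfolding dir_deriv_def
proof
  fix q
  have "((\<lambda>r. integral (cbox 0 h) (\<lambda>s. f (q + r *\<^sub>R d + s *\<^sub>R e))) has_real_derivative
      integral (cbox 0 h) (\<lambda>s. f' (q + 0 *\<^sub>R d + s *\<^sub>R e))) (at 0 within UNIV)"
  proof (rule leibniz_rule_field_derivative)
    show "((\<lambda>r. f (q + r *\<^sub>R d + s *\<^sub>R e)) has_real_derivative f' (q + r *\<^sub>R d + s *\<^sub>R e)) (at r within UNIV)" for r s
      using dir_derivD[OF d, of "q + s *\<^sub>R e" r] by (simp add: ac_simps)
    show "(\<lambda>s. f (q + r *\<^sub>R d + s *\<^sub>R e)) integrable_on cbox 0 h" for r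
      by (intro integrable_continuous continuous_steklov_integrand c)
    show "continuous_on (UNIV \<times> cbox 0 h) (\<lambda>(r, s). f' (q + r *\<^sub>R d + s *\<^sub>R e))"
      by (auto intro!: continuous_intros continuous_on_compose2[OF c(2)] simp: split_beta)
  qed auto
  then show "((\<lambda>r. steklov h e f (q + r *\<^sub>R d)) has_real_derivative steklov h e f' q) (at 0)"
    by (simp add: steklov_def)
qed

lemma steklov_derivative:
  assumes d: "dir_deriv e f f'" and "0 \<le> h"
  shows "steklov h e f' q = f (q + h *\<^sub>R e) - f q"
proof -
  have "((\<lambda>s. f' (q + s *\<^sub>R e)) has_integral (f (q + h *\<^sub>R e) - f (q + 0 *\<^sub>R e))) {0..h}"
    using assms dir_derivD[OF d]
    by (intro fundamental_theorem_of_calculus)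
      (auto simp: has_real_derivative_iff_has_vector_derivative[symmetric] intro: DERIV_subset)
  then show ?thesis by (simp add: steklov_def integral_unique)
qed

text \<open>\<open>f q\<close> is the one-sided derivative at \<open>h = 0\<close> of the primitive,
  so what is proved for all small averages returns to the function itself.\<close>

lemma steklov_eq_0_imp:
  fixes f :: "'a::real_normed_vector \<Rightarrow> real"
  assumes c: "continuous_on UNIV f" and 0: "\<And>h. 0 < h \<Longrightarrow> h \<le> 1 \<Longrightarrow> steklov h e f q = 0"
  shows "f q = 0"
proof -
  have "((\<lambda>h. integral {0..h} (\<lambda>s. f (q + s *\<^sub>R e))) has_real_derivative f (q + 0 *\<^sub>R e)) (at 0 within {0..1})"
    by (intro integral_has_real_derivative continuous_steklov_integrand c) auto
  moreover have "((\<lambda>h. integral {0..h} (\<lambda>s. f (q + s *\<^sub>R e))) has_vector_derivative 0) (at 0 within {0..1})"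
  proof (rule has_vector_derivative_transform[where f="\<lambda>h. 0"])
    show "integral {0..h} (\<lambda>s. f (q + s *\<^sub>R e)) = 0" if "h \<in> {0..1}" for h
      using that 0[of h] by (cases "h = 0") (auto simp: steklov_def)
  qed auto
  moreover have "at 0 within {0..1::real} \<noteq> bot"
    by (simp add: at_within_Icc_at_right)
  ultimately show ?thesis
    using vector_derivative_unique_within[of 0 "{0..1}" "\<lambda>h. integral {0..h} (\<lambda>s. f (q + s *\<^sub>R e))" "f q" 0]
    by (simp add: has_real_derivative_iff_has_vector_derivative)
qed

text \<open>Both averages along \<open>e\<close> are the same difference: that of \<open>fde\<close>
  is \<open>fd (q + h *\<^sub>R e) - fd q\<close> by the fundamental theorem of calculus, and that
  of \<open>fed\<close> is the \<open>d\<close>-derivative of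
  \<open>f (q + h *\<^sub>R e) - f q\<close>.\<close>

lemma dir_deriv_mixed:
  fixes f :: "'a::real_normed_vector \<Rightarrow> real"
  assumes "dir_deriv d f fd" "dir_deriv e f fe" "dir_deriv e fd fde" "dir_deriv d fe fed"
    and c: "continuous_on UNIV fe" "continuous_on UNIV fde" "continuous_on UNIV fed"
  shows "fde = fed"
proof
  fix q
  have "fde q - fed q = 0"
  proof (rule steklov_eq_0_imp[where e=e])
    show "continuous_on UNIV (\<lambda>q. fde q - fed q)"
      by (intro continuous_intros c)
    fix h :: real assume h: "0 < h"
    have "steklov h e fe = (\<lambda>q. f (q + h *\<^sub>R e) - f q)"
      using steklov_derivative[OF assms(2)] h by auto
    then have "dir_deriv d (steklov h e fe) (\<lambda>q. fd (q + h *\<^sub>R e) - fd q)"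
      using dir_deriv_diff[OF dir_deriv_shift[OF assms(1)] assms(1)] by simp
    moreover have "dir_deriv d (steklov h e fe) (steklov h e fed)"
      by (intro dir_deriv_steklov assms c)
    ultimately have "steklov h e fed q = fd (q + h *\<^sub>R e) - fd q"
      using dir_deriv_unique by metis
    moreover have "steklov h e fde q = fd (q + h *\<^sub>R e) - fd q"
      using h by (simp add: steklov_derivative[OF assms(3)])
    ultimately show "steklov h e (\<lambda>q. fde q - fed q) q = 0"
      using c by (simp add: steklov_def integral_diff integrable_continuous_interval continuous_steklov_integrand)
  qed
  then show "fde q = fed q" by simp
qed

section \<open>Iterated integrals over boxes and vanishing fluxes\<close>

lemma integral_triple:
  fixes f :: "real \<times> real \<times> real \<Rightarrow> real"
  assumes "continuous_on UNIV f"
  shows "integral (cbox (a1, a2, a3) (b1, b2, b3)) f =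
    integral {a1..b1} (\<lambda>x. integral {a2..b2} (\<lambda>y. integral {a3..b3} (\<lambda>z. f (x, y, z))))"
proof -
  have c: "continuous_on S f" for S using assms continuous_on_subset by blast
  have "integral (cbox (a2, a3) (b2, b3)) (\<lambda>w. f (x, w)) =
      integral {a2..b2} (\<lambda>y. integral {a3..b3} (\<lambda>z. f (x, y, z)))" for x
    by (subst integral_prod_continuous) (auto intro!: continuous_on_compose2[OF assms] continuous_intros)
  then show ?thesis
    by (subst integral_prod_continuous) (auto intro!: c)
qed

text \<open>Each flux lemma needs its own direction innermost, so that the fundamental theorem of
  calculus applies before the other integrations.\<close>

lemma integral_triple_x:
  fixes f :: "real \<times> real \<times> real \<Rightarrow> real"
  assumes "continuous_on UNIV f"
  shows "integral (cbox (a1, a2, a3) (b1, b2, b3)) f =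
    integral (cbox (a2, a3) (b2, b3)) (\<lambda>w. integral {a1..b1} (\<lambda>x. f (x, w)))"
proof -
  have c: "continuous_on S f" for S using assms continuous_on_subset by blast
  show ?thesis
    by (subst integral_prod_continuous, rule c, subst integral_swap_continuous)
      (auto intro!: c simp: split_beta)
qed

lemma integral_triple_y:
  fixes f :: "real \<times> real \<times> real \<Rightarrow> real"
  assumes "continuous_on UNIV f"
  shows "integral (cbox (a1, a2, a3) (b1, b2, b3)) f =
    integral {a1..b1} (\<lambda>x. integral {a3..b3} (\<lambda>z. integral {a2..b2} (\<lambda>y. f (x, y, z))))"
proof -
  have "integral {a2..b2} (\<lambda>y. integral {a3..b3} (\<lambda>z. f (x, y, z))) =
      integral {a3..b3} (\<lambda>z. integral {a2..b2} (\<lambda>y. f (x, y, z)))" for x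
    using integral_swap_continuous[of a2 a3 b2 b3 "\<lambda>y z. f (x, y, z)"]
    by (simp add: split_beta continuous_on_compose2[OF assms] continuous_intros)
  then show ?thesis by (simp add: integral_triple[OF assms])
qed

lemma integral_dir_deriv_eq_0:
  assumes d: "dir_deriv e f f'" and c: "continuous_on UNIV f'"
    and ends: "f (q + a *\<^sub>R e) = f (q + b *\<^sub>R e)"
  shows "integral {a..b} (\<lambda>s. f' (q + s *\<^sub>R e)) = 0"
proof (cases "a \<le> b")
  case True
  then have "((\<lambda>s. f' (q + s *\<^sub>R e)) has_integral (f (q + b *\<^sub>R e) - f (q + a *\<^sub>R e))) {a..b}"
    using dir_derivD[OF d]
    by (intro fundamental_theorem_of_calculus)
      (auto simp: has_real_derivative_iff_has_vector_derivative[symmetric] intro: DERIV_subset)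
  then show ?thesis by (simp add: integral_unique ends)
qed auto

lemma flux_x:
  assumes d: "dir_deriv dx f f'" and c: "continuous_on UNIV f'"
    and "\<And>y z. f (a1, y, z) = f (b1, y, z)"
  shows "integral (cbox (a1, a2, a3) (b1, b2, b3)) f' = 0"
proof -
  have "integral {a1..b1} (\<lambda>x. f' (x, w)) = 0" for w
    using integral_dir_deriv_eq_0[OF d c, of "(0, w)" a1 b1] assms(3) by (cases w) simp
  then show ?thesis by (simp add: integral_triple_x[OF c])
qed

lemma flux_y:
  assumes d: "dir_deriv dy f f'" and c: "continuous_on UNIV f'"
    and "\<And>x z. f (x, a2, z) = f (x, b2, z)"
  shows "integral (cbox (a1, a2, a3) (b1, b2, b3)) f' = 0"
proof -
  have "integral {a2..b2} (\<lambda>y. f' (x, y, z)) = 0" for x z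
    using integral_dir_deriv_eq_0[OF d c, of "(x, 0, z)" a2 b2] assms(3) by simp
  then show ?thesis by (simp add: integral_triple_y[OF c])
qed

lemma flux_z:
  assumes d: "dir_deriv dz f f'" and c: "continuous_on UNIV f'"
    and "\<And>x y. f (x, y, a3) = f (x, y, b3)"
  shows "integral (cbox (a1, a2, a3) (b1, b2, b3)) f' = 0"
proof -
  have "integral {a3..b3} (\<lambda>z. f' (x, y, z)) = 0" for x y
    using integral_dir_deriv_eq_0[OF d c, of "(x, y, 0)" a3 b3] assms(3) by simp
  then show ?thesis by (simp add: integral_triple[OF c])
qed

subsection \<open>Cut-off functions and integration by parts on a slab\<close>

text \<open>The exponent 3 is the least one that makes the truncated polynomial twice continuously
  differentiable. It also makes the squared first derivative at most a multiple of the function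
  itself, which allows a cross term to be absorbed in the energy estimate.\<close>

definition bump :: "real \<Rightarrow> real \<Rightarrow> real" where
  "bump X x = (max 0 (1 - (x / X)\<^sup>2)) ^ 3"

definition bump1 :: "real \<Rightarrow> real \<Rightarrow> real" where
  "bump1 X x = - 6 * x / X\<^sup>2 * (max 0 (1 - (x / X)\<^sup>2))\<^sup>2"

definition bump2 :: "real \<Rightarrow> real \<Rightarrow> real" where
  "bump2 X x = - 6 / X\<^sup>2 * (max 0 (1 - (x / X)\<^sup>2))\<^sup>2 + 24 * x\<^sup>2 / X ^ 4 * max 0 (1 - (x / X)\<^sup>2)"

lemma DERIV_pos_part_power:
  "((\<lambda>x::real. (max 0 x) ^ Suc (Suc n)) has_real_derivative real (Suc (Suc n)) * (max 0 x) ^ Suc n) (at x)"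
proof -
  consider "x > 0" | "x < 0" | "x = 0" by linarith
  then show ?thesis
  proof cases
    case 1
    have "((\<lambda>x::real. x ^ Suc (Suc n)) has_real_derivative real (Suc (Suc n)) * x ^ Suc n) (at x)"
      using DERIV_pow[of "Suc (Suc n)" x] by simp
    then have "((\<lambda>x::real. (max 0 x) ^ Suc (Suc n)) has_real_derivative real (Suc (Suc n)) * x ^ Suc n) (at x)"
      by (rule has_field_derivative_transform_within_open[where S="{0<..}"]) (use 1 in auto)
    then show ?thesis using 1 by (simp add: max_def)
  next
    case 2
    have "((\<lambda>x::real. 0) has_real_derivative 0) (at x)" by simp
    then have "((\<lambda>x::real. (max 0 x) ^ Suc (Suc n)) has_real_derivative 0) (at x)"
      by (rule has_field_derivative_transform_within_open[where S="{..<0}"]) (use 2 in auto)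
    then show ?thesis using 2 by (simp add: max_def)
  next
    case 3
    have lim: "((\<lambda>h::real. \<bar>h\<bar> ^ Suc n) \<longlongrightarrow> 0) (at 0)"
      by (rule tendsto_eq_intros refl)+ simp
    have le: "norm (max 0 h ^ Suc (Suc n) / h) \<le> \<bar>h\<bar> ^ Suc n" for h :: real
      by (cases "h > 0") (simp_all add: mult_le_0_iff)
    have "((\<lambda>h::real. max 0 h ^ Suc (Suc n) / h) \<longlongrightarrow> 0) (at 0)"
      by (rule Lim_null_comparison[OF always_eventually lim]) (use le in blast)
    then show ?thesis using 3 by (simp add: DERIV_def)
  qed
qed

lemma DERIV_bump:
  "(bump X has_real_derivative bump1 X x) (at x)"
  "(bump1 X has_real_derivative bump2 X x) (at x)"
proof -
  have i: "((\<lambda>x. 1 - (x / X)\<^sup>2) has_real_derivative - 2 * x / X\<^sup>2) (at x)"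
    by (cases "X = 0") (auto intro!: derivative_eq_intros simp: power2_eq_square)
  have 3: "((\<lambda>x. (max 0 (1 - (x / X)\<^sup>2)) ^ 3) has_real_derivative
      (3 * (max 0 (1 - (x / X)\<^sup>2))\<^sup>2) * (- 2 * x / X\<^sup>2)) (at x)"
    using DERIV_chain2[OF DERIV_pos_part_power[of 1 "1 - (x / X)\<^sup>2"] i]
    by (simp add: numeral_3_eq_3 numeral_2_eq_2)
  have 2: "((\<lambda>x. (max 0 (1 - (x / X)\<^sup>2))\<^sup>2) has_real_derivative
      (2 * (max 0 (1 - (x / X)\<^sup>2))) * (- 2 * x / X\<^sup>2)) (at x)"
    using DERIV_chain2[OF DERIV_pos_part_power[of 0 "1 - (x / X)\<^sup>2"] i]
    by (simp add: numeral_2_eq_2)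
  have "3 * (max 0 (1 - (x / X)\<^sup>2))\<^sup>2 * (- 2 * x / X\<^sup>2) = bump1 X x"
    by (simp add: bump1_def)
  then show "(bump X has_real_derivative bump1 X x) (at x)"
    using 3 by (simp only: bump_def[abs_def])
  have "((\<lambda>x. - 6 / X\<^sup>2 * (x * (max 0 (1 - (x / X)\<^sup>2))\<^sup>2)) has_real_derivative bump2 X x) (at x)"
    by (rule DERIV_cong[OF DERIV_cmult[OF DERIV_mult[OF DERIV_ident 2]]])
      (simp add: bump2_def power2_eq_square power4_eq_xxxx ring_distribs mult.assoc mult.left_commute)
  then show "(bump1 X has_real_derivative bump2 X x) (at x)"
    by (simp add: bump1_def[abs_def] algebra_simps)
qed

lemma DERIV_imp_continuous:
  fixes f :: "real \<Rightarrow> real"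
  shows "(\<And>x. (f has_real_derivative f' x) (at x)) \<Longrightarrow> continuous_on S f"
  by (meson DERIV_isCont continuous_at_imp_continuous_on)

lemma continuous_bump:
  "continuous_on S (bump X)" "continuous_on S (bump1 X)" "continuous_on S (bump2 X)"
proof -
  show "continuous_on S (bump X)" "continuous_on S (bump1 X)"
    by (rule DERIV_imp_continuous, rule DERIV_bump)+
  have "continuous_on S (\<lambda>x. - 6 * inverse (X\<^sup>2) * (max 0 (1 - (inverse X * x)\<^sup>2))\<^sup>2
      + 24 * inverse (X ^ 4) * x\<^sup>2 * max 0 (1 - (inverse X * x)\<^sup>2))"
    by (intro continuous_on_add continuous_on_mult continuous_on_power continuous_on_max
        continuous_on_diff continuous_on_const continuous_on_id)
  then show "continuous_on S (bump2 X)"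
    by (simp add: bump2_def[abs_def] divide_inverse mult.commute mult.left_commute)
qed

text \<open>With \<open>m\<close> the truncated parabola: \<open>1/8\<close> is
  \<open>(1/2) ^ 3\<close>, because \<open>m\<close> is at least \<open>3/4\<close> on the inner
  half; \<open>36\<close> is the square of the coefficient 6, and \<open>30\<close> is
  \<open>6 + 24\<close>.\<close>

lemma bump_bounds:
  assumes "X > 0"
  shows "0 \<le> bump X x" "bump X x \<le> 1" "\<bar>x\<bar> \<le> X / 2 \<Longrightarrow> bump X x \<ge> 1/8"
    "\<bar>x\<bar> \<ge> X \<Longrightarrow> bump X x = 0" "\<bar>x\<bar> \<ge> X \<Longrightarrow> bump1 X x = 0"
    "(bump1 X x)\<^sup>2 \<le> 36 / X\<^sup>2 * bump X x" "\<bar>bump1 X x\<bar> \<le> 6 / X" "\<bar>bump2 X x\<bar> \<le> 30 / X\<^sup>2"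
proof -
  define m where "m = max 0 (1 - (x / X)\<^sup>2)"
  have m: "0 \<le> m" "m \<le> 1" by (auto simp: m_def)
  show "0 \<le> bump X x" "bump X x \<le> 1" using m by (auto simp: bump_def m_def[symmetric] power_le_one)
  have sq: "\<bar>x\<bar> \<ge> X \<Longrightarrow> m = 0"
  proof -
    assume "\<bar>x\<bar> \<ge> X"
    then have "\<bar>x / X\<bar> \<ge> 1" using assms by (simp add: abs_divide)
    then have "(x / X)\<^sup>2 \<ge> 1" using abs_le_square_iff[of 1 "x / X"] by simp
    then show "m = 0" by (simp add: m_def)
  qed
  then show "\<bar>x\<bar> \<ge> X \<Longrightarrow> bump X x = 0" "\<bar>x\<bar> \<ge> X \<Longrightarrow> bump1 X x = 0"
    by (auto simp: bump_def bump1_def m_def)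
  show "bump X x \<ge> 1/8" if "\<bar>x\<bar> \<le> X / 2"
  proof -
    have "\<bar>x / X\<bar> \<le> 1/2" using that assms by (simp add: abs_divide field_simps)
    then have "(x / X)\<^sup>2 \<le> (1/2)\<^sup>2" using abs_le_square_iff[of "x / X" "1/2"] by simp
    then have "1/2 \<le> m" by (simp add: m_def power2_eq_square[of "1/2"])
    then have "(1/2)^3 \<le> m^3" by (intro power_mono) auto
    then show ?thesis by (simp add: bump_def m_def power3_eq_cube)
  qed
  \<comment> \<open>The factor \<open>m\<close> restricts the inequality to the support, where the
    square of \<open>x\<close> is below that of \<open>X\<close>.\<close>
  have x2: "x\<^sup>2 * m \<le> X\<^sup>2 * m"
  proof (cases "\<bar>x\<bar> \<ge> X")
    case False
    then have "x\<^sup>2 \<le> X\<^sup>2" using abs_le_square_iff[of x X] assms by simp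
    then show ?thesis using m by (simp add: mult_right_mono)
  qed (simp add: sq)
  then have x2': "x\<^sup>2 * m \<le> X\<^sup>2 * 1"
    using m mult_left_mono[of m 1 "X\<^sup>2"] by simp
  have "(bump1 X x)\<^sup>2 = 36 / X^4 * (x\<^sup>2 * m) * m^3"
    unfolding bump1_def m_def[symmetric]
    by (simp add: power2_eq_square power3_eq_cube power4_eq_xxxx mult.assoc)
  also have "\<dots> \<le> 36 / X^4 * (X\<^sup>2 * 1) * m^3"
    using x2' m by (intro mult_right_mono mult_left_mono) auto
  also have "\<dots> = 36 / X\<^sup>2 * bump X x"
    using assms unfolding bump_def m_def[symmetric] by (simp add: power2_eq_square power4_eq_xxxx)
  finally show b1: "(bump1 X x)\<^sup>2 \<le> 36 / X\<^sup>2 * bump X x" .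
  also have "\<dots> \<le> (6 / X)\<^sup>2"
    using \<open>bump X x \<le> 1\<close> by (simp add: power_divide divide_right_mono)
  finally have "\<bar>bump1 X x\<bar> \<le> \<bar>6 / X\<bar>" by (simp only: abs_le_square_iff)
  then show "\<bar>bump1 X x\<bar> \<le> 6 / X" using assms by simp
  have "\<bar>bump2 X x\<bar> \<le> 6 / X\<^sup>2 * m\<^sup>2 + 24 / X^4 * (x\<^sup>2 * m)"
    using m abs_triangle_ineq[of "- 6 / X\<^sup>2 * m\<^sup>2" "24 * x\<^sup>2 / X ^ 4 * m"]
    by (simp add: bump2_def m_def[symmetric] abs_mult mult.assoc)
  also have "\<dots> \<le> 6 / X\<^sup>2 * 1 + 24 / X^4 * (X\<^sup>2 * 1)"
    using m x2' by (intro add_mono mult_left_mono) (auto intro: power_le_one)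
  also have "\<dots> = 30 / X\<^sup>2"
    using assms by (simp add: power2_eq_square power4_eq_xxxx)
  finally show "\<bar>bump2 X x\<bar> \<le> 30 / X\<^sup>2" .
qed

section \<open>Functions with named derivatives on the slab, and Green's formula\<close>

lemma dir_deriv_coord_const:
  "dir_deriv dx (\<lambda>q. Q (snd q)) (\<lambda>q. 0)"
  "dir_deriv dx (\<lambda>q. Q1 (fst (snd q))) (\<lambda>q. 0)"
  "dir_deriv dy (\<lambda>q. Q1 (fst q)) (\<lambda>q. 0)"
  "dir_deriv dz (\<lambda>q. Q1 (fst q)) (\<lambda>q. 0)"
  "dir_deriv dz (\<lambda>q. Q1 (fst (snd q))) (\<lambda>q. 0)"
  by (auto simp: dir_deriv_def)

text \<open>Packs \<open>u\<close> with exactly the derivatives that occur in the equations. The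
  coordinate \<open>z\<close> is an angle, hence the period \<open>2 * pi\<close>; it replaces a
  cut-off in that direction.\<close>

locale jet2 =
  fixes u u1 u2 u3 u11 u22 u33 :: "real \<times> real \<times> real \<Rightarrow> real"
  assumes der: "dir_deriv dx u u1" "dir_deriv dy u u2" "dir_deriv dz u u3"
    "dir_deriv dx u1 u11" "dir_deriv dy u2 u22" "dir_deriv dz u3 u33"
    and cont: "continuous_on UNIV u" "continuous_on UNIV u1" "continuous_on UNIV u2"
      "continuous_on UNIV u3" "continuous_on UNIV u11" "continuous_on UNIV u22" "continuous_on UNIV u33"
    and per: "u (x, y, z + 2 * pi) = u (x, y, z)"
begin

lemma cont_on: "continuous_on S u" "continuous_on S u1" "continuous_on S u2" "continuous_on S u3"
  "continuous_on S u11" "continuous_on S u22" "continuous_on S u33"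
  using cont continuous_on_subset by blast+

lemma per3: "u3 (x, y, z + 2 * pi) = u3 (x, y, z)"
proof -
  have "(\<lambda>q. u (q + (0, 0, 2 * pi))) = u" using per by auto
  then have "dir_deriv dz u (\<lambda>q. u3 (q + (0, 0, 2 * pi)))"
    using dir_deriv_shift[OF der(3), of "(0, 0, 2 * pi)"] by simp
  then have "(\<lambda>q. u3 (q + (0, 0, 2 * pi))) = u3"
    using der(3) dir_deriv_unique by blast
  from fun_cong[OF this, of "(x, y, z)"] show ?thesis by simp
qed

text \<open>Two integrations by parts in \<open>x\<close> and in \<open>y\<close> move the operator
  onto the cut-offs \<open>A\<close> and \<open>B\<close>. The \<open>z\<close>-term drops out since
  its weight does not depend on \<open>z\<close> and \<open>u3\<close> is periodic. \<open>Q\<close>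
  and \<open>R\<close> carry no cut-off of their own: the applications put the factor in
  \<open>y\<close> into them.\<close>

lemma green:
  fixes X Y z0 :: real
  assumes A: "\<And>x. (A has_real_derivative A' x) (at x)" "\<And>x. (A' has_real_derivative A'' x) (at x)"
      "continuous_on UNIV A''" "A (-X) = 0" "A X = 0" "A' (-X) = 0" "A' X = 0"
    and B: "\<And>y. (B has_real_derivative B' y) (at y)" "\<And>y. (B' has_real_derivative B'' y) (at y)"
      "continuous_on UNIV B''" "B (-Y) = 0" "B Y = 0" "B' (-Y) = 0" "B' Y = 0"
    and k: "\<And>y. (k has_real_derivative k' y) (at y)" "continuous_on UNIV k'"
    and QR: "continuous_on UNIV Q" "continuous_on UNIV R"
  defines "D \<equiv> cbox (-X, -Y, z0) (X, Y, z0 + 2 * pi)"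
  shows "integral D (\<lambda>q. A (fst q) * (Q (fst (snd q)) * u11 q
      + B (fst (snd q)) * (k (fst (snd q)) * u22 q + (k' (fst (snd q)) + d) * u2 q) + R (fst (snd q)) * u33 q))
    = integral D (\<lambda>q. u q * (A'' (fst q) * Q (fst (snd q))
      + A (fst q) * (k' (fst (snd q)) * B' (fst (snd q)) + k (fst (snd q)) * B'' (fst (snd q)) - d * B' (fst (snd q)))))"
proof -
  note dA = dir_deriv_coord[OF A(1)] dir_deriv_coord[OF A(2)] dir_deriv_coord[OF B(1)] dir_deriv_coord[OF B(2)]
    dir_deriv_coord[OF k(1)]
  have cAB: "continuous_on UNIV A" "continuous_on UNIV A'" "continuous_on UNIV B" "continuous_on UNIV B'" "continuous_on UNIV k"
    by (rule DERIV_imp_continuous, (rule A B k))+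
  note cs = cAB[THEN continuous_on_compose2] A(3)[THEN continuous_on_compose2] B(3)[THEN continuous_on_compose2]
    k(2)[THEN continuous_on_compose2] QR[THEN continuous_on_compose2] cont
  \<comment> \<open>\<open>F1\<close>, \<open>F2\<close> and \<open>F3\<close> are exact derivatives
    in \<open>x\<close>, \<open>y\<close> and \<open>z\<close>, and their sum is the difference of
    the two integrands.\<close>
  define F1 where "F1 = (\<lambda>q. A (fst q) * (Q (fst (snd q)) * u11 q) - A'' (fst q) * (Q (fst (snd q)) * u q))"
  define F2 where "F2 = (\<lambda>q. A (fst q) * (B (fst (snd q)) * (k (fst (snd q)) * u22 q + (k' (fst (snd q)) + d) * u2 q))
    - A (fst q) * u q * (k' (fst (snd q)) * B' (fst (snd q)) + k (fst (snd q)) * B'' (fst (snd q)) - d * B' (fst (snd q))))"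
  define F3 where "F3 = (\<lambda>q. A (fst q) * R (fst (snd q)) * u33 q)"
  have c: "continuous_on UNIV F1" "continuous_on UNIV F2" "continuous_on UNIV F3"
    unfolding F1_def F2_def F3_def by (intro continuous_intros cs subset_UNIV)+
  have 1: "integral D F1 = 0" unfolding D_def
  proof (rule flux_x)
    show "dir_deriv dx (\<lambda>q. A (fst q) * (Q (fst (snd q)) * u1 q) - A' (fst q) * (Q (fst (snd q)) * u q)) F1"
      by (rule dir_deriv_eq, (rule dir_deriv_diff dir_deriv_mult dA dir_deriv_coord_const der)+)
        (simp add: F1_def algebra_simps)
  qed (use A c in auto)
  have 2: "integral D F2 = 0" unfolding D_def
  proof (rule flux_y)
    show "dir_deriv dy (\<lambda>q. A (fst q) * (B (fst (snd q)) * (k (fst (snd q)) * u2 q) - k (fst (snd q)) * (B' (fst (snd q)) * u q)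
        + d * (B (fst (snd q)) * u q))) F2"
      by (rule dir_deriv_eq, (rule dir_deriv_diff dir_deriv_add dir_deriv_mult dA dir_deriv_coord_const der dir_deriv_const)+)
        (simp add: F2_def algebra_simps)
  qed (use B c in auto)
  have 3: "integral D F3 = 0" unfolding D_def
  proof (rule flux_z)
    show "dir_deriv dz (\<lambda>q. A (fst q) * R (fst (snd q)) * u3 q) F3"
      by (rule dir_deriv_eq, (rule dir_deriv_diff dir_deriv_mult dA dir_deriv_coord_const der)+)
        (simp add: F3_def algebra_simps)
  qed (use c per3 in auto)
  have int: "F1 integrable_on D" "F2 integrable_on D" "F3 integrable_on D"
    unfolding D_def using c continuous_on_subset integrable_continuous by blast+
  define L where "L = (\<lambda>q. A (fst q) * (Q (fst (snd q)) * u11 q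
      + B (fst (snd q)) * (k (fst (snd q)) * u22 q + (k' (fst (snd q)) + d) * u2 q) + R (fst (snd q)) * u33 q))"
  define M where "M = (\<lambda>q. u q * (A'' (fst q) * Q (fst (snd q))
      + A (fst q) * (k' (fst (snd q)) * B' (fst (snd q)) + k (fst (snd q)) * B'' (fst (snd q)) - d * B' (fst (snd q)))))"
  have "continuous_on UNIV M"
    unfolding M_def by (intro continuous_intros cs subset_UNIV)
  then have M: "M integrable_on D"
    unfolding D_def using continuous_on_subset integrable_continuous by blast
  have "L q = M q + (F1 q + (F2 q + F3 q))" for q
    unfolding L_def M_def F1_def F2_def F3_def by (simp only: ring_distribs) (simp add: mult.commute mult.left_commute)
  then have "integral D L = integral D (\<lambda>q. M q + (F1 q + (F2 q + F3 q)))"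
    by presburger
  also have "\<dots> = integral D M + (integral D F1 + (integral D F2 + integral D F3))"
    using int M by (simp add: integral_add integrable_add)
  finally show ?thesis by (simp add: 1 2 3 L_def M_def)
qed

lemma compose:
  assumes F: "\<And>x. (F has_real_derivative F' x) (at x)" "\<And>x. (F' has_real_derivative F'' x) (at x)"
    and c: "continuous_on UNIV F''"
  shows "jet2 (\<lambda>q. F (u q)) (\<lambda>q. F' (u q) * u1 q) (\<lambda>q. F' (u q) * u2 q) (\<lambda>q. F' (u q) * u3 q)
    (\<lambda>q. F'' (u q) * (u1 q)\<^sup>2 + F' (u q) * u11 q) (\<lambda>q. F'' (u q) * (u2 q)\<^sup>2 + F' (u q) * u22 q)
    (\<lambda>q. F'' (u q) * (u3 q)\<^sup>2 + F' (u q) * u33 q)"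
proof -
  have cF: "continuous_on UNIV F" "continuous_on UNIV F'"
    by (rule DERIV_imp_continuous, rule F)+
  show ?thesis
  proof
    show "continuous_on UNIV (\<lambda>q. F (u q))" "continuous_on UNIV (\<lambda>q. F' (u q) * u1 q)"
      "continuous_on UNIV (\<lambda>q. F' (u q) * u2 q)" "continuous_on UNIV (\<lambda>q. F' (u q) * u3 q)"
      "continuous_on UNIV (\<lambda>q. F'' (u q) * (u1 q)\<^sup>2 + F' (u q) * u11 q)"
      "continuous_on UNIV (\<lambda>q. F'' (u q) * (u2 q)\<^sup>2 + F' (u q) * u22 q)"
      "continuous_on UNIV (\<lambda>q. F'' (u q) * (u3 q)\<^sup>2 + F' (u q) * u33 q)"
      by (intro continuous_intros cont cF[THEN continuous_on_compose2] c[THEN continuous_on_compose2] subset_UNIV)+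
    have *: "dir_deriv e (\<lambda>q. F' (u q) * v q) (\<lambda>q. F'' (u q) * (v q)\<^sup>2 + F' (u q) * v' q)"
      if "dir_deriv e u v" "dir_deriv e v v'" for e v v'
      by (rule dir_deriv_eq[OF dir_deriv_mult[OF dir_deriv_compose[of _ u _ F' F'', OF that(1) F(2)] that(2)]])
        (simp add: power2_eq_square)
    show "dir_deriv dx (\<lambda>q. F' (u q) * u1 q) (\<lambda>q. F'' (u q) * (u1 q)\<^sup>2 + F' (u q) * u11 q)"
      "dir_deriv dy (\<lambda>q. F' (u q) * u2 q) (\<lambda>q. F'' (u q) * (u2 q)\<^sup>2 + F' (u q) * u22 q)"
      "dir_deriv dz (\<lambda>q. F' (u q) * u3 q) (\<lambda>q. F'' (u q) * (u3 q)\<^sup>2 + F' (u q) * u33 q)"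
      by (rule *[OF der(1) der(4)] *[OF der(2) der(5)] *[OF der(3) der(6)])+
    show "dir_deriv dx (\<lambda>q. F (u q)) (\<lambda>q. F' (u q) * u1 q)"
      "dir_deriv dy (\<lambda>q. F (u q)) (\<lambda>q. F' (u q) * u2 q)"
      "dir_deriv dz (\<lambda>q. F (u q)) (\<lambda>q. F' (u q) * u3 q)"
      by (rule dir_deriv_compose[OF der(1) F(1)] dir_deriv_compose[OF der(2) F(1)] dir_deriv_compose[OF der(3) F(1)])+
  qed (simp add: per)
qed

end

lemma DERIV_hypot:
  "((\<lambda>x. sqrt (1 + x\<^sup>2) - 1) has_real_derivative x / sqrt (1 + x\<^sup>2)) (at x)"
  "((\<lambda>x. x / sqrt (1 + x\<^sup>2)) has_real_derivative 1 / (sqrt (1 + x\<^sup>2)) ^ 3) (at x)"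
proof -
  have pos: "0 < 1 + x\<^sup>2" by (simp add: add_pos_nonneg)
  have 1: "((\<lambda>x. sqrt (1 + x\<^sup>2)) has_real_derivative x / sqrt (1 + x\<^sup>2)) (at x)"
    using pos by (auto intro!: derivative_eq_intros simp: divide_simps)
  show "((\<lambda>x. sqrt (1 + x\<^sup>2) - 1) has_real_derivative x / sqrt (1 + x\<^sup>2)) (at x)"
    using DERIV_diff[OF 1 DERIV_const[of 1]] by simp
  have s: "sqrt (1 + x\<^sup>2) \<noteq> 0" "sqrt (1 + x\<^sup>2) ^ 2 = 1 + x\<^sup>2" using pos by auto
  have "(1 * sqrt (1 + x\<^sup>2) - x * (x / sqrt (1 + x\<^sup>2))) / (sqrt (1 + x\<^sup>2) * sqrt (1 + x\<^sup>2)) = 1 / (sqrt (1 + x\<^sup>2)) ^ 3"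
    using s by (simp add: field_simps power2_eq_square power3_eq_cube)
  then show "((\<lambda>x. x / sqrt (1 + x\<^sup>2)) has_real_derivative 1 / (sqrt (1 + x\<^sup>2)) ^ 3) (at x)"
    using DERIV_divide[OF DERIV_ident 1 s(1)] by simp
qed

text \<open>The witness is \<open>(sqrt (1 + x\<^sup>2) - 1) ^ k\<close> with \<open>k = \<lfloor>p\<rfloor>\<close>: it behaves like
  \<open>\<bar>x\<bar> ^ (2 * k)\<close> near \<open>0\<close> and like \<open>\<bar>x\<bar> ^ k\<close> at infinity, and \<open>k \<le> p \<le> 2 * k\<close>.\<close>

lemma convex_minorant:
  fixes p :: real
  assumes "1 \<le> p"
  obtains F F' F'' :: "real \<Rightarrow> real" where
    "\<And>x. (F has_real_derivative F' x) (at x)" "\<And>x. (F' has_real_derivative F'' x) (at x)"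
    "continuous_on UNIV F''" "\<And>x. 0 \<le> F x" "\<And>x. F x \<le> \<bar>x\<bar> powr p" "\<And>x. 0 \<le> F' x * x"
    "\<And>x. 0 \<le> F'' x" "\<And>x. x \<noteq> 0 \<Longrightarrow> 0 < F'' x"
proof -
  define j where "j = nat \<lfloor>p\<rfloor> - 1"
  have j: "real (Suc j) \<le> p" "p \<le> 2 * real (Suc j)"
  proof -
    have "1 \<le> \<lfloor>p\<rfloor>" using assms by simp
    then have "real (Suc j) = of_int \<lfloor>p\<rfloor>" by (simp add: j_def of_nat_diff)
    moreover have "p \<le> 2 * r" if "1 \<le> r" "p < r + 1" for r :: real
      using that by linarith
    moreover have "1 \<le> real_of_int \<lfloor>p\<rfloor>" "real_of_int \<lfloor>p\<rfloor> \<le> p" "p < real_of_int \<lfloor>p\<rfloor> + 1"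
      using \<open>1 \<le> \<lfloor>p\<rfloor>\<close> by simp_all
    ultimately have "real (Suc j) \<le> p \<and> p \<le> 2 * real (Suc j)"
      by metis
    then show "real (Suc j) \<le> p" "p \<le> 2 * real (Suc j)" by blast+
  qed
  define s where "s = (\<lambda>x::real. sqrt (1 + x\<^sup>2))"
  define g where "g = (\<lambda>x::real. s x - 1)"
  have s1: "s x \<ge> 1" "s x > 0" for x by (simp_all add: s_def add_pos_nonneg)
  have g0: "0 \<le> g x" for x using s1[of x] by (simp add: g_def)
  have gpos: "0 < g x" if "x \<noteq> 0" for x using that by (simp add: g_def s_def)
  have g1: "g x \<le> \<bar>x\<bar>" for x
    using sqrt_add_le_add_sqrt[of 1 "x\<^sup>2"] by (simp add: g_def s_def)
  have g2: "g x \<le> x\<^sup>2" for x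
  proof -
    have "1 + x\<^sup>2 \<le> (1 + x\<^sup>2)\<^sup>2" by (intro self_le_power) auto
    then have "s x \<le> 1 + x\<^sup>2" unfolding s_def by (intro real_le_lsqrt) auto
    then show ?thesis by (simp add: g_def)
  qed
  have dg: "(g has_real_derivative x / s x) (at x)" for x
    using DERIV_hypot(1)[of x] by (simp add: g_def s_def)
  have ds: "((\<lambda>x. x / s x) has_real_derivative 1 / s x ^ 3) (at x)" for x
    using DERIV_hypot(2)[of x] by (simp add: s_def)
  define F where "F = (\<lambda>x. g x ^ Suc j)"
  define F' where "F' = (\<lambda>x. real (Suc j) * (g x ^ j * (x / s x)))"
  \<comment> \<open>For \<open>j = 0\<close> the truncated exponent \<open>j - 1\<close> does no
    harm, because its factor \<open>real j\<close> vanishes. The second summand is the one that is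
    positive away from \<open>0\<close>.\<close>
  define F'' where "F'' = (\<lambda>x. real (Suc j) * (real j * g x ^ (j - 1) * (x / s x)\<^sup>2 + g x ^ j * (1 / s x ^ 3)))"
  have cs: "continuous_on UNIV s" unfolding s_def by (intro continuous_intros)
  show thesis
  proof
    show "(F has_real_derivative F' x) (at x)" for x
      unfolding F_def F'_def by (rule DERIV_cong[OF DERIV_power[OF dg]]) simp
    show "(F' has_real_derivative F'' x) (at x)" for x
      unfolding F'_def F''_def
      by (rule DERIV_cong[OF DERIV_cmult[OF DERIV_mult[OF DERIV_power[OF dg] ds]]])
        (simp add: power2_eq_square algebra_simps)
    show "continuous_on UNIV F''"
      unfolding F''_def g_def using s1 by (intro continuous_intros cs) (auto simp: less_imp_neq[symmetric])
    show "0 \<le> F x" for x using g0 by (simp add: F_def)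
    show "F x \<le> \<bar>x\<bar> powr p" for x
    proof (cases "x = 0")
      case True then show ?thesis by (simp add: F_def g_def s_def)
    next
      case x: False
      show ?thesis
      proof (cases "1 \<le> \<bar>x\<bar>")
        case True
        have "F x \<le> \<bar>x\<bar> ^ Suc j" unfolding F_def by (intro power_mono g1 g0)
        also have "\<dots> = \<bar>x\<bar> powr real (Suc j)" using x by (subst powr_realpow) simp_all
        also have "\<dots> \<le> \<bar>x\<bar> powr p" using True j(1) by (intro powr_mono) auto
        finally show ?thesis .
      next
        case False
        have "F x \<le> (x\<^sup>2) ^ Suc j" unfolding F_def by (intro power_mono g2 g0)
        also have "\<dots> = \<bar>x\<bar> ^ (2 * Suc j)" by (simp only: power_mult power2_abs)
        also have "\<dots> = \<bar>x\<bar> powr real (2 * Suc j)" using x by (subst powr_realpow) simp_all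
        also have "\<dots> = \<bar>x\<bar> powr (2 * real (Suc j))" by simp
        also have "\<dots> \<le> \<bar>x\<bar> powr p" using False j(2) x by (intro powr_mono') auto
        finally show ?thesis .
      qed
    qed
    show "0 \<le> F' x * x" for x
    proof -
      have "F' x * x = real (Suc j) * (g x ^ j * (x\<^sup>2 / s x))" by (simp add: F'_def power2_eq_square)
      then show ?thesis using g0[of x] s1[of x] by simp
    qed
    show "0 \<le> F'' x" for x using g0[of x] s1[of x] unfolding F''_def
      by (intro mult_nonneg_nonneg add_nonneg_nonneg) auto
    show "0 < F'' x" if "x \<noteq> 0" for x using gpos[OF that] s1[of x] unfolding F''_def
      by (intro mult_pos_pos add_nonneg_pos) auto
  qed
qed

text \<open>A closed curve is unrolled along \<open>x\<close>, so the integral of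
  \<open>|w| powr p\<close> is bounded only on slabs of unit length. Over length \<open>n\<close> it
  grows linearly, and the second derivative of the cut-off, of order \<open>1 / n^2\<close>, still
  wins.\<close>

lemma integral_slab_le:
  fixes g :: "real \<times> real \<times> real \<Rightarrow> real"
  assumes c: "continuous_on UNIV g"
    and C: "\<And>x0. integral (cbox (x0, y0, z0) (x0 + 1, y1, z1)) g \<le> C"
  shows "integral (cbox (a, y0, z0) (a + real n, y1, z1)) g \<le> real n * C"
proof -
  define h where "h x = integral {y0..y1} (\<lambda>y. integral {z0..z1} (\<lambda>z. g (x, y, z)))" for x
  have "h x = integral (cbox (y0, z0) (y1, z1)) (\<lambda>w. g (x, w))" for x
    unfolding h_def
    by (subst integral_prod_continuous) (auto intro!: continuous_on_compose2[OF c] continuous_intros)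
  moreover have "continuous_on UNIV (\<lambda>x. integral (cbox (y0, z0) (y1, z1)) (\<lambda>w. g (x, w)))"
    by (rule integral_continuous_on_param) (auto intro!: continuous_on_compose2[OF c] continuous_intros)
  ultimately have ch: "continuous_on UNIV h" by presburger
  then have ih: "h integrable_on {r..s}" for r s
    by (meson continuous_on_subset integrable_continuous_real top_greatest)
  have "integral {a..a + real n} h \<le> real n * C"
  proof (induction n)
    case (Suc n)
    have "integral {a..a + real (Suc n)} h = integral {a..a + real n} h + integral {a + real n..a + real (Suc n)} h"
      by (rule Henstock_Kurzweil_Integration.integral_combine[symmetric]) (auto intro: ih)
    also have "integral {a + real n..a + real (Suc n)} h \<le> C"
      using C[of "a + real n"] by (simp add: integral_triple[OF c] h_def[abs_def] ac_simps)
    finally show ?case using Suc by (simp add: algebra_simps)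
  qed simp
  then show ?thesis by (simp add: integral_triple[OF c] h_def[abs_def])
qed

text \<open>\<open>b n\<close> may depend on \<open>n\<close> in any way, so \<open>N\<close> must
  go to infinity with \<open>n\<close> fixed.\<close>

lemma nonpos_by_double_limit:
  fixes J a :: real
  assumes "\<And>n N. n \<ge> n0 \<Longrightarrow> N \<ge> n0 \<Longrightarrow> J \<le> a / real n + b n / real N"
  shows "J \<le> 0"
proof -
  have 1: "(\<lambda>N. c / real N) \<longlonglongrightarrow> 0" for c :: real by (rule lim_const_over_n)
  have "J \<le> a / real n" if "n \<ge> n0" for n
  proof (rule LIMSEQ_le_const)
    show "(\<lambda>N. a / real n + b n / real N) \<longlonglongrightarrow> a / real n"
      using tendsto_add[OF tendsto_const 1, of "a / real n" "b n"] by simp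
  qed (use assms that in blast)
  then show ?thesis by (intro LIMSEQ_le_const[OF 1[of a]]) blast
qed

lemma dir_deriv_0_imp_const:
  assumes "dir_deriv e f (\<lambda>q. 0)"
  shows "f (q + s *\<^sub>R e) = f q"
proof -
  have "\<forall>h. ((\<lambda>h. f (q + h *\<^sub>R e)) has_real_derivative 0) (at h)"
    using dir_derivD[OF assms] by blast
  from DERIV_isconst_all[OF this, of s 0] show ?thesis by (simp only: scaleR_zero_left add_0_right)
qed

lemma integral_const_triple:
  fixes c :: real
  assumes "a1 \<le> b1" "a2 \<le> b2" "a3 \<le> b3"
  shows "integral (cbox (a1, a2, a3) (b1, b2, b3)) (\<lambda>q. c) = (b1 - a1) * (b2 - a2) * (b3 - a3) * c"
  using assms by (simp add: content_Pair content_real)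

lemma cont_coord:
  "continuous_on UNIV f \<Longrightarrow> continuous_on S (\<lambda>q. f (fst (snd q)))"
  "continuous_on UNIV f \<Longrightarrow> continuous_on S (\<lambda>q. f (fst q))"
  by (auto intro!: continuous_on_compose2[of UNIV f] continuous_intros)

subsection \<open>A Liouville theorem by convexity\<close>

context jet2
begin

text \<open>The second derivative of the convex function may vanish at \<open>0\<close>, so the
  energy gives information only where \<open>u\<close> is nonzero. The square of \<open>u\<close>
  has zero gradient everywhere, which determines \<open>u\<close> up to sign.\<close>

lemma const_of_grad_0:
  assumes "\<And>q. u q \<noteq> 0 \<Longrightarrow> u1 q = 0 \<and> u2 q = 0 \<and> u3 q = 0"
  shows "\<bar>u q\<bar> = \<bar>u q'\<bar>"
proof -
  define f where "f = (\<lambda>q. (u q)\<^sup>2)"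
  have d: "dir_deriv e f (\<lambda>q. 0)" if "dir_deriv e u v" "\<And>q. u q \<noteq> 0 \<Longrightarrow> v q = 0" for e v
    unfolding f_def power2_eq_square
    by (rule dir_deriv_eq[OF dir_deriv_mult[OF that(1) that(1)]]) (use that(2) in auto)
  have c: "f (q + s *\<^sub>R dx) = f q" "f (q + s *\<^sub>R dy) = f q" "f (q + s *\<^sub>R dz) = f q" for q s
    by (rule dir_deriv_0_imp_const, rule d, rule der, use assms in blast)+
  have "f (x, y, z) = f (0, 0, 0)" for x y z
    using c(1)[of "(0, y, z)" x] c(2)[of "(0, 0, z)" y] c(3)[of "(0, 0, 0)" z] by simp
  then have "f q = f q'" by (metis prod_cases3)
  then show ?thesis by (simp add: f_def power2_eq_iff abs_eq_iff)
qed

text \<open>The coefficients are kept general to serve two cases: nonzero \<open>t\<close>, with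
  \<open>d = m = 0\<close>, and the weighted equation on the cone for \<open>p\<close> at least 3,
  with constant coefficients. Assumption \<open>kb\<close> expresses that \<open>k\<close> is
  dominated by the density \<open>\<mu>\<close> except near the zero section, where a bound
  depending on \<open>X\<close> takes over. Once \<open>u\<close> is constant up to sign, the
  infinite volume for positive \<open>y\<close> forces it to vanish.\<close>

lemma liouville_convex:
  fixes p C K \<mu>min m d :: real
  assumes p: "1 \<le> p"
    and k: "\<And>y. (k has_real_derivative k' y) (at y)" "continuous_on UNIV k'" "\<And>y. 0 < k y"
    and \<alpha>: "continuous_on UNIV \<alpha>" "\<And>y. 0 < \<alpha> y"
    and \<beta>: "continuous_on UNIV \<beta>" "\<And>y. 0 < \<beta> y"
    and \<mu>: "continuous_on UNIV \<mu>" "\<And>y. 0 \<le> \<mu> y" "\<And>y. 0 \<le> y \<Longrightarrow> \<mu>min \<le> \<mu> y" "0 < \<mu>min"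
    and pde: "\<And>x y z. \<alpha> y * u11 (x, y, z) + (k y * u22 (x, y, z) + (k' y + d) * u2 (x, y, z))
      + \<beta> y * u33 (x, y, z) = m * u (x, y, z)" "0 \<le> m"
    and int: "\<And>x0 y0 y1 z0. integral (cbox (x0, y0, z0) (x0 + 1, y1, z0 + 2 * pi)) (\<lambda>q. \<bar>u q\<bar> powr p * \<mu> (fst (snd q))) \<le> C"
    and K: "0 \<le> K" "\<And>y. \<alpha> y \<le> K * \<mu> y" "\<And>y. \<bar>k' y\<bar> + \<bar>d\<bar> \<le> K * \<mu> y"
    and kb: "\<And>X. \<exists>M. \<forall>x y z. \<bar>x\<bar> \<le> X \<longrightarrow> k y * \<bar>u (x, y, z)\<bar> powr p \<le> M + K * (\<bar>u (x, y, z)\<bar> powr p * \<mu> y)"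
  shows "u q = 0"
proof -
  obtain F F' F'' where F: "\<And>x. (F has_real_derivative F' x) (at x)" "\<And>x. (F' has_real_derivative F'' x) (at x)"
    "continuous_on UNIV F''" "\<And>x. 0 \<le> F x" "\<And>x. F x \<le> \<bar>x\<bar> powr p" "\<And>x. 0 \<le> F' x * x"
    "\<And>x. 0 \<le> F'' x" "\<And>x. x \<noteq> 0 \<Longrightarrow> 0 < F'' x"
    using convex_minorant[OF p] by blast
  interpret G: jet2 "\<lambda>q. F (u q)" "\<lambda>q. F' (u q) * u1 q" "\<lambda>q. F' (u q) * u2 q" "\<lambda>q. F' (u q) * u3 q"
    "\<lambda>q. F'' (u q) * (u1 q)\<^sup>2 + F' (u q) * u11 q" "\<lambda>q. F'' (u q) * (u2 q)\<^sup>2 + F' (u q) * u22 q"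
    "\<lambda>q. F'' (u q) * (u3 q)\<^sup>2 + F' (u q) * u33 q"
    by (rule compose) (fact F)+
  have cF: "continuous_on S (\<lambda>q. F (u q))" "continuous_on S (\<lambda>q. F' (u q))" "continuous_on S (\<lambda>q. F'' (u q))" for S
    using DERIV_imp_continuous[OF F(1), where S=UNIV] DERIV_imp_continuous[OF F(2), where S=UNIV] F(3)
    by (auto intro: continuous_on_compose2[OF _ cont_on(1)])
  have ck: "continuous_on UNIV k" by (rule DERIV_imp_continuous, rule k)
  define g where "g = (\<lambda>q. \<bar>u q\<bar> powr p * \<mu> (fst (snd q)))"
  have cg: "continuous_on UNIV g"
    unfolding g_def using p by (intro continuous_intros cont_coord \<mu> cont_on continuous_on_powr') auto
  have g0: "0 \<le> g q" for q using \<mu>(2) by (simp add: g_def)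
  \<comment> \<open>This is what the operator applied to \<open>F (u q)\<close> contains beyond
    \<open>F' (u q)\<close> times the operator applied to \<open>u\<close>.\<close>
  define E where "E = (\<lambda>q. F'' (u q) * (\<alpha> (fst (snd q)) * (u1 q)\<^sup>2 + k (fst (snd q)) * (u2 q)\<^sup>2 + \<beta> (fst (snd q)) * (u3 q)\<^sup>2))"
  have cE: "continuous_on UNIV E"
    unfolding E_def by (intro continuous_intros cont_coord ck \<alpha> \<beta> cont_on cF)
  have E0: "0 \<le> E q" for q
    unfolding E_def using F(7) \<alpha>(2) \<beta>(2) k(3) by (simp add: less_imp_le)
  have intg: "f integrable_on cbox a b" if "continuous_on UNIV f" for f :: "real \<times> real \<times> real \<Rightarrow> real" and a b
    using that continuous_on_subset integrable_continuous by blast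
  have C0: "0 \<le> C"
    using int[of 0 0 0 0] integral_nonneg[OF intg[OF cg], of "(0, 0, 0)" "(1, 0, 2 * pi)"] g0 by (simp add: g_def)
  have cB: "continuous_on UNIV (bump X)" "continuous_on UNIV (bump1 X)" "continuous_on UNIV (bump2 X)" for X
    by (rule continuous_bump)+
  have main: "integral (cbox (-X, -Y, z0) (X, Y, z0 + 2 * pi)) (\<lambda>q. bump X (fst q) * bump Y (fst (snd q)) * E q)
      \<le> (30 * K / X\<^sup>2 + 6 * K / Y + 30 * K / Y\<^sup>2) * (2 * real n * C) + 240 * pi * X * M / Y"
    if n: "X = real n" "n > 0" and Y: "Y > 0"
      and M: "\<forall>x y z. \<bar>x\<bar> \<le> X \<longrightarrow> k y * \<bar>u (x, y, z)\<bar> powr p \<le> M + K * (\<bar>u (x, y, z)\<bar> powr p * \<mu> y)"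
    for X Y M z0 :: real and n
  proof -
    have X: "X > 0" using n by simp
    let ?D = "cbox (-X, -Y, z0) (X, Y, z0 + 2 * pi)"
    define S where "S = 30 * K / X\<^sup>2 + 6 * K / Y + 30 * K / Y\<^sup>2"
    have "integral ?D (\<lambda>q. bump X (fst q) * bump Y (fst (snd q)) * E q) \<le>
        integral ?D (\<lambda>q. bump X (fst q) * (bump Y (fst (snd q)) * \<alpha> (fst (snd q)) * (F'' (u q) * (u1 q)\<^sup>2 + F' (u q) * u11 q)
          + bump Y (fst (snd q)) * (k (fst (snd q)) * (F'' (u q) * (u2 q)\<^sup>2 + F' (u q) * u22 q) + (k' (fst (snd q)) + d) * (F' (u q) * u2 q))
          + bump Y (fst (snd q)) * \<beta> (fst (snd q)) * (F'' (u q) * (u3 q)\<^sup>2 + F' (u q) * u33 q)))"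
    proof (rule integral_le)
      fix q assume "q \<in> ?D"
      obtain x y z where q: "q = (x, y, z)" by (cases q)
      \<comment> \<open>\<open>F' x * x\<close> and \<open>m\<close> are nonnegative, so the
        zero-order term can be added and then exchanged for the differential operator.\<close>
      have "bump X x * bump Y y * E q \<le> bump X x * bump Y y * (E q + m * (F' (u q) * u q))"
        using bump_bounds(1)[OF X, of x] bump_bounds(1)[OF Y, of y] pde(2) F(6)[of "u q"]
        by (intro mult_left_mono) auto
      also have "\<dots> = bump X x * bump Y y * (E q + F' (u q) * (\<alpha> y * u11 q + (k y * u22 q + (k' y + d) * u2 q) + \<beta> y * u33 q))"
        using pde(1)[of y x z] by (simp add: q mult.commute mult.left_commute)
      also have "\<dots> = bump X x * (bump Y y * \<alpha> y * (F'' (u q) * (u1 q)\<^sup>2 + F' (u q) * u11 q)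
          + bump Y y * (k y * (F'' (u q) * (u2 q)\<^sup>2 + F' (u q) * u22 q) + (k' y + d) * (F' (u q) * u2 q))
          + bump Y y * \<beta> y * (F'' (u q) * (u3 q)\<^sup>2 + F' (u q) * u33 q))"
        unfolding E_def q by (simp add: algebra_simps)
      finally show "bump X (fst q) * bump Y (fst (snd q)) * E q \<le> bump X (fst q) * (bump Y (fst (snd q)) * \<alpha> (fst (snd q)) * (F'' (u q) * (u1 q)\<^sup>2 + F' (u q) * u11 q)
          + bump Y (fst (snd q)) * (k (fst (snd q)) * (F'' (u q) * (u2 q)\<^sup>2 + F' (u q) * u22 q) + (k' (fst (snd q)) + d) * (F' (u q) * u2 q))
          + bump Y (fst (snd q)) * \<beta> (fst (snd q)) * (F'' (u q) * (u3 q)\<^sup>2 + F' (u q) * u33 q))"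
        by (simp add: q)
    qed (intro intg continuous_intros cont_coord cB cE ck k(2) \<alpha> \<beta> cF cont_on)+
    also have "\<dots> = integral ?D (\<lambda>q. F (u q) * (bump2 X (fst q) * (bump Y (fst (snd q)) * \<alpha> (fst (snd q)))
      + bump X (fst q) * (k' (fst (snd q)) * bump1 Y (fst (snd q)) + k (fst (snd q)) * bump2 Y (fst (snd q)) - d * bump1 Y (fst (snd q)))))"
      by (rule G.green[where k=k and k'=k' and d=d and Q="\<lambda>y. bump Y y * \<alpha> y" and R="\<lambda>y. bump Y y * \<beta> y"
        and A="bump X" and A'="bump1 X" and A''="bump2 X" and B="bump Y" and B'="bump1 Y" and B''="bump2 Y"])
        (auto intro!: DERIV_bump cB k \<alpha> \<beta> continuous_intros bump_bounds X Y)
    also have "\<dots> \<le> integral ?D (\<lambda>q. S * g q + 30 * M / Y\<^sup>2)"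
    proof (rule integral_le)
      fix q assume q': "q \<in> ?D"
      obtain x y z where q: "q = (x, y, z)" by (cases q)
      have x: "\<bar>x\<bar> \<le> X" using q' by (auto simp: q)
      define w where "w = \<bar>u q\<bar> powr p"
      have w: "0 \<le> w" "F (u q) \<le> w" using F(5) by (auto simp: w_def)
      have A: "0 \<le> bump X x" "bump X x \<le> 1" "\<bar>bump2 X x\<bar> \<le> 30 / X\<^sup>2" using bump_bounds[OF X, of x] by auto
      have B: "0 \<le> bump Y y" "bump Y y \<le> 1" "\<bar>bump1 Y y\<bar> \<le> 6 / Y" "\<bar>bump2 Y y\<bar> \<le> 30 / Y\<^sup>2" using bump_bounds[OF Y, of y] by auto
      have gw: "g q = w * \<mu> y" by (simp add: g_def w_def q)
      have t1: "\<bar>bump2 X x * (bump Y y * \<alpha> y)\<bar> \<le> 30 / X\<^sup>2 * (1 * (K * \<mu> y))"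
        unfolding abs_mult using A B K(2)[of y] \<alpha>(2)[of y] by (intro mult_mono) auto
      have t2: "\<bar>k' y * bump1 Y y - d * bump1 Y y\<bar> \<le> (K * \<mu> y) * (6 / Y)"
      proof -
        have "\<bar>k' y * bump1 Y y - d * bump1 Y y\<bar> = \<bar>k' y - d\<bar> * \<bar>bump1 Y y\<bar>"
          by (simp add: abs_mult[symmetric] left_diff_distrib)
        also have "\<dots> \<le> (K * \<mu> y) * (6 / Y)"
          using K(3)[of y] B K(1) \<mu>(2)[of y] by (intro mult_mono) auto
        finally show ?thesis .
      qed
      have t3: "\<bar>k y * bump2 Y y\<bar> \<le> k y * (30 / Y\<^sup>2)"
        unfolding abs_mult using B k(3)[of y] by (intro mult_mono) auto
      have "F (u q) * (bump2 X x * (bump Y y * \<alpha> y) + bump X x * (k' y * bump1 Y y + k y * bump2 Y y - d * bump1 Y y))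
        \<le> w * \<bar>bump2 X x * (bump Y y * \<alpha> y) + bump X x * (k' y * bump1 Y y + k y * bump2 Y y - d * bump1 Y y)\<bar>"
        by (rule order_trans[OF mult_left_mono[OF abs_ge_self F(4)] mult_right_mono[OF w(2) abs_ge_zero]])
      also have "\<dots> \<le> w * (30 / X\<^sup>2 * (1 * (K * \<mu> y)) + 1 * ((K * \<mu> y) * (6 / Y) + k y * (30 / Y\<^sup>2)))"
      proof (intro mult_left_mono w(1) order_trans[OF abs_triangle_ineq] add_mono t1)
        have "\<bar>k' y * bump1 Y y + k y * bump2 Y y - d * bump1 Y y\<bar> \<le> (K * \<mu> y) * (6 / Y) + k y * (30 / Y\<^sup>2)"
          using t2 t3 by linarith
        then show "\<bar>bump X x * (k' y * bump1 Y y + k y * bump2 Y y - d * bump1 Y y)\<bar> \<le> 1 * ((K * \<mu> y) * (6 / Y) + k y * (30 / Y\<^sup>2))"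
          unfolding abs_mult using A by (intro mult_mono) auto
      qed
      also have "\<dots> = (30 * K / X\<^sup>2 + 6 * K / Y) * g q + (k y * w) * (30 / Y\<^sup>2)"
        by (simp add: gw algebra_simps)
      also have "\<dots> \<le> (30 * K / X\<^sup>2 + 6 * K / Y) * g q + (M + K * (w * \<mu> y)) * (30 / Y\<^sup>2)"
        using M[rule_format, OF x, of y z] by (intro add_mono order_refl mult_right_mono) (auto simp: w_def q)
      also have "\<dots> = S * g q + 30 * M / Y\<^sup>2"
        by (simp add: S_def gw algebra_simps add_divide_distrib)
      finally show "F (u q) * (bump2 X (fst q) * (bump Y (fst (snd q)) * \<alpha> (fst (snd q)))
        + bump X (fst q) * (k' (fst (snd q)) * bump1 Y (fst (snd q)) + k (fst (snd q)) * bump2 Y (fst (snd q)) - d * bump1 Y (fst (snd q))))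
        \<le> S * g q + 30 * M / Y\<^sup>2" by (simp add: q)
    qed (intro intg continuous_intros cont_coord cB ck k(2) \<alpha> cF cg)+
    also have "\<dots> = S * integral ?D g + integral ?D (\<lambda>q. 30 * M / Y\<^sup>2)"
      using cg by (subst integral_add) (auto intro!: intg continuous_intros)
    \<comment> \<open>The box has volume \<open>8 * pi * X * Y\<close>.\<close>
    also have "integral ?D (\<lambda>q. 30 * M / Y\<^sup>2) = 240 * pi * X * M / Y"
      using X Y by (subst integral_const_triple) (auto simp: power2_eq_square)
    also have "S * integral ?D g \<le> S * (2 * real n * C)"
    proof (rule mult_left_mono)
      show "0 \<le> S" using K(1) X Y by (simp add: S_def)
      show "integral ?D g \<le> 2 * real n * C"
        using integral_slab_le[OF cg, of "-Y" z0 Y "z0 + 2 * pi" C "-X" "2 * n"] int n by (simp add: g_def)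
    qed
    finally show ?thesis by (simp add: S_def)
  qed
  have J: "integral (cbox (-real n0, -real n0, z0) (real n0, real n0, z0 + 2 * pi)) E \<le> 0" (is "integral ?I E \<le> 0")
    if n0: "n0 > 0" for n0 :: nat and z0
  proof -
    obtain M where M: "\<forall>x y z. \<bar>x\<bar> \<le> X \<longrightarrow> k y * \<bar>u (x, y, z)\<bar> powr p \<le> M X + K * (\<bar>u (x, y, z)\<bar> powr p * \<mu> y)" for X
      using kb by metis
    show ?thesis
    proof (rule nonpos_by_double_limit)
      fix n N :: nat assume nN: "n \<ge> 2 * n0" "N \<ge> 2 * n0"
      define X Y where "X = real n" and "Y = real N"
      have XY: "X > 0" "Y \<ge> 1" "2 * real n0 \<le> X" "2 * real n0 \<le> Y" "n > 0" using nN n0 by (auto simp: X_def Y_def)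
      let ?D = "cbox (-X, -Y, z0) (X, Y, z0 + 2 * pi)"
      \<comment> \<open>The small box lies in the inner half of the large one, where each cut-off is
        at least \<open>1/8\<close>; hence \<open>64\<close>.\<close>
      have "integral ?I E \<le> integral ?I (\<lambda>q. 64 * (bump X (fst q) * bump Y (fst (snd q)) * E q))"
      proof (rule integral_le)
        fix q assume q': "q \<in> ?I"
        obtain x y z where q: "q = (x, y, z)" by (cases q)
        have "\<bar>x\<bar> \<le> real n0" "\<bar>y\<bar> \<le> real n0" using q' by (auto simp: q)
        then have "\<bar>x\<bar> \<le> X / 2" "\<bar>y\<bar> \<le> Y / 2" using XY by linarith+
        then have "bump X x \<ge> 1/8" "bump Y y \<ge> 1/8"
          using XY bump_bounds(3)[of X x] bump_bounds(3)[of Y y] by linarith+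
        then have "(1/8) * (1/8) \<le> bump X x * bump Y y" by (intro mult_mono) auto
        from mult_right_mono[OF this E0[of q]]
        show "E q \<le> 64 * (bump X (fst q) * bump Y (fst (snd q)) * E q)" by (simp add: q)
      qed (intro intg continuous_intros cont_coord cB cE)+
      also have "\<dots> \<le> integral ?D (\<lambda>q. 64 * (bump X (fst q) * bump Y (fst (snd q)) * E q))"
      proof (rule integral_subset_le)
        show "?I \<subseteq> ?D" using XY by auto
      qed (use bump_bounds(1) XY E0 in \<open>auto intro!: intg continuous_intros cont_coord cB cE\<close>)
      also have "\<dots> = 64 * integral ?D (\<lambda>q. bump X (fst q) * bump Y (fst (snd q)) * E q)" by simp
      also have "\<dots> \<le> 64 * ((30 * K / X\<^sup>2 + 6 * K / Y + 30 * K / Y\<^sup>2) * (2 * X * C) + 240 * pi * X * M X / Y)"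
        using main[of X n Y "M X" z0] XY M by (simp add: X_def)
      also have "\<dots> \<le> 64 * ((30 * K / X\<^sup>2 + 6 * K / Y + 30 * K / Y) * (2 * X * C) + 240 * pi * X * M X / Y)"
      proof -
        have "Y \<le> Y\<^sup>2" using XY by (simp add: power2_eq_square)
        then have "30 * K / Y\<^sup>2 \<le> 30 * K / Y" using XY K(1) by (intro divide_left_mono) auto
        then show ?thesis using XY C0 by (intro mult_left_mono add_mono mult_right_mono) auto
      qed
      \<comment> \<open>The part without \<open>1 / Y\<close> is \<open>30 * K / X\<^sup>2\<close>
        times the slab mass \<open>2 * X * C\<close>. Everything else, including the uncontrolled
        \<open>M X\<close>, carries \<open>1 / Y\<close> and disappears in the first limit.\<close>
      also have "\<dots> = (64 * 60 * K * C) / X + 64 * (72 * K * X * C + 240 * pi * X * M X) / Y"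
        using XY by (simp add: field_simps power2_eq_square)
      finally show "integral ?I E \<le> (64 * 60 * K * C) / real n + (64 * (72 * K * real n * C + 240 * pi * real n * M (real n))) / real N"
        by (simp add: X_def Y_def)
    qed
  qed
  have Ez: "E q = 0" for q
  proof -
    obtain x y z where q: "q = (x, y, z)" by (cases q)
    obtain n0 :: nat where n0: "n0 > 0" "\<bar>x\<bar> \<le> real n0" "\<bar>y\<bar> \<le> real n0"
    proof -
      obtain n0 :: nat where "\<bar>x\<bar> + \<bar>y\<bar> + 1 \<le> real n0" using real_arch_simple by blast
      then show thesis by (intro that[of n0]) linarith+
    qed
    let ?I = "cbox (-real n0, -real n0, z) (real n0, real n0, z + 2 * pi)"
    have "integral ?I E = 0"
      using J[OF n0(1)] integral_nonneg[OF intg[OF cE]] E0 by (meson order_antisym)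
    moreover have "box (-real n0, -real n0, z) (real n0, real n0, z + 2 * pi) \<noteq> {}"
      using n0 by (auto simp: box_ne_empty Basis_prod_def)
    moreover have "continuous_on ?I E" using cE continuous_on_subset by blast
    ultimately have "\<forall>q\<in>?I. E q = 0"
      using integral_cbox_eq_0_iff E0 by blast
    moreover have "q \<in> ?I" using n0 by (auto simp: q)
    ultimately show ?thesis by blast
  qed
  have "u1 q = 0 \<and> u2 q = 0 \<and> u3 q = 0" if "u q \<noteq> 0" for q
  proof -
    obtain x y z where q: "q = (x, y, z)" by (cases q)
    have "\<alpha> y * (u1 q)\<^sup>2 + k y * (u2 q)\<^sup>2 + \<beta> y * (u3 q)\<^sup>2 = 0"
      using Ez[of q] F(8)[OF that] by (simp add: E_def q)
    moreover have "0 \<le> \<alpha> y * (u1 q)\<^sup>2" "0 \<le> k y * (u2 q)\<^sup>2" "0 \<le> \<beta> y * (u3 q)\<^sup>2"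
      using \<alpha>(2)[of y] \<beta>(2)[of y] k(3)[of y] by auto
    ultimately have "\<alpha> y * (u1 q)\<^sup>2 = 0" "k y * (u2 q)\<^sup>2 = 0" "\<beta> y * (u3 q)\<^sup>2 = 0" by linarith+
    then show ?thesis using \<alpha>(2)[of y] \<beta>(2)[of y] k(3)[of y] by auto
  qed
  from const_of_grad_0[OF this] have ua: "\<bar>u q'\<bar> = \<bar>u q\<bar>" for q' .
  define a where "a = \<bar>u q\<bar> powr p"
  \<comment> \<open>The mass of a constant over the box \<open>[0, 1] x [0, n] x [0, 2 * pi]\<close>
    grows with \<open>n\<close>, yet stays below \<open>C\<close>.\<close>
  have "a * \<mu>min * 2 * pi * real n \<le> C" for n
  proof -
    have "integral (cbox (0::real, 0, 0) (1, real n, 2 * pi)) (\<lambda>q. a * \<mu>min) = (1 - 0) * (real n - 0) * (2 * pi - 0) * (a * \<mu>min)"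
      by (rule integral_const_triple) auto
    then have "a * \<mu>min * 2 * pi * real n = integral (cbox (0::real, 0, 0) (1, real n, 2 * pi)) (\<lambda>q. a * \<mu>min)"
      by (simp only:) simp
    also have "\<dots> \<le> integral (cbox (0, 0, 0) (1, real n, 2 * pi)) g"
    proof (rule integral_le)
      fix q' :: "real \<times> real \<times> real" assume "q' \<in> cbox (0, 0, 0) (1, real n, 2 * pi)"
      then have "\<mu>min \<le> \<mu> (fst (snd q'))" by (cases q') (auto intro: \<mu>(3))
      then show "a * \<mu>min \<le> g q'" unfolding g_def a_def ua[of q'] by (intro mult_left_mono) auto
    qed (intro intg cg continuous_intros)+
    also have "\<dots> \<le> C" using int[of 0 0 0 "real n"] unfolding g_def by (simp only: add_0)
    finally show ?thesis .
  qed
  then have "a * \<mu>min * 2 * pi \<le> 0"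
    using reals_Archimedean3[of "a * \<mu>min * 2 * pi"] by (metis linorder_not_le mult.commute)
  moreover have "0 \<le> a" by (simp add: a_def)
  ultimately have "a = 0" using \<mu>(4) pi_gt_zero by (auto simp: mult_le_0_iff simp del: pi_gt_zero)
  then show ?thesis by (simp add: a_def)
qed

end

subsection \<open>A Liouville theorem by energy estimates\<close>

lemma integrable_cbox_continuous:
  fixes f :: "real \<times> real \<times> real \<Rightarrow> real"
  shows "continuous_on UNIV f \<Longrightarrow> f integrable_on cbox a b"
  using continuous_on_subset integrable_continuous by blast

context jet2
begin

text \<open>Green's formula for the square of \<open>u\<close>: its second derivatives contain
  \<open>2 * E\<close>, and the equation turns the rest into multiples of the square of
  \<open>u\<close>. As \<open>X\<close> and \<open>Y\<close> are at least 1, the derivatives of the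
  cut-offs contribute at most \<open>30 + 30 + 6 * c\<close>, independently of the box. The factor
  32 is \<open>64 / 2\<close>, from the lower bound \<open>1/8\<close> of each cut-off and the
  \<open>2\<close> before \<open>E\<close>.\<close>

lemma caccioppoli:
  assumes pde: "\<And>q. u11 q + u22 q - c * u2 q + 4 * u33 q = - m * u q"
    and c: "0 < c" and XY: "1 \<le> X" "1 \<le> Y"
  shows "integral (cbox (- X / 2, - Y / 2, z0) (X / 2, Y / 2, z0 + 2 * pi)) (\<lambda>q. (u1 q)\<^sup>2 + (u2 q)\<^sup>2 + 4 * (u3 q)\<^sup>2)
    \<le> 32 * (2 * \<bar>m\<bar> + 60 + 6 * c) * integral (cbox (- X, - Y, z0) (X, Y, z0 + 2 * pi)) (\<lambda>q. (u q)\<^sup>2)"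
proof -
  let ?D = "cbox (- X, - Y, z0) (X, Y, z0 + 2 * pi)"
  let ?H = "cbox (- X / 2, - Y / 2, z0) (X / 2, Y / 2, z0 + 2 * pi)"
  define E where "E = (\<lambda>q. (u1 q)\<^sup>2 + (u2 q)\<^sup>2 + 4 * (u3 q)\<^sup>2)"
  define A where "A = (\<lambda>q::real \<times> real \<times> real. bump X (fst q) * bump Y (fst (snd q)))"
  define S where "S = (\<lambda>q::real \<times> real \<times> real. 2 * m * A q + (bump2 X (fst q) * bump Y (fst (snd q))
      + bump X (fst q) * (bump2 Y (fst (snd q)) + c * bump1 Y (fst (snd q)))))"
  have XY': "0 < X" "0 < Y" using XY by auto
  have cB: "continuous_on UNIV (bump X)" "continuous_on UNIV (bump1 X)" "continuous_on UNIV (bump2 X)" for X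
    by (rule continuous_bump)+
  have cE: "continuous_on UNIV E" unfolding E_def by (intro continuous_intros cont)
  have cA: "continuous_on UNIV A" unfolding A_def by (intro continuous_intros cont_coord cB)
  have cS: "continuous_on UNIV S" unfolding S_def by (intro continuous_intros cont_coord cB cA)
  have cu: "continuous_on UNIV (\<lambda>q. (u q)\<^sup>2)" by (intro continuous_intros cont)
  interpret G: jet2 "\<lambda>q. (u q)\<^sup>2" "\<lambda>q. 2 * u q * u1 q" "\<lambda>q. 2 * u q * u2 q" "\<lambda>q. 2 * u q * u3 q"
    "\<lambda>q. 2 * (u1 q)\<^sup>2 + 2 * u q * u11 q" "\<lambda>q. 2 * (u2 q)\<^sup>2 + 2 * u q * u22 q"
    "\<lambda>q. 2 * (u3 q)\<^sup>2 + 2 * u q * u33 q"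
    by (rule compose) (auto intro!: derivative_eq_intros)
  have 1: "integral ?D (\<lambda>q. bump X (fst q) * (bump Y (fst (snd q)) * (2 * (u1 q)\<^sup>2 + 2 * u q * u11 q)
      + bump Y (fst (snd q)) * (1 * (2 * (u2 q)\<^sup>2 + 2 * u q * u22 q) + (0 + - c) * (2 * u q * u2 q))
      + 4 * bump Y (fst (snd q)) * (2 * (u3 q)\<^sup>2 + 2 * u q * u33 q)))
    = integral ?D (\<lambda>q. (u q)\<^sup>2 * (bump2 X (fst q) * bump Y (fst (snd q))
      + bump X (fst q) * (0 * bump1 Y (fst (snd q)) + 1 * bump2 Y (fst (snd q)) - (- c) * bump1 Y (fst (snd q)))))"
    by (rule G.green[where k="\<lambda>y. 1" and k'="\<lambda>y. 0" and d="-c" and Q="bump Y" and R="\<lambda>y. 4 * bump Y y"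
        and A="bump X" and A'="bump1 X" and A''="bump2 X" and B="bump Y" and B'="bump1 Y" and B''="bump2 Y"])
      (auto intro!: DERIV_bump cB continuous_intros bump_bounds XY')
  have "bump X (fst q) * (bump Y (fst (snd q)) * (2 * (u1 q)\<^sup>2 + 2 * u q * u11 q)
      + bump Y (fst (snd q)) * (1 * (2 * (u2 q)\<^sup>2 + 2 * u q * u22 q) + (0 + - c) * (2 * u q * u2 q))
      + 4 * bump Y (fst (snd q)) * (2 * (u3 q)\<^sup>2 + 2 * u q * u33 q))
    = 2 * (A q * E q) - 2 * m * A q * (u q)\<^sup>2" for q
  proof -
    have "bump X (fst q) * (bump Y (fst (snd q)) * (2 * (u1 q)\<^sup>2 + 2 * u q * u11 q)
      + bump Y (fst (snd q)) * (1 * (2 * (u2 q)\<^sup>2 + 2 * u q * u22 q) + (0 + - c) * (2 * u q * u2 q))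
      + 4 * bump Y (fst (snd q)) * (2 * (u3 q)\<^sup>2 + 2 * u q * u33 q))
      = 2 * (A q * E q) + 2 * A q * u q * (u11 q + u22 q - c * u2 q + 4 * u33 q)"
      by (simp add: A_def E_def algebra_simps)
    then show ?thesis by (simp add: pde power2_eq_square)
  qed
  then have "integral ?D (\<lambda>q. 2 * (A q * E q) - 2 * m * A q * (u q)\<^sup>2) = integral ?D (\<lambda>q. (u q)\<^sup>2 * (S q - 2 * m * A q))"
    using 1 by (simp add: S_def)
  moreover have "integral ?D (\<lambda>q. 2 * (A q * E q)) = integral ?D (\<lambda>q. (2 * (A q * E q) - 2 * m * A q * (u q)\<^sup>2) + 2 * m * A q * (u q)\<^sup>2)"
    by simp
  moreover have "\<dots> = integral ?D (\<lambda>q. 2 * (A q * E q) - 2 * m * A q * (u q)\<^sup>2) + integral ?D (\<lambda>q. 2 * m * A q * (u q)\<^sup>2)"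
    by (rule integral_add) (intro integrable_cbox_continuous continuous_intros cA cE cont)+
  moreover have "integral ?D (\<lambda>q. (u q)\<^sup>2 * (S q - 2 * m * A q)) + integral ?D (\<lambda>q. 2 * m * A q * (u q)\<^sup>2)
      = integral ?D (\<lambda>q. (u q)\<^sup>2 * (S q - 2 * m * A q) + 2 * m * A q * (u q)\<^sup>2)"
    by (rule integral_add[symmetric]) (intro integrable_cbox_continuous continuous_intros cA cS cont)+
  moreover have "\<dots> = integral ?D (\<lambda>q. S q * (u q)\<^sup>2)"
    by (simp add: algebra_simps)
  ultimately have 2: "2 * integral ?D (\<lambda>q. A q * E q) = integral ?D (\<lambda>q. S q * (u q)\<^sup>2)"
    by (simp only: integral_mult_right)
  have S: "S q \<le> 2 * \<bar>m\<bar> + 60 + 6 * c" for q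
  proof -
    obtain x y z where q: "q = (x, y, z)" by (cases q)
    have A: "0 \<le> bump X x" "bump X x \<le> 1" "\<bar>bump2 X x\<bar> \<le> 30 / X\<^sup>2" using bump_bounds[OF XY'(1), of x] by auto
    have B: "0 \<le> bump Y y" "bump Y y \<le> 1" "\<bar>bump1 Y y\<bar> \<le> 6 / Y" "\<bar>bump2 Y y\<bar> \<le> 30 / Y\<^sup>2" using bump_bounds[OF XY'(2), of y] by auto
    have "1 \<le> X\<^sup>2" "1 \<le> Y\<^sup>2" using XY by (simp_all add: one_le_power)
    then have "30 / X\<^sup>2 \<le> 30" "30 / Y\<^sup>2 \<le> 30" "6 / Y \<le> 6" using XY by (simp_all add: field_simps)
    then have b: "\<bar>bump2 X x\<bar> \<le> 30" "\<bar>bump2 Y y\<bar> \<le> 30" "\<bar>bump1 Y y\<bar> \<le> 6" using A B by linarith+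
    have t1: "\<bar>2 * m * A q\<bar> \<le> 2 * \<bar>m\<bar> * 1"
      unfolding abs_mult A_def using A B by (simp add: q abs_mult mult_le_one mult_left_le)
    have t2: "\<bar>bump2 X x * bump Y y\<bar> \<le> 30 * 1" unfolding abs_mult using A B b by (intro mult_mono) auto
    have "\<bar>c * bump1 Y y\<bar> \<le> c * 6" unfolding abs_mult using c b by (intro mult_mono) auto
    then have "\<bar>bump2 Y y + c * bump1 Y y\<bar> \<le> 30 + c * 6" using b by linarith
    then have t3: "\<bar>bump X x * (bump2 Y y + c * bump1 Y y)\<bar> \<le> 1 * (30 + c * 6)"
      unfolding abs_mult using A c by (intro mult_mono) auto
    have "S q = 2 * m * A q + (bump2 X x * bump Y y + bump X x * (bump2 Y y + c * bump1 Y y))" by (simp add: S_def q)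
    also have "\<dots> \<le> 2 * \<bar>m\<bar> * 1 + (30 * 1 + 1 * (30 + c * 6))"
      by (intro add_mono t1[THEN abs_le_D1] t2[THEN abs_le_D1] t3[THEN abs_le_D1])
    finally show ?thesis by simp
  qed
  have "integral ?H E \<le> integral ?H (\<lambda>q. 64 * (A q * E q))"
  proof (rule integral_le)
    fix q assume q': "q \<in> ?H"
    obtain x y z where q: "q = (x, y, z)" by (cases q)
    have "\<bar>x\<bar> \<le> X / 2" "\<bar>y\<bar> \<le> Y / 2" using q' by (auto simp: q)
    then have "bump X x \<ge> 1/8" "bump Y y \<ge> 1/8"
      using XY' bump_bounds(3)[of X x] bump_bounds(3)[of Y y] by linarith+
    then have "(1/8) * (1/8) \<le> A q" unfolding A_def q fst_conv snd_conv by (intro mult_mono) auto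
    from mult_right_mono[OF this, of "E q"]
    show "E q \<le> 64 * (A q * E q)" by (simp add: E_def)
  qed (intro integrable_cbox_continuous continuous_intros cA cE)+
  also have "\<dots> \<le> integral ?D (\<lambda>q. 64 * (A q * E q))"
  proof (rule integral_subset_le)
    show "?H \<subseteq> ?D" using XY' by auto
    show "\<forall>q\<in>?D. 0 \<le> 64 * (A q * E q)"
      using bump_bounds(1)[OF XY'(1)] bump_bounds(1)[OF XY'(2)] by (simp add: A_def E_def)
  qed (intro integrable_cbox_continuous continuous_intros cA cE)+
  also have "\<dots> = 32 * integral ?D (\<lambda>q. S q * (u q)\<^sup>2)" using 2 by simp
  also have "integral ?D (\<lambda>q. S q * (u q)\<^sup>2) \<le> integral ?D (\<lambda>q. (2 * \<bar>m\<bar> + 60 + 6 * c) * (u q)\<^sup>2)"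
    by (rule integral_le; (intro integrable_cbox_continuous continuous_intros cS cont)?)
      (auto intro!: mult_right_mono S)
  finally show ?thesis by (simp add: E_def mult.assoc del: distrib_left_numeral)
qed

text \<open>The equation is invariant under translation in \<open>y\<close>, whose generator is the
  multiplier \<open>u2\<close>; this is why only the drift survives. The other terms contain a
  derivative of a cut-off and are bounded through \<open>caccioppoli\<close>. The hypothesis
  \<open>int\<close> admits growth like \<open>N\<close> over a length of order \<open>N^3\<close>,
  slow enough for the errors to vanish and weak enough to follow from a bound on
  \<open>|u| powr p\<close> with \<open>p\<close> between 2 and 3.\<close>

lemma liouville_quadratic:
  assumes pde: "\<And>q. u11 q + u22 q - c * u2 q + 4 * u33 q = - m * u q" and c: "0 < c"
    and mixed: "dir_deriv dx u2 u12" "dir_deriv dy u1 u12" "dir_deriv dz u2 u32" "dir_deriv dy u3 u32"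
      "continuous_on UNIV u12" "continuous_on UNIV u32"
    and int: "\<And>x0 z0 N. 1 \<le> N \<Longrightarrow> integral (cbox (x0, - (real N ^ 3), z0) (x0 + 1, real N ^ 3, z0 + 2 * pi)) (\<lambda>q. (u q)\<^sup>2) \<le> C * real N"
  shows "u q = 0"
proof -
  define E where "E = (\<lambda>q. (u1 q)\<^sup>2 + (u2 q)\<^sup>2 + 4 * (u3 q)\<^sup>2)"
  define K1 where "K1 = 32 * (2 * \<bar>m\<bar> + 60 + 6 * c)"
  have K1: "0 \<le> K1" using c by (simp add: K1_def)
  have cE: "continuous_on UNIV E" unfolding E_def by (intro continuous_intros cont)
  have cu: "continuous_on UNIV (\<lambda>q. (u q)\<^sup>2)" by (intro continuous_intros cont)
  have cB: "continuous_on UNIV (bump X)" "continuous_on UNIV (bump1 X)" "continuous_on UNIV (bump2 X)" for X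
    by (rule continuous_bump)+
  have energy: "c / 2 * integral (cbox (-X, -Y, z0) (X, Y, z0 + 2 * pi)) (\<lambda>q. bump X (fst q) * bump Y (fst (snd q)) * (u2 q)\<^sup>2)
      \<le> integral (cbox (-X, -Y, z0) (X, Y, z0 + 2 * pi)) (\<lambda>q. (18 / (c * X\<^sup>2) + 3 / Y) * E q + 3 * \<bar>m\<bar> / Y * (u q)\<^sup>2)"
    if XY: "X > 0" "Y > 0" for X Y z0
  proof -
    let ?D = "cbox (-X, -Y, z0) (X, Y, z0 + 2 * pi)"
    note dA = dir_deriv_coord[OF DERIV_bump(1)]
    \<comment> \<open>In \<open>F1 + F2 + F3\<close> the mixed terms \<open>u1 * u12\<close> and
      \<open>u3 * u32\<close> cancel. What remains besides derivatives of the cut-offs is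
      \<open>u2 * (u11 + u22 + m * u + 4 * u33)\<close>, that is \<open>c\<close> times the square
      of \<open>u2\<close>.\<close>
    define W where "W = (\<lambda>q. (u2 q)\<^sup>2 - (u1 q)\<^sup>2 + m * (u q)\<^sup>2 - 4 * (u3 q)\<^sup>2)"
    define F1 where "F1 = (\<lambda>q. bump1 X (fst q) * bump Y (fst (snd q)) * (u1 q * u2 q)
      + bump X (fst q) * bump Y (fst (snd q)) * (u11 q * u2 q + u1 q * u12 q))"
    define F2 where "F2 = (\<lambda>q. (1/2) * (bump X (fst q) * bump1 Y (fst (snd q)) * W q)
      + bump X (fst q) * bump Y (fst (snd q)) * (u2 q * u22 q - u1 q * u12 q + m * (u q * u2 q) - 4 * (u3 q * u32 q)))"
    define F3 where "F3 = (\<lambda>q. bump X (fst q) * bump Y (fst (snd q)) * (4 * (u33 q * u2 q) + 4 * (u3 q * u32 q)))"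
    have cF: "continuous_on UNIV F1" "continuous_on UNIV F2" "continuous_on UNIV F3"
      unfolding F1_def F2_def F3_def W_def by (intro continuous_intros cont_coord cB cont mixed)+
    have sq: "dir_deriv e (\<lambda>q. (f q)\<^sup>2) (\<lambda>q. 2 * (f q * f' q))" if "dir_deriv e f f'" for e f f'
      unfolding power2_eq_square by (rule dir_deriv_eq[OF dir_deriv_mult[OF that that]]) simp
    have 1: "integral ?D F1 = 0"
    proof (rule flux_x)
      show "dir_deriv dx (\<lambda>q. bump X (fst q) * bump Y (fst (snd q)) * (u1 q * u2 q)) F1"
        by (rule dir_deriv_eq, (rule dir_deriv_mult dA dir_deriv_coord_const der mixed)+)
          (simp add: F1_def algebra_simps)
    qed (use cF XY bump_bounds(4)[of X X] bump_bounds(4)[of X "-X"] in auto)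
    have 2: "integral ?D F2 = 0"
    proof (rule flux_y)
      show "dir_deriv dy (\<lambda>q. (1/2) * (bump X (fst q) * bump Y (fst (snd q)) * W q)) F2"
        unfolding W_def by (rule dir_deriv_eq, (rule dir_deriv_const dir_deriv_mult dir_deriv_diff dir_deriv_add sq dA dir_deriv_coord_const der mixed)+)
          (simp add: F2_def W_def algebra_simps)
    qed (use cF XY bump_bounds(4)[of Y Y] bump_bounds(4)[of Y "-Y"] in auto)
    have 3: "integral ?D F3 = 0"
    proof (rule flux_z)
      have "u2 (x, y, z + 2 * pi) = u2 (x, y, z)" for x y z
      proof -
        have "(\<lambda>q. u (q + (0, 0, 2 * pi))) = u" using per by auto
        then have "dir_deriv dy u (\<lambda>q. u2 (q + (0, 0, 2 * pi)))"
          using dir_deriv_shift[OF der(2), of "(0, 0, 2 * pi)"] by simp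
        then have "(\<lambda>q. u2 (q + (0, 0, 2 * pi))) = u2"
          using der(2) dir_deriv_unique by blast
        from fun_cong[OF this, of "(x, y, z)"] show ?thesis by simp
      qed
      then show "(\<lambda>q. bump X (fst q) * bump Y (fst (snd q)) * (4 * (u3 q * u2 q))) (x, y, z0) =
        (\<lambda>q. bump X (fst q) * bump Y (fst (snd q)) * (4 * (u3 q * u2 q))) (x, y, z0 + 2 * pi)" for x y
        by (simp add: per3)
      show "dir_deriv dz (\<lambda>q. bump X (fst q) * bump Y (fst (snd q)) * (4 * (u3 q * u2 q))) F3"
        by (rule dir_deriv_eq, (rule dir_deriv_const dir_deriv_mult dA dir_deriv_coord_const der mixed)+)
          (simp add: F3_def algebra_simps)
    qed (use cF in auto)
    define V where "V = (\<lambda>q. bump X (fst q) * bump Y (fst (snd q)) * (u2 q)\<^sup>2)"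
    define R where "R = (\<lambda>q. bump1 X (fst q) * bump Y (fst (snd q)) * (u1 q * u2 q) + (1/2) * (bump X (fst q) * bump1 Y (fst (snd q)) * W q))"
    have cVR: "continuous_on UNIV V" "continuous_on UNIV R"
      unfolding V_def R_def W_def by (intro continuous_intros cont_coord cB cont)+
    have "F1 q + (F2 q + F3 q) = c * V q + R q" for q
    proof -
      have "F1 q + (F2 q + F3 q) = bump X (fst q) * bump Y (fst (snd q)) * (u2 q * (u11 q + u22 q - c * u2 q + 4 * u33 q + m * u q)) + c * V q + R q"
        by (simp add: F1_def F2_def F3_def V_def R_def algebra_simps power2_eq_square)
      then show ?thesis by (simp add: pde)
    qed
    then have "integral ?D (\<lambda>q. c * V q + R q) = integral ?D (\<lambda>q. F1 q + (F2 q + F3 q))" by simp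
    also have "\<dots> = integral ?D F1 + (integral ?D F2 + integral ?D F3)"
      using cF by (simp add: integral_add integrable_add integrable_cbox_continuous)
    finally have z: "integral ?D (\<lambda>q. c * V q + R q) = 0" by (simp add: 1 2 3)
    have "c / 2 * integral ?D V = integral ?D (\<lambda>q. c / 2 * V q) - integral ?D (\<lambda>q. c * V q + R q)"
      by (simp add: z)
    also have "\<dots> = integral ?D (\<lambda>q. c / 2 * V q - (c * V q + R q))"
      by (rule integral_diff[symmetric]) (intro integrable_cbox_continuous continuous_intros cVR)+
    also have "\<dots> \<le> integral ?D (\<lambda>q. (18 / (c * X\<^sup>2) + 3 / Y) * E q + 3 * \<bar>m\<bar> / Y * (u q)\<^sup>2)"
    proof (rule integral_le)
      fix q :: "real \<times> real \<times> real"
      obtain x y z where q: "q = (x, y, z)" by (cases q)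
      \<comment> \<open>The first derivative of the cut-off is at most \<open>6 / X * s\<close>; the
        factor \<open>s\<close> is what lets the cross term be absorbed in \<open>V\<close>.\<close>
      define s where "s = sqrt (bump X x)"
      have A: "0 \<le> bump X x" "bump X x \<le> 1" "(bump1 X x)\<^sup>2 \<le> 36 / X\<^sup>2 * bump X x" using bump_bounds[OF XY(1), of x] by auto
      have B: "0 \<le> bump Y y" "bump Y y \<le> 1" "\<bar>bump1 Y y\<bar> \<le> 6 / Y" using bump_bounds[OF XY(2), of y] by auto
      have s: "0 \<le> s" "s\<^sup>2 = bump X x" using A by (auto simp: s_def)
      have "(bump1 X x)\<^sup>2 \<le> (6 / X * s)\<^sup>2" using A(3) by (simp add: power_mult_distrib power_divide s)
      then have "\<bar>bump1 X x\<bar> \<le> 6 / X * s" using s XY abs_le_square_iff[of "bump1 X x" "6 / X * s"] by simp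
      then have "\<bar>bump1 X x\<bar> * \<bar>u1 q * u2 q\<bar> \<le> (6 / X * s) * \<bar>u1 q * u2 q\<bar>" by (intro mult_right_mono) auto
      also have "\<dots> = 6 / X * \<bar>u1 q\<bar> * (s * \<bar>u2 q\<bar>)" by (simp add: abs_mult)
      also have "\<dots> \<le> c / 2 * (s * \<bar>u2 q\<bar>)\<^sup>2 + 18 / (c * X\<^sup>2) * \<bar>u1 q\<bar>\<^sup>2"
      proof -
        \<comment> \<open>Young's inequality with weights that use up exactly half of the drift
          term; \<open>18 / c\<close> is \<open>6^2 / (2 * c)\<close>.\<close>
        have "0 \<le> 1 / (2 * c) * (c * (s * \<bar>u2 q\<bar>) - 6 / X * \<bar>u1 q\<bar>)\<^sup>2" using c by simp
        also have "\<dots> = c / 2 * (s * \<bar>u2 q\<bar>)\<^sup>2 + 18 / (c * X\<^sup>2) * \<bar>u1 q\<bar>\<^sup>2 - 6 / X * \<bar>u1 q\<bar> * (s * \<bar>u2 q\<bar>)"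
          using c XY by (simp add: power2_eq_square field_simps)
        finally show ?thesis by simp
      qed
      finally have "\<bar>bump1 X x\<bar> * \<bar>u1 q * u2 q\<bar> \<le> c / 2 * (bump X x * (u2 q)\<^sup>2) + 18 / (c * X\<^sup>2) * (u1 q)\<^sup>2"
        by (simp add: power_mult_distrib s)
      from mult_left_mono[OF this B(1)]
      have "\<bar>bump1 X x * bump Y y * (u1 q * u2 q)\<bar> \<le> c / 2 * V q + bump Y y * (18 / (c * X\<^sup>2) * (u1 q)\<^sup>2)"
        using B by (simp add: abs_mult V_def q algebra_simps)
      also have "bump Y y * (18 / (c * X\<^sup>2) * (u1 q)\<^sup>2) \<le> 18 / (c * X\<^sup>2) * (u1 q)\<^sup>2"
        using B c by (intro mult_left_le_one_le) auto
      also have "\<dots> \<le> 18 / (c * X\<^sup>2) * E q" using c by (intro mult_left_mono) (auto simp: E_def)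
      finally have t1: "\<bar>bump1 X x * bump Y y * (u1 q * u2 q)\<bar> \<le> c / 2 * V q + 18 / (c * X\<^sup>2) * E q" by simp
      have "\<bar>W q\<bar> \<le> E q + \<bar>m\<bar> * (u q)\<^sup>2"
      proof -
        have "\<bar>m * (u q)\<^sup>2\<bar> = \<bar>m\<bar> * (u q)\<^sup>2" by (simp add: abs_mult)
        then show ?thesis using zero_le_power2[of "u1 q"] zero_le_power2[of "u2 q"] zero_le_power2[of "u3 q"]
          unfolding W_def E_def by linarith
      qed
      then have "\<bar>bump X x\<bar> * \<bar>bump1 Y y\<bar> * \<bar>W q\<bar> \<le> (1 * (6 / Y)) * (E q + \<bar>m\<bar> * (u q)\<^sup>2)"
        using A B XY by (intro mult_mono) (auto simp: E_def)
      then have t2: "\<bar>bump X x * bump1 Y y * W q\<bar> \<le> 2 * (3 / Y * E q + 3 * \<bar>m\<bar> / Y * (u q)\<^sup>2)"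
        by (simp add: abs_mult algebra_simps)
      have R: "R q = bump1 X x * bump Y y * (u1 q * u2 q) + (1/2) * (bump X x * bump1 Y y * W q)" by (simp add: R_def q)
      have "c / 2 * V q - (c * V q + R q) = - (c / 2 * V q) - R q" by (simp add: field_simps)
      also have "\<dots> \<le> 18 / (c * X\<^sup>2) * E q + (3 / Y * E q + 3 * \<bar>m\<bar> / Y * (u q)\<^sup>2)"
      proof -
        have "\<bar>a\<bar> \<le> v + p \<Longrightarrow> \<bar>b\<bar> \<le> 2 * s \<Longrightarrow> - v - (a + (1/2) * b) \<le> p + s" for a b v p s :: real
          by linarith
        from this[OF t1 t2] show ?thesis unfolding R .
      qed
      finally show "c / 2 * V q - (c * V q + R q) \<le> (18 / (c * X\<^sup>2) + 3 / Y) * E q + 3 * \<bar>m\<bar> / Y * (u q)\<^sup>2"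
        by (simp add: algebra_simps)
    qed (intro integrable_cbox_continuous continuous_intros cVR cE cont)+
    finally show ?thesis by (simp add: V_def)
  qed
  have C0: "0 \<le> C"
    using int[of 1 0 0] integral_nonneg[OF integrable_cbox_continuous[OF cu]] by (simp) (meson order_trans zero_le_power2)
  have J: "integral (cbox (-real n0, -real n0, z0) (real n0, real n0, z0 + 2 * pi)) (\<lambda>q. (u2 q)\<^sup>2) \<le> 0" (is "integral ?I _ \<le> 0")
    if n0: "n0 > 0" for n0 :: nat and z0
  proof -
    define K2 where "K2 = 64 * (2 / c) * ((18 / c + 3) * (K1 * (8 * C)) + 3 * \<bar>m\<bar> * (8 * C))"
    have "integral ?I (\<lambda>q. (u2 q)\<^sup>2) \<le> K2 / real n" if n: "n \<ge> 2 * n0" for n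
    proof -
      \<comment> \<open>The integral of \<open>u\<^sup>2\<close> over the box is of order \<open>n ^ 5\<close>, and the error terms carry \<open>1 / X\<^sup>2\<close> or \<open>1 / Y\<close>.\<close>
      define X Y where "X = real n ^ 3" and "Y = real n ^ 6"
      have n1: "1 \<le> real n" "2 * real n0 \<le> real n" using n n0 by auto
      have XY: "1 \<le> X" "1 \<le> Y" "0 < X" "0 < Y" using n1 by (auto simp: X_def Y_def)
      have "real n \<le> X" "real n \<le> Y" using n1 by (auto simp: X_def Y_def intro: self_le_power)
      then have nX: "2 * real n0 \<le> X" "2 * real n0 \<le> Y" using n1 by linarith+
      let ?D = "cbox (-X, -Y, z0) (X, Y, z0 + 2 * pi)"
      \<comment> \<open>The energy on a box costs the integral of the squared function on the box of
        twice the size.\<close>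
      let ?DD = "cbox (- (2 * X), - (2 * Y), z0) (2 * X, 2 * Y, z0 + 2 * pi)"
      have mono: "64 * (2 / c) * r \<le> 64 * (2 / c) * s" if "r \<le> s" for r s
        using that c by (intro mult_left_mono) auto
      have DD: "integral ?DD (\<lambda>q. (u q)\<^sup>2) \<le> 8 * C * real n ^ 5"
      proof -
        \<comment> \<open>Then \<open>N^3 = 8 * n^6\<close> covers the half-length
          \<open>2 * Y\<close>, and the \<open>x\<close>-interval of length \<open>4 * X\<close>
          splits into \<open>4 * n^3\<close> unit slabs, each with integral at most
          \<open>2 * C * n^2\<close>.\<close>
        define N where "N = 2 * n\<^sup>2"
        have N: "1 \<le> N" "2 * Y \<le> real N ^ 3" using n1 by (auto simp: N_def Y_def power_mult_distrib simp flip: power_mult)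
        have "integral (cbox (-(2 * X), - (real N ^ 3), z0) (-(2 * X) + real (4 * n ^ 3), real N ^ 3, z0 + 2 * pi)) (\<lambda>q. (u q)\<^sup>2)
          \<le> real (4 * n ^ 3) * (C * real N)"
          by (rule integral_slab_le[OF cu int[OF N(1)]])
        moreover have "real (4 * n ^ 3) * (C * real N) = 8 * C * real n ^ 5"
          by (simp add: N_def power_numeral_reduce)
        moreover have "integral ?DD (\<lambda>q. (u q)\<^sup>2) \<le> integral (cbox (-(2 * X), - (real N ^ 3), z0) (-(2 * X) + real (4 * n ^ 3), real N ^ 3, z0 + 2 * pi)) (\<lambda>q. (u q)\<^sup>2)"
          by (rule integral_subset_le) (use N in \<open>auto intro!: integrable_cbox_continuous cu simp: X_def\<close>)
        ultimately show ?thesis by linarith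
      qed
      have DE: "integral ?D E \<le> K1 * (8 * C * real n ^ 5)"
        using caccioppoli[OF pde c, of "2 * X" "2 * Y" z0] XY mult_left_mono[OF DD K1] by (simp add: K1_def E_def)
      have "integral ?D (\<lambda>q. (u q)\<^sup>2) \<le> integral ?DD (\<lambda>q. (u q)\<^sup>2)"
        by (rule integral_subset_le) (use XY in \<open>auto intro!: integrable_cbox_continuous cu\<close>)
      then have DU: "integral ?D (\<lambda>q. (u q)\<^sup>2) \<le> 8 * C * real n ^ 5" using DD by linarith
      have "integral ?I (\<lambda>q. (u2 q)\<^sup>2) \<le> integral ?I (\<lambda>q. 64 * (bump X (fst q) * bump Y (fst (snd q)) * (u2 q)\<^sup>2))"
      proof (rule integral_le)
        fix q assume q': "q \<in> ?I"
        obtain x y z where q: "q = (x, y, z)" by (cases q)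
        have "\<bar>x\<bar> \<le> real n0" "\<bar>y\<bar> \<le> real n0" using q' by (auto simp: q)
        then have "\<bar>x\<bar> \<le> X / 2" "\<bar>y\<bar> \<le> Y / 2" using nX by linarith+
        then have "bump X x \<ge> 1/8" "bump Y y \<ge> 1/8"
          using XY bump_bounds(3)[of X x] bump_bounds(3)[of Y y] by linarith+
        then have "(1/8) * (1/8) \<le> bump X x * bump Y y" by (intro mult_mono) auto
        from mult_right_mono[OF this, of "(u2 q)\<^sup>2"]
        show "(u2 q)\<^sup>2 \<le> 64 * (bump X (fst q) * bump Y (fst (snd q)) * (u2 q)\<^sup>2)" by (simp add: q)
      qed (intro integrable_cbox_continuous continuous_intros cont_coord cB cont)+
      also have "\<dots> \<le> integral ?D (\<lambda>q. 64 * (bump X (fst q) * bump Y (fst (snd q)) * (u2 q)\<^sup>2))"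
      proof (rule integral_subset_le)
        show "?I \<subseteq> ?D" using nX by auto
      qed (use bump_bounds(1) XY in \<open>auto intro!: integrable_cbox_continuous continuous_intros cont_coord cB cont\<close>)
      also have "\<dots> = 64 * (2 / c) * (c / 2 * integral ?D (\<lambda>q. bump X (fst q) * bump Y (fst (snd q)) * (u2 q)\<^sup>2))" using c by simp
      also have "\<dots> \<le> 64 * (2 / c) * integral ?D (\<lambda>q. (18 / (c * X\<^sup>2) + 3 / Y) * E q + 3 * \<bar>m\<bar> / Y * (u q)\<^sup>2)"
        using energy[of X Y z0] XY c by (intro mult_left_mono) auto
      also have "integral ?D (\<lambda>q. (18 / (c * X\<^sup>2) + 3 / Y) * E q + 3 * \<bar>m\<bar> / Y * (u q)\<^sup>2)
        = (18 / (c * X\<^sup>2) + 3 / Y) * integral ?D E + 3 * \<bar>m\<bar> / Y * integral ?D (\<lambda>q. (u q)\<^sup>2)"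
        using XY c by (subst integral_add) (auto intro!: integrable_cbox_continuous continuous_intros cE cont)
      also have "\<dots> \<le> (18 / (c * X\<^sup>2) + 3 / Y) * (K1 * (8 * C * real n ^ 5)) + 3 * \<bar>m\<bar> / Y * (8 * C * real n ^ 5)"
        using DE DU XY c by (intro add_mono mult_left_mono) auto
      also have "\<dots> = ((18 / c + 3) * (K1 * (8 * C)) + 3 * \<bar>m\<bar> * (8 * C)) / real n"
      proof -
        have "X\<^sup>2 = real n ^ 6" by (simp add: X_def flip: power_mult)
        moreover have "real n ^ 6 = real n ^ 5 * real n" by (simp add: power_numeral_reduce)
        ultimately show ?thesis using n1 c by (simp add: Y_def field_simps)
      qed
      finally have "integral ?I (\<lambda>q. (u2 q)\<^sup>2) \<le> 64 * (2 / c) * (((18 / c + 3) * (K1 * (8 * C)) + 3 * \<bar>m\<bar> * (8 * C)) / real n)"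
        using mono by blast
      then show ?thesis by (simp only: K2_def times_divide_eq_right)
    qed
    then show ?thesis by (intro LIMSEQ_le_const[OF lim_const_over_n[of K2]]) blast
  qed
  have u2z: "u2 q = 0" for q
  proof -
    obtain x y z where q: "q = (x, y, z)" by (cases q)
    obtain n0 :: nat where n0: "n0 > 0" "\<bar>x\<bar> \<le> real n0" "\<bar>y\<bar> \<le> real n0"
    proof -
      obtain n0 :: nat where "\<bar>x\<bar> + \<bar>y\<bar> + 1 \<le> real n0" using real_arch_simple by blast
      then show thesis by (intro that[of n0]) linarith+
    qed
    let ?I = "cbox (-real n0, -real n0, z) (real n0, real n0, z + 2 * pi)"
    have c2: "continuous_on UNIV (\<lambda>q. (u2 q)\<^sup>2)" by (intro continuous_intros cont)
    have "integral ?I (\<lambda>q. (u2 q)\<^sup>2) = 0"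
      using J[OF n0(1)] integral_nonneg[OF integrable_cbox_continuous[OF c2]] by (meson order_antisym zero_le_power2)
    moreover have "box (-real n0, -real n0, z) (real n0, real n0, z + 2 * pi) \<noteq> {}"
      using n0 by (auto simp: box_ne_empty Basis_prod_def)
    moreover have "continuous_on ?I (\<lambda>q. (u2 q)\<^sup>2)" using c2 continuous_on_subset by blast
    ultimately have "\<forall>q\<in>?I. (u2 q)\<^sup>2 = 0"
      using integral_cbox_eq_0_iff[of _ _ "\<lambda>q. (u2 q)\<^sup>2"] zero_le_power2 by blast
    moreover have "q \<in> ?I" using n0 by (auto simp: q)
    ultimately show ?thesis by simp
  qed
  obtain x y z where q: "q = (x, y, z)" by (cases q)
  \<comment> \<open>Since \<open>u\<close> does not depend on \<open>y\<close>, its square has mass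
    \<open>2 * L * f\<close> over a slab of half-length \<open>L\<close>. For \<open>L = n^3\<close>
    this is compatible with the bound \<open>C * n\<close> only if \<open>f\<close>
    vanishes.\<close>
  define v where "v x z = u (x, 0, z)" for x z
  have uy: "u (x, y, z) = v x z" for x y z
  proof -
    have "dir_deriv dy u (\<lambda>q. 0)" using der(2) u2z by (rule dir_deriv_eq)
    from dir_deriv_0_imp_const[OF this, of "(x, 0, z)" y] show ?thesis by (simp add: v_def)
  qed
  define f where "f = integral {x..x + 1} (\<lambda>x. integral {z..z + 2 * pi} (\<lambda>z. (v x z)\<^sup>2))"
  have slab: "integral (cbox (x, -L, z) (x + 1, L, z + 2 * pi)) (\<lambda>q. (u q)\<^sup>2) = 2 * L * f" if "L \<ge> 0" for L
    using that by (simp add: integral_triple_y[OF cu] uy f_def)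
  have "0 \<le> integral (cbox (x, -1, z) (x + 1, 1, z + 2 * pi)) (\<lambda>q. (u q)\<^sup>2)"
    by (rule integral_nonneg[OF integrable_cbox_continuous[OF cu]]) simp
  then have f0: "0 \<le> f" using slab[of 1] by simp
  have "f \<le> C / real n" if "n \<ge> 1" for n
  proof -
    have "2 * real n ^ 3 * f \<le> C * real n" using int[of n x z] slab[of "real n ^ 3"] that by simp
    then have "2 * (real n * real n) * f \<le> C" using that by (simp add: power3_eq_cube)
    moreover have "real n * 1 \<le> 2 * (real n * real n)" using that by (intro order_trans[OF mult_left_mono[of 1 "real n"]]) auto
    then have "real n * f \<le> 2 * (real n * real n) * f" using f0 by (intro mult_right_mono) auto
    ultimately show ?thesis using that by (simp add: field_simps)
  qed
  then have "f \<le> 0" by (intro LIMSEQ_le_const[OF lim_const_over_n[of C]]) blast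
  then have "integral (cbox (x, -(\<bar>y\<bar> + 1), z) (x + 1, \<bar>y\<bar> + 1, z + 2 * pi)) (\<lambda>q. (u q)\<^sup>2) = 0" (is "integral ?I _ = 0")
    using slab[of "\<bar>y\<bar> + 1"] f0 by simp
  moreover have "box (x, -(\<bar>y\<bar> + 1), z) (x + 1, \<bar>y\<bar> + 1, z + 2 * pi) \<noteq> {}"
    by (auto simp: box_ne_empty Basis_prod_def)
  moreover have "continuous_on ?I (\<lambda>q. (u q)\<^sup>2)" using cu continuous_on_subset by blast
  ultimately have "\<forall>q\<in>?I. (u q)\<^sup>2 = 0"
    using integral_cbox_eq_0_iff[of _ _ "\<lambda>q. (u q)\<^sup>2"] zero_le_power2 by blast
  moreover have "q \<in> ?I" by (auto simp: q)
  ultimately show ?thesis by simp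
qed

end

subsection \<open>Solutions on the flat cone\<close>

lemma powr_ge_tangent:
  fixes t m p :: real
  assumes p: "1 \<le> p" and t: "0 \<le> t" and m: "0 < m"
  shows "m powr p + p * m powr (p - 1) * (t - m) \<le> t powr p"
proof -
  have mp: "m powr p = m powr (p - 1) * m" using m by (simp add: powr_diff)
  show ?thesis
  proof (cases "t = 0")
    case True
    have "m powr p + p * m powr (p - 1) * (t - m) = (1 - p) * m powr p"
      by (simp add: True mp algebra_simps)
    also have "\<dots> \<le> 0" using p by (simp add: mult_nonpos_nonneg)
    finally show ?thesis by (simp add: True)
  next
    case False
    then have t: "0 < t" using t by simp
    have "((\<lambda>x. x powr p) has_real_derivative p * x powr (p - 1)) (at x)" if "0 < x" for x
      using that by (rule has_real_derivative_powr)
    consider "t < m" | "t = m" | "m < t" by linarith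
    then show ?thesis
    proof cases
      case 1
      obtain z where z: "t < z" "z < m" "m powr p - t powr p = (m - t) * (p * z powr (p - 1))"
        using MVT2[OF 1, of "\<lambda>x. x powr p" "\<lambda>x. p * x powr (p - 1)"] t
        by (metis has_real_derivative_powr order_less_le_trans)
      have "z powr (p - 1) \<le> m powr (p - 1)" using z t p by (intro powr_mono2) auto
      then have "(m - t) * (p * z powr (p - 1)) \<le> (m - t) * (p * m powr (p - 1))"
        using 1 p by (intro mult_left_mono) auto
      then show ?thesis using z(3) by (simp add: algebra_simps)
    next
      case 3
      obtain z where z: "m < z" "z < t" "t powr p - m powr p = (t - m) * (p * z powr (p - 1))"
        using MVT2[OF 3, of "\<lambda>x. x powr p" "\<lambda>x. p * x powr (p - 1)"] m
        by (metis has_real_derivative_powr order_less_le_trans)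
      have "m powr (p - 1) \<le> z powr (p - 1)" using z m p by (intro powr_mono2) auto
      then have "(t - m) * (p * m powr (p - 1)) \<le> (t - m) * (p * z powr (p - 1))"
        using 3 p by (intro mult_left_mono) auto
      then show ?thesis using z(3) by (simp add: algebra_simps)
    qed simp
  qed
qed

text \<open>The measure on \<open>[0, h]\<close> has total mass at most 1, and the integral is not
  divided by \<open>h\<close>. The tangent inequality is therefore used at the point
  \<open>m\<close>, the integral of \<open>|f|\<close>; integrating it gives
  \<open>m powr p * (h + p * (1 - h))\<close>, and the bracket is at least 1.\<close>

lemma jensen_powr_unit:
  fixes f :: "real \<Rightarrow> real"
  assumes p: "1 \<le> p" and h: "0 < h" "h \<le> 1" and c: "continuous_on UNIV f"
  shows "\<bar>integral {0..h} f\<bar> powr p \<le> integral {0..h} (\<lambda>s. \<bar>f s\<bar> powr p)"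
proof -
  define m where "m = integral {0..h} (\<lambda>s. \<bar>f s\<bar>)"
  have ci: "g integrable_on {0..h}" if "continuous_on UNIV g" for g :: "real \<Rightarrow> real"
    using that by (meson continuous_on_subset integrable_continuous_real top_greatest)
  have ca: "continuous_on UNIV (\<lambda>s. \<bar>f s\<bar>)" "continuous_on UNIV (\<lambda>s. \<bar>f s\<bar> powr p)"
    using p by (auto intro!: continuous_intros c continuous_on_powr')
  have fm: "\<bar>integral {0..h} f\<bar> \<le> m"
    unfolding m_def using integral_norm_bound_integral[OF ci[OF c] ci[OF ca(1)]] by simp
  have m0: "0 \<le> m" using fm by linarith
  show ?thesis
  proof (cases "m = 0")
    case True
    then show ?thesis using fm integral_nonneg[OF ci[OF ca(2)]] by simp
  next
    case False
    then have m: "0 < m" using m0 by simp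
    have "m powr p \<le> m powr p * (h + p * (1 - h))"
    proof -
      have "0 \<le> (p - 1) * (1 - h)" using p h by simp
      then have "1 \<le> h + p * (1 - h)" by (simp add: algebra_simps)
      then show ?thesis by (simp add: mult_le_cancel_left1)
    qed
    also have "\<dots> = m powr p * h + p * m powr (p - 1) * (m - h * m)"
    proof -
      have "m powr p = m powr (p - 1) * m" using m by (simp add: powr_diff)
      then show ?thesis by (simp add: algebra_simps)
    qed
    also have "\<dots> = integral {0..h} (\<lambda>s. m powr p - p * m powr (p - 1) * m)
        + integral {0..h} (\<lambda>s. p * m powr (p - 1) * \<bar>f s\<bar>)"
      using h by (simp only: integral_mult_right m_def[symmetric]) (simp add: algebra_simps)
    also have "\<dots> = integral {0..h} (\<lambda>s. (m powr p - p * m powr (p - 1) * m) + p * m powr (p - 1) * \<bar>f s\<bar>)"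
      by (rule integral_add[symmetric]) (intro ci continuous_intros ca)+
    also have "\<dots> \<le> integral {0..h} (\<lambda>s. \<bar>f s\<bar> powr p)"
    proof (rule integral_le)
      show "m powr p - p * m powr (p - 1) * m + p * m powr (p - 1) * \<bar>f s\<bar> \<le> \<bar>f s\<bar> powr p" for s
        using powr_ge_tangent[OF p _ m, of "\<bar>f s\<bar>"] by (simp add: algebra_simps)
    qed (intro ci continuous_intros ca)+
    finally have "m powr p \<le> integral {0..h} (\<lambda>s. \<bar>f s\<bar> powr p)" .
    moreover have "\<bar>integral {0..h} f\<bar> powr p \<le> m powr p" using fm p by (intro powr_mono2) auto
    ultimately show ?thesis by linarith
  qed
qed

section \<open>Averages of functions with an integral bound on slabs\<close>

lemma steklov_mono:
  fixes f :: "'a::real_normed_vector \<Rightarrow> real"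
  assumes "continuous_on UNIV f" "continuous_on UNIV g" "\<And>q. f q \<le> g q"
  shows "steklov h e f q \<le> steklov h e g q"
  unfolding steklov_def using assms
  by (intro integral_le integrable_continuous_interval continuous_steklov_integrand)

lemma steklov_add:
  fixes f :: "'a::real_normed_vector \<Rightarrow> real"
  assumes "continuous_on UNIV f" "continuous_on UNIV g"
  shows "steklov h e (\<lambda>q. f q + g q) = (\<lambda>q. steklov h e f q + steklov h e g q)"
  unfolding steklov_def
  by (intro ext integral_add integrable_continuous_interval continuous_steklov_integrand assms)

lemma steklov_mult: "steklov h e (\<lambda>q. c * f q) = (\<lambda>q. c * steklov h e f q)"
  by (simp add: steklov_def[abs_def])

lemma steklov_powr:
  fixes f :: "'a::real_normed_vector \<Rightarrow> real"
  assumes "1 \<le> p" "0 < h" "h \<le> 1" "continuous_on UNIV f"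
  shows "\<bar>steklov h e f q\<bar> powr p \<le> steklov h e (\<lambda>q. \<bar>f q\<bar> powr p) q"
  unfolding steklov_def by (rule jensen_powr_unit) (use assms continuous_steklov_integrand in auto)

text \<open>After exchanging the integrals, the inner one is over a translated slab of the same
  widths, where the same bound \<open>C\<close> holds.\<close>

lemma integral_slab_steklov:
  fixes g :: "real \<times> real \<times> real \<Rightarrow> real"
  assumes c: "continuous_on UNIV g" and h: "0 < h" "h \<le> 1" and C0: "0 \<le> C"
    and C: "\<And>x0 y0 y1 z0. integral (cbox (x0, y0, z0) (x0 + 1, y1, z0 + w)) g \<le> C"
  shows "integral (cbox (x0, y0, z0) (x0 + 1, y1, z0 + w)) (steklov h e g) \<le> C"
proof -
  obtain e1 e2 e3 where e: "e = (e1, e2, e3)" by (cases e)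
  let ?D = "cbox (x0, y0, z0) (x0 + 1, y1, z0 + w)"
  have cc: "continuous_on S (\<lambda>(q, s). g (q + s *\<^sub>R e))" for S
    by (auto intro!: continuous_intros continuous_on_compose2[OF c] simp: split_beta)
  have "integral ?D (steklov h e g) = integral ?D (\<lambda>q. integral (cbox 0 h) (\<lambda>s. g (q + s *\<^sub>R e)))"
    by (simp add: steklov_def[abs_def])
  also have "\<dots> = integral (cbox 0 h) (\<lambda>s. integral ?D (\<lambda>q. g (q + s *\<^sub>R e)))"
    by (rule integral_swap_continuous) (rule cc)
  also have "\<dots> \<le> integral (cbox 0 h) (\<lambda>s. C)"
  proof (rule integral_le)
    have "continuous_on (cbox 0 h) (\<lambda>s. integral ?D (\<lambda>q. g (q + s *\<^sub>R e)))"
      by (rule integral_continuous_on_param)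
        (auto intro!: continuous_intros continuous_on_compose2[OF c] simp: split_beta)
    then show "(\<lambda>s. integral ?D (\<lambda>q. g (q + s *\<^sub>R e))) integrable_on cbox 0 h"
      by (rule integrable_continuous)
    fix s
    have "integral ?D (\<lambda>q. g (q + s *\<^sub>R e)) =
        integral (cbox (x0 + s * e1, y0 + s * e2, z0 + s * e3) ((x0 + s * e1) + 1, y1 + s * e2, (z0 + s * e3) + w)) g"
      using integral_shift_cbox[of "(x0 + s * e1, y0 + s * e2, z0 + s * e3)" "s *\<^sub>R e" "((x0 + s * e1) + 1, y1 + s * e2, (z0 + s * e3) + w)" g]
      by (simp add: e algebra_simps)
    also have "\<dots> \<le> C" by (rule C)
    finally show "integral ?D (\<lambda>q. g (q + s *\<^sub>R e)) \<le> C" .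
  qed auto
  also have "\<dots> = h * C" using h by simp
  also have "\<dots> \<le> C" using h C0 by (simp add: mult_left_le_one_le)
  finally show ?thesis .
qed

text \<open>Averaging in all three directions at a point is integration over a small box contained
  in one slab. In this way the integral bound becomes a pointwise one.\<close>

lemma steklov_triple_le:
  fixes g :: "real \<times> real \<times> real \<Rightarrow> real"
  assumes c: "continuous_on UNIV g" and g0: "\<And>q. 0 \<le> g q" and h: "h1 \<le> 1" "h2 \<le> 1" "h3 \<le> w"
    and C: "\<And>x0 y0 y1 z0. integral (cbox (x0, y0, z0) (x0 + 1, y1, z0 + w)) g \<le> C"
  shows "steklov h1 dx (steklov h2 dy (steklov h3 dz g)) q \<le> C"
proof -
  obtain x y z where q: "q = (x, y, z)" by (cases q)
  define f where "f = (\<lambda>q'. g (q' + q))"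
  have cf: "continuous_on UNIV f" unfolding f_def by (intro continuous_on_compose2[OF c]) (auto intro!: continuous_intros)
  have "steklov h1 dx (steklov h2 dy (steklov h3 dz g)) q = integral (cbox (0, 0, 0) (h1, h2, h3)) f"
    unfolding integral_triple[OF cf] by (simp add: steklov_def f_def q ac_simps)
  also have "\<dots> \<le> integral (cbox (0, 0, 0) (1, 1, w)) f"
  proof (rule integral_subset_le)
    show "\<forall>q'\<in>cbox (0, 0, 0) (1, 1, w). 0 \<le> f q'" using g0 by (simp add: f_def)
  qed (use h cf in \<open>auto intro!: integrable_cbox_continuous\<close>)
  also have "\<dots> = integral (cbox (x, y, z) (x + 1, y + 1, z + w)) g"
    using integral_shift_cbox[of "(x, y, z)" "(x, y, z)" "(x + 1, y + 1, z + w)" g] by (simp add: f_def q zero_prod_def)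
  also have "\<dots> \<le> C" by (rule C)
  finally show ?thesis .
qed

text \<open>The multiplier \<open>u2\<close> requires the mixed derivatives involving
  \<open>y\<close>; using one name for both orders of differentiation builds in their
  symmetry.\<close>

locale jet2_mixed = jet2 +
  fixes u12 u32 :: "real \<times> real \<times> real \<Rightarrow> real"
  assumes mixed: "dir_deriv dx u2 u12" "dir_deriv dy u1 u12" "dir_deriv dz u2 u32" "dir_deriv dy u3 u32"
    and cont_mixed: "continuous_on UNIV u12" "continuous_on UNIV u32"
begin

lemma steklov_jet:
  "jet2_mixed (steklov h e u) (steklov h e u1) (steklov h e u2) (steklov h e u3)
    (steklov h e u11) (steklov h e u22) (steklov h e u33) (steklov h e u12) (steklov h e u32)"
proof
  show "steklov h e u (x, y, z + 2 * pi) = steklov h e u (x, y, z)" for x y z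
  proof -
    obtain e1 e2 e3 where e: "e = (e1, e2, e3)" by (cases e)
    have "u (a, b, z + 2 * pi + s) = u (a, b, z + s)" for a b s
      using per[of a b "z + s"] by (simp add: ac_simps)
    then show ?thesis by (simp add: steklov_def e)
  qed
qed (intro dir_deriv_steklov continuous_steklov der mixed cont cont_mixed)+

text \<open>For \<open>p\<close> at least 3 one has \<open>a \<le> 1\<close> and the zero-order
  coefficient is nonnegative. For smaller \<open>p\<close> the drift \<open>2 * a - 1\<close> is
  positive, and the remaining task is to derive a bound on squares from one on
  \<open>|u| powr p\<close>; the cases below and above \<open>p = 2\<close> do this
  differently.\<close>

lemma liouville_cone:
  fixes p C :: real
  assumes p: "1 \<le> p" and a: "a = 3 / p"
    and pde: "\<And>q. u11 q + u22 q + (1 - 2 * a) * u2 q + 4 * u33 q = (a - a\<^sup>2) * u q"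
    and int: "\<And>x0 y0 y1 z0. integral (cbox (x0, y0, z0) (x0 + 1, y1, z0 + 2 * pi)) (\<lambda>q. \<bar>u q\<bar> powr p) \<le> C"
  shows "u q = 0"
proof -
  have cp: "continuous_on UNIV (\<lambda>q. \<bar>u q\<bar> powr p)"
    using p by (auto intro!: continuous_intros cont continuous_on_powr')
  have C0: "0 \<le> C"
    using int[of 0 0 0 0] integral_nonneg[OF integrable_cbox_continuous[OF cp], of "(0, 0, 0)" "(1, 0, 2 * pi)"] by simp
  consider "3 \<le> p" | "2 \<le> p" "p < 3" | "p < 2" by linarith
  then show ?thesis
  proof cases
    case 1
    have a01: "0 < a" "a \<le> 1" using 1 by (auto simp: a)
    show ?thesis
    proof (rule liouville_convex[where p=p and C=C and k="\<lambda>y. 1" and k'="\<lambda>y. 0" and \<alpha>="\<lambda>y. 1" and \<beta>="\<lambda>y. 4"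
        and \<mu>="\<lambda>y. 1" and \<mu>min=1 and d="1 - 2 * a" and m="a - a\<^sup>2" and K="1 + \<bar>1 - 2 * a\<bar>"])
      show "1 * u11 (x, y, z) + (1 * u22 (x, y, z) + (0 + (1 - 2 * a)) * u2 (x, y, z)) + 4 * u33 (x, y, z) = (a - a\<^sup>2) * u (x, y, z)" for x y z
        using pde[of "(x, y, z)"] by simp
      show "0 \<le> a - a\<^sup>2" using a01 by (simp add: power2_eq_square mult_left_le)
      show "\<exists>M. \<forall>x y z. \<bar>x\<bar> \<le> X \<longrightarrow> 1 * \<bar>u (x, y, z)\<bar> powr p \<le> M + (1 + \<bar>1 - 2 * a\<bar>) * (\<bar>u (x, y, z)\<bar> powr p * 1)" for X
        by (intro exI[of _ 0]) (simp add: algebra_simps)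
    qed (use p int in auto)
  next
    case 2
    have c: "0 < 2 * a - 1" using 2 by (simp add: a)
    show ?thesis
    proof (rule liouville_quadratic[where c="2 * a - 1" and m="a\<^sup>2 - a" and C="4 * pi + C", OF _ c mixed cont_mixed])
      show "u11 q + u22 q - (2 * a - 1) * u2 q + 4 * u33 q = - (a\<^sup>2 - a) * u q" for q
        using pde[of q] by (simp add: algebra_simps)
      fix x0 z0 :: real and N :: nat assume N: "1 \<le> N"
      let ?D = "cbox (x0, - (real N ^ 3), z0) (x0 + 1, real N ^ 3, z0 + 2 * pi)"
      have "integral ?D (\<lambda>q. (u q)\<^sup>2) \<le> integral ?D (\<lambda>q. 1 / (real N)\<^sup>2 + real N * \<bar>u q\<bar> powr p)"
      proof (rule integral_le)
        \<comment> \<open>Split at size \<open>1 / N\<close>. Below it, \<open>1 / N^2\<close>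
          integrates to \<open>4 * pi * N\<close> over the slab of volume
          \<open>4 * pi * N^3\<close>. Above it, \<open>|u| powr (2 - p)\<close> is at most
          \<open>N powr (p - 2)\<close>, hence at most \<open>N\<close>.\<close>
        show "(u q)\<^sup>2 \<le> 1 / (real N)\<^sup>2 + real N * \<bar>u q\<bar> powr p" for q
        proof (cases "\<bar>u q\<bar> \<le> 1 / real N")
          case True
          then have "\<bar>u q\<bar>\<^sup>2 \<le> (1 / real N)\<^sup>2" by (intro power_mono) auto
          then show ?thesis by (simp add: power_divide add_increasing2)
        next
          case False
          then have u0: "1 / real N < \<bar>u q\<bar>" "0 < \<bar>u q\<bar>" using N by (auto intro: order_less_le_trans[of 0 "1 / real N"] simp: not_le less_imp_le)
          have "\<bar>u q\<bar> powr (2 - p) \<le> (1 / real N) powr (2 - p)"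
            using u0 2 N by (intro powr_mono2') auto
          also have "\<dots> = real N powr (p - 2)" using N by (simp add: powr_divide powr_minus_divide[symmetric])
          also have "\<dots> \<le> real N powr 1" using N 2 by (intro powr_mono) auto
          finally have *: "\<bar>u q\<bar> powr (2 - p) \<le> real N" using N by simp
          have "(u q)\<^sup>2 = \<bar>u q\<bar> powr 2" using u0 by (simp add: powr_numeral)
          also have "\<dots> = \<bar>u q\<bar> powr (2 - p) * \<bar>u q\<bar> powr p" by (simp flip: powr_add)
          also have "\<dots> \<le> real N * \<bar>u q\<bar> powr p" using * by (intro mult_right_mono) auto
          finally show ?thesis by (simp add: add_increasing)
        qed
      qed (intro integrable_cbox_continuous continuous_intros cont cp)+
      also have "\<dots> = integral ?D (\<lambda>q. 1 / (real N)\<^sup>2) + integral ?D (\<lambda>q. real N * \<bar>u q\<bar> powr p)"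
        by (rule integral_add) (intro integrable_cbox_continuous continuous_on_const continuous_on_mult cp)+
      also have "integral ?D (\<lambda>q. 1 / (real N)\<^sup>2) = 4 * pi * real N"
        using N by (subst integral_const_triple) (auto simp: power2_eq_square power3_eq_cube)
      also have "integral ?D (\<lambda>q. real N * \<bar>u q\<bar> powr p) \<le> real N * C"
        using int N by (simp add: mult_left_mono)
      finally show "integral ?D (\<lambda>q. (u q)\<^sup>2) \<le> (4 * pi + C) * real N" by (simp add: algebra_simps)
    qed
  next
    case 3
    have c: "0 < 2 * a - 1" using 3 p by (simp add: a field_simps)
    have z: "steklov h1 dx (steklov h2 dy (steklov h3 dz u)) q = 0"
      if h: "0 < h1" "h1 \<le> 1" "0 < h2" "h2 \<le> 1" "0 < h3" "h3 \<le> 1" for h1 h2 h3 q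
    proof -
      \<comment> \<open>The equation has constant coefficients, so the averaged function satisfies
        it again, and unlike \<open>u\<close> it is bounded in terms of \<open>C\<close>.\<close>
      define A where "A f = steklov h1 dx (steklov h2 dy (steklov h3 dz f))" for f
      interpret J3: jet2_mixed "steklov h3 dz u" "steklov h3 dz u1" "steklov h3 dz u2" "steklov h3 dz u3"
        "steklov h3 dz u11" "steklov h3 dz u22" "steklov h3 dz u33" "steklov h3 dz u12" "steklov h3 dz u32"
        by (rule steklov_jet)
      note J2' = J3.steklov_jet[of h2 dy]
      interpret J: jet2_mixed "A u" "A u1" "A u2" "A u3" "A u11" "A u22" "A u33" "A u12" "A u32"
        unfolding A_def by (rule jet2_mixed.steklov_jet[OF J2'])
      have cA: "continuous_on UNIV (A f)" if "continuous_on UNIV f" for f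
        unfolding A_def by (intro continuous_steklov that)
      have Aadd: "A (\<lambda>q. f q + g q) = (\<lambda>q. A f q + A g q)" if "continuous_on UNIV f" "continuous_on UNIV g" for f g
        unfolding A_def by (simp add: steklov_add that continuous_steklov)
      have Amult: "A (\<lambda>q. c * f q) = (\<lambda>q. c * A f q)" for c f
        unfolding A_def by (simp add: steklov_mult)
      have "A (\<lambda>q. u11 q + (u22 q + ((1 - 2 * a) * u2 q + 4 * u33 q))) = A (\<lambda>q. (a - a\<^sup>2) * u q)"
        using pde by (simp add: add.assoc)
      then have "(\<lambda>q. A u11 q + (A u22 q + ((1 - 2 * a) * A u2 q + 4 * A u33 q))) = (\<lambda>q. (a - a\<^sup>2) * A u q)"
        by (simp add: Aadd Amult cont continuous_on_add continuous_on_mult_left)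
      then have pdeA: "A u11 q + A u22 q - (2 * a - 1) * A u2 q + 4 * A u33 q = - (a\<^sup>2 - a) * A u q" for q
        by (auto dest!: fun_cong[of _ _ q] simp: algebra_simps)
      define G where "G = A (\<lambda>q. \<bar>u q\<bar> powr p)"
      have cG: "continuous_on UNIV G" unfolding G_def by (rule cA[OF cp])
      have uG: "\<bar>A u q\<bar> powr p \<le> G q" for q
      proof -
        note cc = cp continuous_steklov cont continuous_on_powr' continuous_on_rabs continuous_on_const
        have "\<bar>A u q\<bar> powr p \<le> steklov h1 dx (\<lambda>q. \<bar>steklov h2 dy (steklov h3 dz u) q\<bar> powr p) q"
          unfolding A_def by (intro steklov_powr p h cc)
        also have "\<dots> \<le> steklov h1 dx (steklov h2 dy (\<lambda>q. \<bar>steklov h3 dz u q\<bar> powr p)) q"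
          using p by (intro steklov_mono steklov_powr h cc) auto
        also have "\<dots> \<le> G q"
          unfolding G_def A_def using p by (intro steklov_mono steklov_powr h cc) auto
        finally show ?thesis .
      qed
      have G0: "0 \<le> G q" for q using uG[of q] powr_ge_zero order_trans by blast
      have GC: "G q \<le> C" for q
        unfolding G_def A_def using h pi_gt3 by (intro steklov_triple_le[where w="2 * pi"] cp int) auto
      have Gint: "integral (cbox (x0, y0, z0) (x0 + 1, y1, z0 + 2 * pi)) G \<le> C" for x0 y0 z0 y1
        unfolding G_def A_def by (intro integral_slab_steklov continuous_steklov cp h C0 int)
      have "A u q = 0"
      proof (rule J.liouville_quadratic[where c="2 * a - 1" and m="a\<^sup>2 - a" and C="(1 + C) * C", OF pdeA c J.mixed J.cont_mixed])
        fix x0 z0 :: real and N :: nat assume N: "1 \<le> N"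
        let ?D = "cbox (x0, - (real N ^ 3), z0) (x0 + 1, real N ^ 3, z0 + 2 * pi)"
        have "integral ?D (\<lambda>q. (A u q)\<^sup>2) \<le> integral ?D (\<lambda>q. (1 + C) * G q)"
        proof (rule integral_le)
          \<comment> \<open>Values below 1 have a square below the power \<open>p < 2\<close>.
            Larger ones are at most \<open>G q\<close>, and one of the two factors of the square is
            estimated by the pointwise bound \<open>C\<close>.\<close>
          show "(A u q)\<^sup>2 \<le> (1 + C) * G q" for q
          proof (cases "\<bar>A u q\<bar> \<le> 1")
            case True
            have "\<bar>A u q\<bar> powr 2 \<le> \<bar>A u q\<bar> powr p" using True 3 by (intro powr_mono') auto
            then have "(A u q)\<^sup>2 \<le> G q" using uG[of q] by simp
            also have "\<dots> \<le> (1 + C) * G q" using C0 G0[of q] by (simp add: algebra_simps)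
            finally show ?thesis .
          next
            case False
            have "\<bar>A u q\<bar> = \<bar>A u q\<bar> powr 1" by simp
            also have "\<dots> \<le> \<bar>A u q\<bar> powr p" using False p by (intro powr_mono) auto
            finally have "\<bar>A u q\<bar> \<le> G q" using uG[of q] by linarith
            then have "\<bar>A u q\<bar> * \<bar>A u q\<bar> \<le> C * G q" using GC[of q] C0 by (intro mult_mono) auto
            then show ?thesis using G0[of q] by (simp add: power2_eq_square algebra_simps)
          qed
        qed (intro integrable_cbox_continuous continuous_intros J.cont cG)+
        also have "\<dots> = (1 + C) * integral ?D G" by simp
        also have "\<dots> \<le> (1 + C) * C" using Gint C0 by (intro mult_left_mono) auto
        also have "\<dots> \<le> (1 + C) * C * real N" using N C0 mult_left_mono[of 1 "real N" "(1 + C) * C"] by simp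
        finally show "integral ?D (\<lambda>q. (A u q)\<^sup>2) \<le> (1 + C) * C * real N" .
      qed
      then show ?thesis by (simp add: A_def)
    qed
    \<comment> \<open>The averages are removed one direction at a time, outermost first.\<close>
    have "steklov h2 dy (steklov h3 dz u) q = 0" if "0 < h2" "h2 \<le> 1" "0 < h3" "h3 \<le> 1" for h2 h3 q
      by (rule steklov_eq_0_imp[where e=dx]) (use z that in \<open>auto intro!: continuous_steklov cont\<close>)
    then have "steklov h3 dz u q = 0" if "0 < h3" "h3 \<le> 1" for h3 q
      using that by (intro steklov_eq_0_imp[where e=dy and f="steklov h3 dz u"] continuous_steklov cont)
    then show ?thesis
      by (intro steklov_eq_0_imp[where e=dz and f=u] cont)
  qed
qed

end

subsection \<open>The Eguchi-Hanson metric in the chart\<close>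

definition radius :: "real \<Rightarrow> real \<Rightarrow> real" where
  "radius t u = sqrt (u\<^sup>2 + t ^ 4)"

lemma radius_pos: "u \<noteq> 0 \<Longrightarrow> 0 < radius t u"
  by (simp add: radius_def add_pos_nonneg)

lemma radius_sq: "(radius t u)\<^sup>2 = u\<^sup>2 + t ^ 4"
  by (simp add: radius_def)

lemma DERIV_radius:
  assumes "u \<noteq> 0"
  shows "(radius t has_real_derivative u / radius t u) (at u)"
proof -
  have "0 < u\<^sup>2 + t ^ 4" using assms by (simp add: add_pos_nonneg)
  then have "((\<lambda>u. sqrt (u\<^sup>2 + t ^ 4)) has_real_derivative u / sqrt (u\<^sup>2 + t ^ 4)) (at u)"
    by (auto intro!: derivative_eq_intros simp: divide_simps)
  then show ?thesis by (simp add: radius_def[abs_def])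
qed

lemma DERIV_potential:
  assumes u: "0 < u"
  shows "((\<lambda>u. radius t u + t\<^sup>2 * ln (u / (radius t u + t\<^sup>2))) has_real_derivative radius t u / u) (at u)"
proof -
  define r where "r = radius t u"
  have r: "0 < r" "r\<^sup>2 = u\<^sup>2 + t ^ 4" using radius_pos[of u t] u by (auto simp: r_def radius_sq)
  have rt: "0 < r + t\<^sup>2" using r(1) by (simp add: add_pos_nonneg)
  have d: "(radius t has_real_derivative u / r) (at u)" using DERIV_radius[of u t] u by (simp add: r_def)
  have "((\<lambda>u. radius t u + t\<^sup>2 * ln (u / (radius t u + t\<^sup>2))) has_real_derivative
      u / r + t\<^sup>2 * ((1 * (r + t\<^sup>2) - u * (u / r + 0)) / ((r + t\<^sup>2) * (r + t\<^sup>2)) / (u / (r + t\<^sup>2)))) (at u)"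
    using u rt unfolding r_def
    by (auto intro!: derivative_eq_intros d[unfolded r_def] simp: divide_simps)
  moreover have "u / r + t\<^sup>2 * ((1 * (r + t\<^sup>2) - u * (u / r + 0)) / ((r + t\<^sup>2) * (r + t\<^sup>2)) / (u / (r + t\<^sup>2))) = r / u"
  proof -
    \<comment> \<open>This factorization cancels the denominator of the logarithm, so that the
      derivative of the potential collapses to \<open>r / u\<close>.\<close>
    have "u * u = (r + t\<^sup>2) * (r - t\<^sup>2)" using r(2) by (simp add: algebra_simps power2_eq_square power4_eq_xxxx)
    then have "1 * (r + t\<^sup>2) - u * (u / r + 0) = (r + t\<^sup>2) * t\<^sup>2 / r"
      using r(1) by (simp add: field_simps)
    then have "u / r + t\<^sup>2 * ((1 * (r + t\<^sup>2) - u * (u / r + 0)) / ((r + t\<^sup>2) * (r + t\<^sup>2)) / (u / (r + t\<^sup>2)))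
      = u / r + t\<^sup>2 * (t\<^sup>2 / (r * u))"
    proof -
      have "(R * t\<^sup>2 / r) / (R * R) / (u / R) = t\<^sup>2 / (r * u)" if "0 < R" for R
        using that r(1) u by (simp add: field_simps)
      from this[OF rt] show ?thesis by (simp only: \<open>1 * (r + t\<^sup>2) - u * (u / r + 0) = (r + t\<^sup>2) * t\<^sup>2 / r\<close>)
    qed
    also have "\<dots> = (u\<^sup>2 + t ^ 4) / (r * u)" using r(1) u by (simp add: field_simps power2_eq_square power4_eq_xxxx)
    also have "\<dots> = r / u" using r(1) u by (simp add: r(2)[symmetric]) (simp add: power2_eq_square)
    finally show ?thesis .
  qed
  ultimately show ?thesis by (simp add: r_def)
qed

definition chart_u :: "complex \<times> complex \<Rightarrow> real" where
  "chart_u q = cmod (snd q) * (1 + (cmod (fst q))\<^sup>2)"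

text \<open>The real differential of \<open>ln (chart_u q)\<close>. The potential has derivative
  \<open>r / u\<close> in \<open>u\<close>, so its differential is simply \<open>r\<close> times
  this form.\<close>

definition dlog_u :: "complex \<times> complex \<Rightarrow> complex \<times> complex \<Rightarrow> real" where
  "dlog_u q v = Re (snd v / snd q) + 2 * Re (cnj (fst q) * fst v) / (1 + (cmod (fst q))\<^sup>2)"

lemma one_add_cmod2_pos: "0 < 1 + (cmod x)\<^sup>2" by (simp add: add_pos_nonneg)

lemma chart_u_pos: "snd q \<noteq> 0 \<Longrightarrow> 0 < chart_u q"
  by (simp add: chart_u_def one_add_cmod2_pos)

lemma has_derivative_cmod2:
  "((\<lambda>z. (cmod (fst z))\<^sup>2) has_derivative (\<lambda>v. 2 * Re (cnj (fst q) * fst v))) (at (q :: complex \<times> complex))"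
proof -
  have "((\<lambda>z. (Re (fst z))\<^sup>2 + (Im (fst z))\<^sup>2) has_derivative (\<lambda>v. 2 * Re (cnj (fst q) * fst v))) (at q)"
    by (auto intro!: derivative_eq_intros simp: algebra_simps)
  then show ?thesis by (simp add: cmod_power2)
qed

lemma has_derivative_chart_u:
  assumes "snd q \<noteq> 0"
  shows "(chart_u has_derivative (\<lambda>v. chart_u q * dlog_u q v)) (at q)"
proof -
  obtain x g where q: "q = (x, g)" by (cases q)
  have g: "g \<noteq> 0" using assms by (simp add: q)
  have "((\<lambda>z. norm (snd z :: complex)) has_derivative (\<lambda>v. sgn (snd q) \<bullet> snd v)) (at q)"
    using has_derivative_compose[OF has_derivative_snd[OF has_derivative_ident] has_derivative_norm[of "snd q"]] g
    by (simp add: q inner_commute)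
  from has_derivative_mult[OF this has_derivative_add[OF has_derivative_const[of 1] has_derivative_cmod2[of q]]]
  have "(chart_u has_derivative (\<lambda>v. cmod g * (0 + 2 * Re (cnj x * fst v)) + (sgn g \<bullet> snd v) * (1 + (cmod x)\<^sup>2))) (at q)"
    by (simp add: chart_u_def[abs_def] q)
  moreover have "cmod g * (0 + 2 * Re (cnj x * fst v)) + (sgn g \<bullet> snd v) * (1 + (cmod x)\<^sup>2) = chart_u q * dlog_u q v" for v
  proof -
    have "sgn g \<bullet> snd v = (Re g * Re (snd v) + Im g * Im (snd v)) / cmod g"
      by (simp add: sgn_div_norm inner_complex_def divide_simps)
    also have "\<dots> = cmod g * Re (snd v / g)"
    proof -
      have "Re (snd v / g) = (Re g * Re (snd v) + Im g * Im (snd v)) / (cmod g)\<^sup>2"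
        by (simp add: Re_divide cmod_power2 mult.commute)
      then show ?thesis using g by (simp add: power2_eq_square)
    qed
    finally show ?thesis
      using one_add_cmod2_pos[of x] by (simp add: chart_u_def dlog_u_def q field_simps)
  qed
  ultimately show ?thesis by (simp only:)
qed

lemma eh_potential_chart:
  "snd q \<noteq> 0 \<Longrightarrow> eh_potential t (h2_chart q) = radius t (chart_u q) + t\<^sup>2 * ln (chart_u q / (radius t (chart_u q) + t\<^sup>2))"
  by (cases q) (simp add: eh_potential_def Let_def h2_u1_chart radius_def chart_u_def)

lemma open_snd_nonzero: "open {q :: complex \<times> complex. snd q \<noteq> 0}"
  by (intro open_Collect_neq continuous_intros)

lemma has_derivative_potential:
  assumes q: "snd q \<noteq> 0"
  shows "((\<lambda>z. eh_potential t (h2_chart z)) has_derivative (\<lambda>v. radius t (chart_u q) * dlog_u q v)) (at q)"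
proof (rule has_derivative_transform_within_open[OF _ open_snd_nonzero])
  have "((\<lambda>z. (\<lambda>u. radius t u + t\<^sup>2 * ln (u / (radius t u + t\<^sup>2))) (chart_u z)) has_derivative
      (\<lambda>v. (radius t (chart_u q) / chart_u q) * (chart_u q * dlog_u q v))) (at q)"
    using has_derivative_compose[OF has_derivative_chart_u[OF q]
      DERIV_potential[OF chart_u_pos[OF q], of t, unfolded has_field_derivative_def]] .
  then show "((\<lambda>z. radius t (chart_u z) + t\<^sup>2 * ln (chart_u z / (radius t (chart_u z) + t\<^sup>2))) has_derivative
      (\<lambda>v. radius t (chart_u q) * dlog_u q v)) (at q)"
    using chart_u_pos[OF q] by simp
qed (use q eh_potential_chart in auto)

lemma has_derivative_radius_chart_u:
  assumes q: "snd q \<noteq> 0"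
  shows "((\<lambda>z. radius t (chart_u z)) has_derivative (\<lambda>v. ((chart_u q)\<^sup>2 / radius t (chart_u q)) * dlog_u q v)) (at q)"
proof -
  have "chart_u q \<noteq> 0" using chart_u_pos[OF q] by simp
  from has_derivative_compose[OF has_derivative_chart_u[OF q] DERIV_radius[OF this, of t, unfolded has_field_derivative_def]]
  show ?thesis by (simp add: power2_eq_square mult.assoc)
qed

definition dbar_log_u :: "bool \<Rightarrow> complex \<times> complex \<Rightarrow> complex" where
  "dbar_log_u j q = (if j then 1 / (2 * cnj (snd q)) else fst q / of_real (1 + (cmod (fst q))\<^sup>2))"

lemma dlog_u_wirtinger:
  assumes "snd q \<noteq> 0"
  shows "complex_of_real (dlog_u q (c2_basis j)) + \<i> * of_real (dlog_u q (c2_J (c2_basis j))) = 2 * dbar_log_u j q"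
    "complex_of_real (dlog_u q (c2_basis j)) - \<i> * of_real (dlog_u q (c2_J (c2_basis j))) = 2 * cnj (dbar_log_u j q)"
proof -
  obtain x g where q: "q = (x, g)" by (cases q)
  have g: "(Re g)\<^sup>2 + (Im g)\<^sup>2 \<noteq> 0" using assms by (simp add: q complex_eq_iff sum_power2_eq_zero_iff)
  have p: "1 + ((Re x)\<^sup>2 + (Im x)\<^sup>2) \<noteq> 0" by (metis add_pos_nonneg less_numeral_extra(1,3) sum_power2_ge_zero)
  show "complex_of_real (dlog_u q (c2_basis j)) + \<i> * of_real (dlog_u q (c2_J (c2_basis j))) = 2 * dbar_log_u j q"
  proof (cases j)
    case True
    have "Re (\<i> / g) = - Im (1 / g)" "1 / cnj g = cnj (1 / g)"
      using Re_i_times[of "1 / g"] by (simp_all del: Re_i_times)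
    then show ?thesis using True by (simp add: dlog_u_def dbar_log_u_def c2_basis_def c2_J_def q complex_eq_iff del: complex_cnj_divide)
  next
    case False
    then show ?thesis using p
      by (simp add: dlog_u_def dbar_log_u_def c2_basis_def c2_J_def q complex_eq_iff Re_divide_of_real Im_divide_of_real
        del: of_real_add)
  qed
  then show "complex_of_real (dlog_u q (c2_basis j)) - \<i> * of_real (dlog_u q (c2_J (c2_basis j))) = 2 * cnj (dbar_log_u j q)"
    by (simp add: complex_eq_iff)
qed

lemma c2_delbar_potential:
  assumes q: "snd q \<noteq> 0"
  shows "c2_delbar j (\<lambda>z. complex_of_real (eh_potential t (h2_chart z))) q = of_real (radius t (chart_u q)) * dbar_log_u j q"
proof -
  have "((\<lambda>z. complex_of_real (eh_potential t (h2_chart z))) has_derivative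
      (\<lambda>v. of_real (radius t (chart_u q) * dlog_u q v))) (at q)"
    by (intro has_derivative_of_real has_derivative_potential q)
  from frechet_derivative_at[OF this, symmetric]
  have "c2_delbar j (\<lambda>z. complex_of_real (eh_potential t (h2_chart z))) q
    = of_real (radius t (chart_u q)) * (complex_of_real (dlog_u q (c2_basis j)) + \<i> * of_real (dlog_u q (c2_J (c2_basis j)))) / 2"
    unfolding c2_delbar_def by (simp add: algebra_simps)
  then show ?thesis by (simp add: dlog_u_wirtinger(1)[OF q])
qed

text \<open>As a function of the logarithm of \<open>u\<close>, the potential has first derivative
  \<open>r\<close> and second derivative \<open>u^2 / r\<close>. The first summand is the second
  derivative times the product of the differentials of the logarithm. The other is \<open>r\<close>
  times the complex Hessian of the logarithm, the Fubini-Study coefficient: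
  \<open>ln (cmod \<gamma>)\<close> is pluriharmonic, so only the base direction
  contributes.\<close>

definition eh_coeff :: "real \<Rightarrow> complex \<times> complex \<Rightarrow> bool \<Rightarrow> bool \<Rightarrow> complex" where
  "eh_coeff t q j k = of_real ((chart_u q)\<^sup>2 / radius t (chart_u q)) * cnj (dbar_log_u j q) * dbar_log_u k q
    + (if j \<or> k then 0 else of_real (radius t (chart_u q) / (1 + (cmod (fst q))\<^sup>2)\<^sup>2))"

lemma has_derivative_dbar_log_u:
  assumes q: "snd q \<noteq> 0"
  shows "(dbar_log_u k has_derivative (\<lambda>v. if k then - cnj (snd v) / (2 * (cnj (snd q))\<^sup>2)
    else fst v / of_real (1 + (cmod (fst q))\<^sup>2)
      - fst q * of_real (2 * Re (cnj (fst q) * fst v)) / (of_real (1 + (cmod (fst q))\<^sup>2))\<^sup>2)) (at q)"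
proof (cases k)
  case True
  have "((\<lambda>z. inverse (2 * cnj (snd z))) has_derivative
      (\<lambda>v. - (inverse (2 * cnj (snd q)) * (2 * cnj (snd v)) * inverse (2 * cnj (snd q))))) (at q)"
    using q by (intro Deriv.has_derivative_inverse has_derivative_mult_right
      bounded_linear.has_derivative[OF bounded_linear_cnj has_derivative_snd[OF has_derivative_ident]]) simp
  then show ?thesis using True q
    by (simp add: dbar_log_u_def[abs_def] field_simps power2_eq_square)
next
  case False
  have p: "complex_of_real (1 + (cmod (fst q))\<^sup>2) \<noteq> 0"
    using one_add_cmod2_pos[of "fst q"] by (metis of_real_eq_0_iff less_irrefl)
  have "((\<lambda>z. complex_of_real (1 + (cmod (fst z))\<^sup>2)) has_derivative (\<lambda>v. of_real (0 + 2 * Re (cnj (fst q) * fst v)))) (at q)"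
    by (intro has_derivative_of_real has_derivative_add has_derivative_const has_derivative_cmod2)
  from has_derivative_divide'[OF has_derivative_fst[OF has_derivative_ident] this p]
  have "((\<lambda>z. fst z / complex_of_real (1 + (cmod (fst z))\<^sup>2)) has_derivative
    (\<lambda>v. (fst v * of_real (1 + (cmod (fst q))\<^sup>2) - fst q * of_real (0 + 2 * Re (cnj (fst q) * fst v))) /
      (of_real (1 + (cmod (fst q))\<^sup>2) * of_real (1 + (cmod (fst q))\<^sup>2)))) (at q)" .
  then show ?thesis using False p
    by (simp add: dbar_log_u_def[abs_def] diff_divide_distrib power2_eq_square)
qed

lemma c2_del_delbar_potential:
  assumes q: "snd q \<noteq> 0"
  shows "c2_del j (c2_delbar k (\<lambda>z. complex_of_real (eh_potential t (h2_chart z)))) q = eh_coeff t q j k"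
proof -
  define r where "r = radius t (chart_u q)"
  define dB where "dB v = (if k then - cnj (snd v) / (2 * (cnj (snd q))\<^sup>2)
    else fst v / of_real (1 + (cmod (fst q))\<^sup>2)
      - fst q * of_real (2 * Re (cnj (fst q) * fst v)) / (of_real (1 + (cmod (fst q))\<^sup>2))\<^sup>2)" for v :: "complex \<times> complex"
  have "((\<lambda>z. complex_of_real (radius t (chart_u z)) * dbar_log_u k z) has_derivative
      (\<lambda>v. of_real r * dB v + of_real ((chart_u q)\<^sup>2 / r * dlog_u q v) * dbar_log_u k q)) (at q)"
    unfolding r_def dB_def
    by (intro has_derivative_mult has_derivative_of_real has_derivative_radius_chart_u has_derivative_dbar_log_u q)
  then have "(c2_delbar k (\<lambda>z. complex_of_real (eh_potential t (h2_chart z))) has_derivative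
      (\<lambda>v. of_real r * dB v + of_real ((chart_u q)\<^sup>2 / r * dlog_u q v) * dbar_log_u k q)) (at q)"
    by (rule has_derivative_transform_within_open[OF _ open_snd_nonzero]) (use q c2_delbar_potential in auto)
  from frechet_derivative_at[OF this, symmetric]
  have "c2_del j (c2_delbar k (\<lambda>z. complex_of_real (eh_potential t (h2_chart z)))) q
    = of_real r * ((dB (c2_basis j) - \<i> * dB (c2_J (c2_basis j))) / 2)
      + of_real ((chart_u q)\<^sup>2 / r) * dbar_log_u k q *
        (complex_of_real (dlog_u q (c2_basis j)) - \<i> * of_real (dlog_u q (c2_J (c2_basis j)))) / 2"
    unfolding c2_del_def by (simp add: algebra_simps diff_divide_distrib add_divide_distrib)
  also have "\<dots> = of_real r * ((dB (c2_basis j) - \<i> * dB (c2_J (c2_basis j))) / 2)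
      + of_real ((chart_u q)\<^sup>2 / r) * cnj (dbar_log_u j q) * dbar_log_u k q"
    by (simp add: dlog_u_wirtinger(2)[OF q])
  also have "(dB (c2_basis j) - \<i> * dB (c2_J (c2_basis j))) / 2 = (if j \<or> k then 0 else of_real (1 / (1 + (cmod (fst q))\<^sup>2)\<^sup>2))"
  proof -
    define x P where "x = fst q" and "P = complex_of_real (1 + (cmod x)\<^sup>2)"
    have P: "P \<noteq> 0" unfolding P_def using one_add_cmod2_pos[of x] by (metis of_real_eq_0_iff less_irrefl)
    have xx: "x * cnj x = P - 1" by (simp add: P_def complex_norm_square[symmetric])
    have c: "complex_of_real (2 * Re (cnj x)) - \<i> * of_real (2 * Re (cnj x * \<i>)) = 2 * cnj x"
      by (simp add: complex_eq_iff)
    consider "k" | "\<not> k" "j" | "\<not> k" "\<not> j" by blast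
    then show ?thesis
    proof cases
      \<comment> \<open>The holomorphic derivative of \<open>x / P\<close> is
        \<open>1 / P - x * cnj x / P^2\<close>, which equals \<open>1 / P^2\<close>.\<close>
      case 3
      have "dB (c2_basis j) - \<i> * dB (c2_J (c2_basis j)) =
          1 / P - x * of_real (2 * Re (cnj x)) / P\<^sup>2 - \<i> * (\<i> / P - x * of_real (2 * Re (cnj x * \<i>)) / P\<^sup>2)"
        using 3 by (simp add: dB_def c2_basis_def c2_J_def x_def P_def)
      also have "\<dots> = 2 / P - x * (complex_of_real (2 * Re (cnj x)) - \<i> * of_real (2 * Re (cnj x * \<i>))) / P\<^sup>2"
        by (simp add: right_diff_distrib diff_divide_distrib)
      also have "\<dots> = 2 / P - 2 * (P - 1) / P\<^sup>2" unfolding c by (simp add: xx[symmetric])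
      also have "\<dots> = 2 / P\<^sup>2" using P by (simp add: field_simps power2_eq_square)
      finally show ?thesis using 3 by (simp add: P_def x_def)
    qed (auto simp: dB_def c2_basis_def c2_J_def)
  qed
  finally show ?thesis by (simp add: eh_coeff_def r_def)
qed

text \<open>The form whose square is the fibre part of the metric: \<open>2 * \<gamma>\<close> times the \<open>(1, 0)\<close>-part of the
  differential of the logarithm of \<open>u\<^sub>1\<close>.\<close>

definition fibre_form :: "complex \<times> complex \<Rightarrow> complex \<times> complex \<Rightarrow> complex" where
  "fibre_form q X = snd X + 2 * snd q * cnj (fst q) * fst X / of_real (1 + (cmod (fst q))\<^sup>2)"

text \<open>The holomorphic differential of the logarithm of \<open>u\<close> is
  \<open>fibre_form\<close> divided by \<open>2 * \<gamma>\<close>. Since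
  \<open>u = cmod \<gamma> * P\<close>, the factor \<open>u^2\<close> cancels the pole and leaves
  \<open>P^2 / 4\<close>. The two orders of the arguments in the two-form are complex conjugate,
  which gives the leading \<open>2\<close>.\<close>

lemma eh_metric_chart:
  assumes q: "snd q \<noteq> 0"
  defines "P \<equiv> 1 + (cmod (fst q))\<^sup>2"
  shows "eh_metric t q X Y = 2 * (radius t (chart_u q) / P\<^sup>2 * Re (fst X * cnj (fst Y))
    + P\<^sup>2 / (4 * radius t (chart_u q)) * Re (fibre_form q X * cnj (fibre_form q Y)))"
proof -
  define r where "r = radius t (chart_u q)"
  define B where "B j = dbar_log_u j q" for j
  define \<xi> where "\<xi> X = cnj (B False) * fst X + cnj (B True) * snd X" for X
  have form: "eh_metric t q X Y = Re (\<Sum>j\<in>UNIV. \<Sum>k\<in>UNIV. eh_coeff t q j k *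
      (c2_coord j X * cnj (c2_coord k Y) + c2_coord j Y * cnj (c2_coord k X)))"
    using q by (simp add: eh_metric_def eh_form_def i_ddbar_def c2_del_delbar_potential UNIV_bool c2_coord_def c2_J_def case_prod_beta algebra_simps)
  have "eh_metric t q X Y = Re (of_real ((chart_u q)\<^sup>2 / r) * (\<xi> X * cnj (\<xi> Y) + \<xi> Y * cnj (\<xi> X))
      + of_real (r / P\<^sup>2) * (fst X * cnj (fst Y) + fst Y * cnj (fst X)))"
    unfolding form by (simp add: UNIV_bool eh_coeff_def r_def[symmetric] P_def[symmetric] B_def[symmetric] \<xi>_def c2_coord_def algebra_simps del: of_real_divide of_real_power)
  also have "\<dots> = 2 * ((chart_u q)\<^sup>2 / r * Re (\<xi> X * cnj (\<xi> Y)) + r / P\<^sup>2 * Re (fst X * cnj (fst Y)))"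
    by (simp add: algebra_simps del: of_real_divide of_real_power)
  also have "(chart_u q)\<^sup>2 / r * Re (\<xi> X * cnj (\<xi> Y)) = P\<^sup>2 / (4 * r) * Re (fibre_form q X * cnj (fibre_form q Y))"
  proof -
    have x: "\<xi> X = fibre_form q X / (2 * snd q)" for X
      using q by (simp add: \<xi>_def fibre_form_def B_def dbar_log_u_def field_simps)
    have "\<xi> X * cnj (\<xi> Y) = fibre_form q X * cnj (fibre_form q Y) / of_real (4 * (cmod (snd q))\<^sup>2)"
    proof -
      have "complex_of_real (4 * (cmod (snd q))\<^sup>2) = (2 * snd q) * cnj (2 * snd q)"
        by (simp add: complex_norm_square del: of_real_power)
      then show ?thesis unfolding x by (simp add: mult.commute mult.left_commute)
    qed
    then have "Re (\<xi> X * cnj (\<xi> Y)) = Re (fibre_form q X * cnj (fibre_form q Y)) / (4 * (cmod (snd q))\<^sup>2)"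
      by (simp only: Re_divide_of_real)
    then show ?thesis using q by (simp add: chart_u_def P_def power_mult_distrib)
  qed
  finally show ?thesis by (simp add: r_def)
qed

section \<open>The induced metric on the hypersurface in its global coordinates\<close>

lemma Ck_on_vector_derivative:
  assumes "Ck_on (Suc k) UNIV (c :: real \<Rightarrow> 'a::real_normed_vector)"
  shows "(c has_vector_derivative frechet_derivative c (at s) 1) (at s)"
    "Ck_on k UNIV (\<lambda>s. frechet_derivative c (at s) 1)"
proof -
  have "c differentiable (at s)" using assms by simp
  then have d: "(c has_derivative frechet_derivative c (at s)) (at s)"
    by (simp add: frechet_derivative_works)
  have "frechet_derivative c (at s) x = x *\<^sub>R frechet_derivative c (at s) 1" for x
    using linear_scale[OF has_derivative_linear[OF d], of x 1] by simp
  then show "(c has_vector_derivative frechet_derivative c (at s) 1) (at s)"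
    unfolding has_vector_derivative_def by (intro has_derivative_eq_rhs[OF d] ext)
  show "Ck_on k UNIV (\<lambda>s. frechet_derivative c (at s) 1)" using assms by simp
qed

lemma unit_speed_curve_derivatives:
  assumes "unit_speed_curve c"
  obtains c' c'' where "\<And>s. (c has_vector_derivative c' s) (at s)" "\<And>s. (c' has_vector_derivative c'' s) (at s)"
    "continuous_on UNIV c''" "\<And>s. cmod (c' s) = 1"
proof -
  have sm: "Ck_on (Suc (Suc 0)) UNIV c" and u: "\<And>s. norm (vector_derivative c (at s)) = 1"
    using assms by (auto simp: unit_speed_curve_def smooth_on_def simp del: Ck_on.simps)
  define c' where "c' = (\<lambda>s. frechet_derivative c (at s) 1)"
  define c'' where "c'' = (\<lambda>s. frechet_derivative c' (at s) 1)"
  have 1: "(c has_vector_derivative c' s) (at s)" for s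
    using Ck_on_vector_derivative(1)[OF sm] by (simp add: c'_def)
  have k1: "Ck_on (Suc 0) UNIV c'" unfolding c'_def by (rule Ck_on_vector_derivative(2)[OF sm])
  have 2: "(c' has_vector_derivative c'' s) (at s)" for s
    using Ck_on_vector_derivative(1)[OF k1] by (simp add: c''_def)
  have 3: "continuous_on UNIV c''"
    using Ck_on_vector_derivative(2)[OF k1] by (simp add: c''_def)
  have 4: "cmod (c' s) = 1" for s using u[of s] vector_derivative_at[OF 1[of s]] by simp
  show thesis using that[OF 1 2 3 4] .
qed

lemma matrix_inv_eqI:
  fixes A B :: "real ^ 'n ^ 'n"
  assumes "A ** B = mat 1" "B ** A = mat 1"
  shows "matrix_inv A = B"
proof -
  have "A ** matrix_inv A = mat 1 \<and> matrix_inv A ** A = mat 1"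
    unfolding matrix_inv_def by (rule someI[where x=B]) (use assms in blast)
  then show ?thesis using assms by (metis matrix_mul_assoc matrix_mul_lid matrix_mul_rid)
qed

text \<open>The matrix of \<open>2 * r / P^2 * ds^2 + f * |d\<gamma> + (m + i * n) * ds|^2\<close>,
  a diagonal metric sheared by the connection term \<open>m + i * n\<close>.\<close>

definition fibre_metric :: "real \<Rightarrow> real \<Rightarrow> real \<Rightarrow> real \<Rightarrow> real ^ 3 ^ 3" where
  "fibre_metric P r m n = (let f = P\<^sup>2 / (2 * r) in vector
    [vector [2 * r / P\<^sup>2 + f * (m\<^sup>2 + n\<^sup>2), f * m, f * n], vector [f * m, f, 0], vector [f * n, 0, f]])"

definition fibre_metric_inv :: "real \<Rightarrow> real \<Rightarrow> real \<Rightarrow> real \<Rightarrow> real ^ 3 ^ 3" where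
  "fibre_metric_inv P r m n = (let f = P\<^sup>2 / (2 * r) in vector
    [vector [f, - m * f, - n * f], vector [- m * f, 1 / f + m * m * f, m * n * f],
     vector [- n * f, m * n * f, 1 / f + n * n * f]])"

lemma matrix_inv_fibre_metric:
  assumes "P > 0" "r > 0"
  shows "matrix_inv (fibre_metric P r m n) = fibre_metric_inv P r m n"
proof (rule matrix_inv_eqI)
  define f g where "f = P\<^sup>2 / (2 * r)" and "g = 2 * r / P\<^sup>2"
  have f: "f * g = 1" "1 / f = g" using assms by (auto simp: f_def g_def)
  show "fibre_metric P r m n ** fibre_metric_inv P r m n = mat 1"
    "fibre_metric_inv P r m n ** fibre_metric P r m n = mat 1"
    unfolding fibre_metric_def fibre_metric_inv_def Let_def f_def[symmetric] f(2) g_def[symmetric]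
    using f(1) by (simp_all add: vec_eq_iff forall_3 matrix_matrix_mult_def sum_3 mat_def algebra_simps power2_eq_square)
qed

text \<open>The shear is unipotent, so \<open>m\<close> and \<open>n\<close> drop out of the
  determinant.\<close>

lemma det_fibre_metric:
  assumes "P > 0" "r > 0"
  shows "sqrt (det (fibre_metric P r m n)) = P / sqrt (2 * r)"
proof -
  define f where "f = P\<^sup>2 / (2 * r)"
  have "det (fibre_metric P r m n) = 2 * r / P\<^sup>2 * f\<^sup>2"
    unfolding fibre_metric_def Let_def f_def[symmetric] by (simp add: det_3 algebra_simps power2_eq_square)
  also have "\<dots> = P\<^sup>2 / (2 * r)" using assms unfolding f_def by (simp add: field_simps power2_eq_square)
  finally show ?thesis using assms by (simp add: real_sqrt_divide)
qed

definition fibre_coord :: "real ^ 3 \<Rightarrow> complex" where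
  "fibre_coord y = Complex (y $ 2) (y $ 3)"

lemma fibre_coord_bounded_linear: "bounded_linear fibre_coord"
proof -
  have "linear fibre_coord" by (rule linearI) (simp_all add: fibre_coord_def complex_eq_iff)
  then show ?thesis by (simp add: linear_conv_bounded_linear)
qed

lemma frechet_hyp_immersion:
  assumes "(c has_vector_derivative c') (at (y $ 1))"
  shows "frechet_derivative (hyp_immersion c) (at y) v = (v $ 1 *\<^sub>R c', fibre_coord v)"
proof -
  have "((\<lambda>y. c (y $ 1)) has_derivative (\<lambda>v. v $ 1 *\<^sub>R c')) (at y)"
    using has_derivative_compose[OF bounded_linear_imp_has_derivative[OF bounded_linear_vec_nth, of 1 "at y"],
      of c "\<lambda>x. x *\<^sub>R c'"] assms
    by (simp add: has_vector_derivative_def)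
  then have "((\<lambda>y. (c (y $ 1), fibre_coord y)) has_derivative (\<lambda>v. (v $ 1 *\<^sub>R c', fibre_coord v))) (at y)"
    by (rule has_derivative_Pair) (rule bounded_linear_imp_has_derivative[OF fibre_coord_bounded_linear])
  from fun_cong[OF frechet_derivative_at[OF this], of v, symmetric] show ?thesis
    by (simp add: hyp_immersion_def[abs_def] fibre_coord_def[abs_def])
qed

lemma hyp_metric_eq:
  assumes c: "(c has_vector_derivative c') (at (y $ 1))" "cmod c' = 1" and y: "fibre_coord y \<noteq> 0"
  defines "P \<equiv> 1 + (cmod (c (y $ 1)))\<^sup>2"
  defines "v \<equiv> 2 * cnj (c (y $ 1)) * c' / of_real P * fibre_coord y"
  shows "hyp_metric c t y = fibre_metric P (radius t (cmod (fibre_coord y) * P)) (Re v) (Im v)"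
proof -
  define q where "q = (c (y $ 1), fibre_coord y)"
  define r where "r = radius t (cmod (fibre_coord y) * P)"
  have im: "hyp_immersion c y = q" by (simp add: hyp_immersion_def q_def fibre_coord_def)
  have r: "radius t (chart_u q) = r" by (simp add: r_def chart_u_def q_def P_def)
  have snd: "snd q \<noteq> 0" using y by (simp add: q_def)
  have P0: "P > 0" unfolding P_def by (rule one_add_cmod2_pos)
  note fd = frechet_hyp_immersion[OF c(1)]
  have cc: "c' * cnj c' = 1" using c(2) complex_norm_square[of c'] by simp
  have f: "fibre_form q ((axis 1 1 :: real ^ 3) $ 1 *\<^sub>R c', fibre_coord (axis 1 1)) = v"
    "fibre_form q ((axis 2 1 :: real ^ 3) $ 1 *\<^sub>R c', fibre_coord (axis 2 1)) = 1"
    "fibre_form q ((axis 3 1 :: real ^ 3) $ 1 *\<^sub>R c', fibre_coord (axis 3 1)) = \<i>"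
    by (simp_all add: fibre_form_def v_def q_def P_def fibre_coord_def axis_def complex_eq_iff mult.commute mult.left_commute)
  have g: "hyp_metric c t y $ i $ j = 2 * (r / P\<^sup>2 * Re ((axis i 1 $ 1 *\<^sub>R c') * cnj (axis j 1 $ 1 *\<^sub>R c'))
    + P\<^sup>2 / (4 * r) * Re (fibre_form q (axis i 1 $ 1 *\<^sub>R c', fibre_coord (axis i 1))
        * cnj (fibre_form q (axis j 1 $ 1 *\<^sub>R c', fibre_coord (axis j 1)))))" for i j
    by (simp add: hyp_metric_def im fd eh_metric_chart[OF snd] r) (simp add: q_def P_def)
  show ?thesis
    unfolding vec_eq_iff forall_3 g f r_def[symmetric]
    by (simp add: fibre_metric_def Let_def axis_def cc power2_eq_square algebra_simps add_divide_distrib)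
qed

subsection \<open>Coordinates adapted to the hypersurface\<close>

text \<open>Asks only for the existence of continuous first derivatives and is closed under the
  arithmetic operations. The second derivatives of the transported function are obtained through it
  without formulas.\<close>

definition cont_diff :: "(real \<times> real \<times> real \<Rightarrow> real) \<Rightarrow> bool" where
  "cont_diff f \<longleftrightarrow> continuous_on UNIV f \<and> (\<forall>e\<in>{dx, dy, dz}. \<exists>f'. dir_deriv e f f' \<and> continuous_on UNIV f')"

lemma cont_diffI:
  assumes "continuous_on UNIV f" "dir_deriv dx f f1" "dir_deriv dy f f2" "dir_deriv dz f f3"
    "continuous_on UNIV f1" "continuous_on UNIV f2" "continuous_on UNIV f3"
  shows "cont_diff f"
  using assms by (auto simp: cont_diff_def)

lemma cont_diff_continuous: "cont_diff f \<Longrightarrow> continuous_on UNIV f"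
  by (simp add: cont_diff_def)

lemma cont_diff_const: "cont_diff (\<lambda>q. a)"
  unfolding cont_diff_def by (auto intro: dir_deriv_const)

lemma cont_diff_add:
  assumes "cont_diff f" "cont_diff g"
  shows "cont_diff (\<lambda>q. f q + g q)"
proof -
  note c = assms[THEN cont_diff_continuous]
  have "\<exists>h. dir_deriv e (\<lambda>q. f q + g q) h \<and> continuous_on UNIV h" if e: "e \<in> {dx, dy, dz}" for e
  proof -
    obtain f' where f': "dir_deriv e f f'" "continuous_on UNIV f'" using assms(1) e unfolding cont_diff_def by blast
    obtain g' where g': "dir_deriv e g g'" "continuous_on UNIV g'" using assms(2) e unfolding cont_diff_def by blast
    show ?thesis
      by (rule exI[of _ "\<lambda>q. f' q + g' q"], rule conjI, rule dir_deriv_add[OF f'(1) g'(1)]) (intro continuous_intros c f' g')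
  qed
  then show ?thesis unfolding cont_diff_def using continuous_on_add[OF c] by blast
qed

lemma cont_diff_diff:
  assumes "cont_diff f" "cont_diff g"
  shows "cont_diff (\<lambda>q. f q - g q)"
proof -
  note c = assms[THEN cont_diff_continuous]
  have "\<exists>h. dir_deriv e (\<lambda>q. f q - g q) h \<and> continuous_on UNIV h" if e: "e \<in> {dx, dy, dz}" for e
  proof -
    obtain f' where f': "dir_deriv e f f'" "continuous_on UNIV f'" using assms(1) e unfolding cont_diff_def by blast
    obtain g' where g': "dir_deriv e g g'" "continuous_on UNIV g'" using assms(2) e unfolding cont_diff_def by blast
    show ?thesis
      by (rule exI[of _ "\<lambda>q. f' q - g' q"], rule conjI, rule dir_deriv_diff[OF f'(1) g'(1)]) (intro continuous_intros c f' g')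
  qed
  then show ?thesis unfolding cont_diff_def using continuous_on_diff[OF c] by blast
qed

lemma cont_diff_mult:
  assumes "cont_diff f" "cont_diff g"
  shows "cont_diff (\<lambda>q. f q * g q)"
proof -
  note c = assms[THEN cont_diff_continuous]
  have "\<exists>h. dir_deriv e (\<lambda>q. f q * g q) h \<and> continuous_on UNIV h" if e: "e \<in> {dx, dy, dz}" for e
  proof -
    obtain f' where f': "dir_deriv e f f'" "continuous_on UNIV f'" using assms(1) e unfolding cont_diff_def by blast
    obtain g' where g': "dir_deriv e g g'" "continuous_on UNIV g'" using assms(2) e unfolding cont_diff_def by blast
    show ?thesis
      by (rule exI[of _ "\<lambda>q. f' q * g q + f q * g' q"], rule conjI, rule dir_deriv_mult[OF f'(1) g'(1)]) (intro continuous_intros c f' g')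
  qed
  then show ?thesis unfolding cont_diff_def using continuous_on_mult[OF c] by blast
qed

lemma cont_diff_x:
  assumes "\<And>x. (A has_real_derivative A' x) (at x)" "continuous_on UNIV A'"
  shows "cont_diff (\<lambda>q. A (fst q))"
  by (rule cont_diffI[OF _ dir_deriv_coord(1)[OF assms(1)] dir_deriv_coord_const(3) dir_deriv_coord_const(4)])
    (auto intro!: cont_coord(2) assms(2) DERIV_imp_continuous[OF assms(1)])

lemma pderiv_at_eqI:
  assumes "f differentiable (at y)" "((\<lambda>h. f (y + h *\<^sub>R axis i 1)) has_real_derivative d) (at 0)"
  shows "pderiv_at i f y = d"
proof -
  have "(f has_derivative frechet_derivative f (at y)) (at (y + 0 *\<^sub>R axis i 1))"
    using assms(1) by (simp add: frechet_derivative_works)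
  moreover have "((\<lambda>h. y + h *\<^sub>R axis i 1) has_derivative (\<lambda>h. h *\<^sub>R axis i 1)) (at 0)"
    by (auto intro!: derivative_eq_intros)
  ultimately have d: "((\<lambda>h. f (y + h *\<^sub>R axis i 1)) has_derivative (\<lambda>h. frechet_derivative f (at y) (h *\<^sub>R axis i 1))) (at 0)"
    using has_derivative_compose by blast
  have "linear (frechet_derivative f (at y))"
    using assms(1) linear_frechet_derivative by blast
  then have "frechet_derivative f (at y) (h *\<^sub>R axis i 1) = pderiv_at i f y * h" for h
    by (simp add: pderiv_at_def linear_scale)
  then have "((\<lambda>h. f (y + h *\<^sub>R axis i 1)) has_real_derivative pderiv_at i f y) (at 0)"
    unfolding has_field_derivative_def by (intro has_derivative_eq_rhs[OF d] ext)
  then show ?thesis using assms(2) DERIV_unique by blast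
qed

lemma pderiv_at_mult:
  assumes "f differentiable (at y)" "g differentiable (at y)"
  shows "pderiv_at i (\<lambda>y. f y * g y) y = f y * pderiv_at i g y + pderiv_at i f y * g y"
proof -
  have "((\<lambda>y. f y * g y) has_derivative (\<lambda>h. f y * frechet_derivative g (at y) h + frechet_derivative f (at y) h * g y)) (at y)"
    using assms by (intro has_derivative_mult) (simp_all add: frechet_derivative_works)
  from fun_cong[OF frechet_derivative_at[OF this], of "axis i 1", symmetric] show ?thesis
    by (simp add: pderiv_at_def)
qed

lemma pderiv_at_diff:
  assumes "f differentiable (at y)" "g differentiable (at y)"
  shows "pderiv_at i (\<lambda>y. f y - g y) y = pderiv_at i f y - pderiv_at i g y"
proof -
  have "((\<lambda>y. f y - g y) has_derivative (\<lambda>h. frechet_derivative f (at y) h - frechet_derivative g (at y) h)) (at y)"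
    using assms by (intro has_derivative_diff) (simp_all add: frechet_derivative_works)
  from fun_cong[OF frechet_derivative_at[OF this], of "axis i 1", symmetric] show ?thesis
    by (simp add: pderiv_at_def)
qed

lemma pderiv_at_cong_open:
  assumes "open O'" "y \<in> O'" "\<And>z. z \<in> O' \<Longrightarrow> f z = g z" "g differentiable (at y)"
  shows "pderiv_at i f y = pderiv_at i g y"
proof -
  have "(g has_derivative frechet_derivative g (at y)) (at y)" using assms(4) by (simp add: frechet_derivative_works)
  then have "(f has_derivative frechet_derivative g (at y)) (at y)"
    by (rule has_derivative_transform_within_open[OF _ assms(1,2)]) (use assms(3) in auto)
  from frechet_derivative_at[OF this] show ?thesis by (simp add: pderiv_at_def)
qed

lemma differentiable_compose_DERIV:
  fixes f :: "'a::real_normed_vector \<Rightarrow> real"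
  assumes "f differentiable (at y)" "(g has_real_derivative g') (at (f y))"
  shows "(\<lambda>y. g (f y)) differentiable (at y)"
  using differentiable_chain_at[OF assms(1), of g] assms(2)
  by (auto simp: o_def has_field_derivative_def differentiable_def)

definition fibre_domain :: "(real ^ 3) set" where
  "fibre_domain = {y. fibre_coord y \<noteq> 0}"

lemma open_fibre_domain: "open fibre_domain"
  unfolding fibre_domain_def
  by (intro open_Collect_neq continuous_on_const linear_continuous_on fibre_coord_bounded_linear)

text \<open>\<open>S\<close> gives the Euclidean arc length in terms of the spherical one.
  \<open>\<theta>\<close> is the angle through which horizontal transport along the curve rotates
  the fibre, up to sign and an additive constant.\<close>

locale curve_chart =
  fixes c c' c'' :: "real \<Rightarrow> complex" and S \<theta> :: "real \<Rightarrow> real"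
  assumes c: "\<And>s. (c has_vector_derivative c' s) (at s)"
    and c': "\<And>s. (c' has_vector_derivative c'' s) (at s)"
    and c'': "continuous_on UNIV c''"
    and unit: "\<And>s. cmod (c' s) = 1"
    and S: "\<And>x. (S has_real_derivative 1 + (cmod (c (S x)))\<^sup>2) (at x)"
    and \<theta>: "\<And>x. (\<theta> has_real_derivative 2 * Im (cnj (c (S x)) * c' (S x))) (at x)"
begin

text \<open>\<open>k1 + i * k2\<close> is the connection coefficient along the curve. Its real part
  is the logarithmic derivative of \<open>P\<close>, which the factor \<open>1 / P\<close> in the
  fibre coordinate compensates; its imaginary part is compensated by
  \<open>\<theta>\<close>.\<close>

definition "P s = 1 + (cmod (c s))\<^sup>2"
definition "k1 s = 2 * Re (cnj (c s) * c' s) / P s"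
definition "k2 s = 2 * Im (cnj (c s) * c' s) / P s"

text \<open>Horizontal transport along the curve of the fibre coordinate \<open>exp (2 * y + \<i> * z)\<close>; the factor
  \<open>1 / P\<close> makes \<open>u\<^sub>1 = exp (2 * y)\<close> and \<open>\<theta>\<close> undoes the rotation.\<close>

definition "fib_re q = exp (2 * fst (snd q)) * cos (snd (snd q) - \<theta> (fst q)) / P (S (fst q))"
definition "fib_im q = exp (2 * fst (snd q)) * sin (snd (snd q) - \<theta> (fst q)) / P (S (fst q))"
definition "tr_re q = k1 (S (fst q)) * fib_re q - k2 (S (fst q)) * fib_im q"
definition "tr_im q = k1 (S (fst q)) * fib_im q + k2 (S (fst q)) * fib_re q"

definition \<Phi> :: "real \<times> real \<times> real \<Rightarrow> real ^ 3" where
  "\<Phi> q = S (fst q) *\<^sub>R axis 1 1 + fib_re q *\<^sub>R axis 2 1 + fib_im q *\<^sub>R axis 3 1"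

lemma \<Phi>_nth: "\<Phi> q $ 1 = S (fst q)" "\<Phi> q $ 2 = fib_re q" "\<Phi> q $ 3 = fib_im q"
  by (simp_all add: \<Phi>_def axis_def)

lemma P_pos: "0 < P s" unfolding P_def by (rule one_add_cmod2_pos)

lemma DERIV_P: "(P has_real_derivative k1 s * P s) (at s)"
proof -
  have "((\<lambda>s. 1 + ((Re (c s))\<^sup>2 + (Im (c s))\<^sup>2)) has_real_derivative 2 * Re (cnj (c s) * c' s)) (at s)"
    by (auto intro!: derivative_eq_intros c simp: algebra_simps)
  then show ?thesis using P_pos[of s] by (simp add: P_def[abs_def] cmod_power2 k1_def)
qed

lemma DERIV_k: "\<exists>k1' k2'. (\<forall>s. (k1 has_real_derivative k1' s) (at s)) \<and> (\<forall>s. (k2 has_real_derivative k2' s) (at s))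
  \<and> continuous_on UNIV k1' \<and> continuous_on UNIV k2'"
proof -
  define h h' where "h s = cnj (c s) * c' s" and "h' s = cnj (c s) * c'' s + cnj (c' s) * c' s" for s
  have h: "(h has_vector_derivative h' s) (at s)" for s
    unfolding h_def[abs_def] h'_def
    by (rule has_vector_derivative_mult[OF bounded_linear.has_vector_derivative[OF bounded_linear_cnj c] c'])
  have cc: "continuous_on UNIV c" "continuous_on UNIV c'"
    by (intro continuous_at_imp_continuous_on ballI has_vector_derivative_continuous[OF c] has_vector_derivative_continuous[OF c'])+
  have ch: "continuous_on UNIV h'" "continuous_on UNIV h" unfolding h'_def h_def by (intro continuous_intros cc c'')+
  have cP: "continuous_on UNIV P" by (rule DERIV_imp_continuous, rule DERIV_P)
  have P0: "P s \<noteq> 0" for s using P_pos[of s] by simp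
  have k1e: "k1 s = 2 * Re (h s) / P s" and k2e: "k2 s = 2 * Im (h s) / P s" for s by (simp_all add: k1_def k2_def h_def)
  have hr: "((\<lambda>s. Re (h s)) has_real_derivative Re (h' s)) (at s)" "((\<lambda>s. Im (h s)) has_real_derivative Im (h' s)) (at s)" for s
    using bounded_linear.has_vector_derivative[OF bounded_linear_Re h] bounded_linear.has_vector_derivative[OF bounded_linear_Im h]
    by (simp_all add: has_real_derivative_iff_has_vector_derivative)
  have ck: "continuous_on UNIV k1" unfolding k1e[abs_def] by (intro continuous_intros ch cP ballI P0)
  define k1' k2' where "k1' s = (2 * Re (h' s) * P s - 2 * Re (h s) * (k1 s * P s)) / (P s * P s)"
    and "k2' s = (2 * Im (h' s) * P s - 2 * Im (h s) * (k1 s * P s)) / (P s * P s)" for s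
  have "((\<lambda>s. 2 * Re (h s) / P s) has_real_derivative k1' s) (at s)" "((\<lambda>s. 2 * Im (h s) / P s) has_real_derivative k2' s) (at s)" for s
    unfolding k1'_def k2'_def by (intro DERIV_divide DERIV_cmult hr DERIV_P P0)+
  then have "(k1 has_real_derivative k1' s) (at s)" "(k2 has_real_derivative k2' s) (at s)" for s
    unfolding k1e[abs_def] k2e[abs_def] by blast+
  moreover have "continuous_on UNIV k1'" "continuous_on UNIV k2'"
    unfolding k1'_def k2'_def by (intro continuous_intros ch cP ck; simp add: P0)+
  ultimately show ?thesis by blast
qed

lemma cont_S: "continuous_on UNIV S" by (rule DERIV_imp_continuous, rule S)

lemma DERIV_PS: "((\<lambda>x. P (S x)) has_real_derivative k1 (S x) * (P (S x))\<^sup>2) (at x)"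
  using DERIV_chain2[OF DERIV_P S[folded P_def]] by (simp add: power2_eq_square mult.assoc)

lemma DERIV_inv_PS: "((\<lambda>x. 1 / P (S x)) has_real_derivative - k1 (S x)) (at x)"
proof -
  have "P (S x) \<noteq> 0" using P_pos[of "S x"] by simp
  then show ?thesis
    using DERIV_divide[OF DERIV_const DERIV_PS, of x 1] by (simp add: power2_eq_square)
qed

lemma DERIV_\<theta>: "(\<theta> has_real_derivative P (S x) * k2 (S x)) (at x)"
  using \<theta>[of x] P_pos[of "S x"] by (simp add: k2_def)

lemma cont_diff_coeffs:
  "cont_diff (\<lambda>q. P (S (fst q)))" "cont_diff (\<lambda>q. k1 (S (fst q)))" "cont_diff (\<lambda>q. k2 (S (fst q)))"
proof -
  obtain k1' k2' where k: "\<And>s. (k1 has_real_derivative k1' s) (at s)" "\<And>s. (k2 has_real_derivative k2' s) (at s)"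
    "continuous_on UNIV k1'" "continuous_on UNIV k2'" using DERIV_k by blast
  have cont: "continuous_on UNIV (\<lambda>x. P (S x))" by (rule DERIV_imp_continuous, rule DERIV_PS)
  have ck: "continuous_on UNIV (\<lambda>x. f (S x))" if "continuous_on UNIV f" for f :: "real \<Rightarrow> real"
    using that cont_S continuous_on_compose2 by blast
  have ck1: "continuous_on UNIV k1" by (rule DERIV_imp_continuous, rule k)
  show "cont_diff (\<lambda>q. P (S (fst q)))"
    by (rule cont_diff_x[OF DERIV_PS]) (intro continuous_intros ck ck1 cont)
  show "cont_diff (\<lambda>q. k1 (S (fst q)))" "cont_diff (\<lambda>q. k2 (S (fst q)))"
    by (rule cont_diff_x[OF DERIV_chain2[OF k(1) S[folded P_def]]] cont_diff_x[OF DERIV_chain2[OF k(2) S[folded P_def]]];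
      intro continuous_intros ck k cont)+
qed

text \<open>With the two functions as real and imaginary parts of one complex coordinate: the
  \<open>x\<close>-derivative is the transport equation, multiplication by
  \<open>- P * (k1 + i * k2)\<close>; the \<open>y\<close>- and \<open>z\<close>-derivatives are
  multiplication by \<open>2\<close> and by \<open>i\<close>.\<close>

lemma dir_deriv_fib:
  "dir_deriv dx fib_re (\<lambda>q. - (P (S (fst q)) * tr_re q))" "dir_deriv dx fib_im (\<lambda>q. - (P (S (fst q)) * tr_im q))"
  "dir_deriv dy fib_re (\<lambda>q. 2 * fib_re q)" "dir_deriv dy fib_im (\<lambda>q. 2 * fib_im q)"
  "dir_deriv dz fib_re (\<lambda>q. - fib_im q)" "dir_deriv dz fib_im (\<lambda>q. fib_re q)"
proof -
  define \<phi> where "\<phi> q = snd (snd q) - \<theta> (fst q)" for q :: "real \<times> real \<times> real"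
  have \<phi>: "dir_deriv dx \<phi> (\<lambda>q. 0 - P (S (fst q)) * k2 (S (fst q)))" "dir_deriv dy \<phi> (\<lambda>q. 0)" "dir_deriv dz \<phi> (\<lambda>q. 1)"
  proof -
    show "dir_deriv dx \<phi> (\<lambda>q. 0 - P (S (fst q)) * k2 (S (fst q)))"
      unfolding \<phi>_def by (intro dir_deriv_diff dir_deriv_coord(1)[OF DERIV_\<theta>] dir_deriv_coord_const(1))
    show "dir_deriv dy \<phi> (\<lambda>q. 0)" "dir_deriv dz \<phi> (\<lambda>q. 1)"
      unfolding \<phi>_def dir_deriv_def by (auto intro!: derivative_eq_intros)
  qed
  have e: "dir_deriv dy (\<lambda>q. exp (2 * fst (snd q))) (\<lambda>q. 2 * exp (2 * fst (snd q)))"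
    by (rule dir_deriv_coord(2)[where A="\<lambda>y. exp (2 * y)" and A'="\<lambda>y. 2 * exp (2 * y)"]) (auto intro!: derivative_eq_intros)
  have re: "fib_re = (\<lambda>q. exp (2 * fst (snd q)) * cos (\<phi> q) * (1 / P (S (fst q))))"
    and im: "fib_im = (\<lambda>q. exp (2 * fst (snd q)) * sin (\<phi> q) * (1 / P (S (fst q))))"
    by (simp_all add: fib_re_def[abs_def] fib_im_def[abs_def] \<phi>_def)
  have P0: "P (S x) \<noteq> 0" for x using P_pos[of "S x"] by simp
  note rules = dir_deriv_mult dir_deriv_coord(1)[OF DERIV_inv_PS] e dir_deriv_coord_const
    dir_deriv_compose[where F=cos and F'="\<lambda>x. - sin x"] dir_deriv_compose[where F=sin and F'=cos] \<phi> DERIV_cos DERIV_sin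
  show "dir_deriv dx fib_re (\<lambda>q. - (P (S (fst q)) * tr_re q))" "dir_deriv dx fib_im (\<lambda>q. - (P (S (fst q)) * tr_im q))"
    unfolding re im tr_re_def tr_im_def
    by (rule dir_deriv_eq, (rule rules)+, simp add: algebra_simps P0)+
  show "dir_deriv dy fib_re (\<lambda>q. 2 * fib_re q)" "dir_deriv dy fib_im (\<lambda>q. 2 * fib_im q)"
    "dir_deriv dz fib_re (\<lambda>q. - fib_im q)" "dir_deriv dz fib_im (\<lambda>q. fib_re q)"
    unfolding re im by (rule dir_deriv_eq, (rule rules)+, simp)+
qed

lemma fib_norm: "(fib_re q)\<^sup>2 + (fib_im q)\<^sup>2 = (exp (2 * fst (snd q)) / P (S (fst q)))\<^sup>2"
proof -
  define \<phi> where "\<phi> = snd (snd q) - \<theta> (fst q)"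
  define R where "R = exp (2 * fst (snd q)) / P (S (fst q))"
  have "fib_re q = R * cos \<phi>" "fib_im q = R * sin \<phi>"
    by (simp_all add: fib_re_def fib_im_def \<phi>_def R_def)
  then show ?thesis
    by (simp only: power_mult_distrib distrib_left[symmetric] sin_cos_squared_add2 mult_1_right R_def)
qed

lemma cont_fib: "continuous_on UNIV fib_re" "continuous_on UNIV fib_im"
proof -
  have c: "continuous_on UNIV \<theta>" "continuous_on UNIV (\<lambda>x. P (S x))"
    by (rule DERIV_imp_continuous, rule \<theta> DERIV_PS)+
  have P0: "P (S x) \<noteq> 0" for x using P_pos[of "S x"] by simp
  show "continuous_on UNIV fib_re" "continuous_on UNIV fib_im"
    unfolding fib_re_def[abs_def] fib_im_def[abs_def]
    by (intro continuous_intros cont_coord(2)[OF c(1)] cont_coord(2)[OF c(2)] ballI P0)+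
qed

lemma cont_diff_fib: "cont_diff fib_re" "cont_diff fib_im" "cont_diff tr_re" "cont_diff tr_im"
proof -
  note cc = cont_diff_coeffs[THEN cont_diff_continuous] cont_fib
  have ct: "continuous_on UNIV tr_re" "continuous_on UNIV tr_im"
    unfolding tr_re_def[abs_def] tr_im_def[abs_def] by (intro continuous_intros cc)+
  show f: "cont_diff fib_re" "cont_diff fib_im"
    by (rule cont_diffI[OF cc(4) dir_deriv_fib(1,3,5)] cont_diffI[OF cc(5) dir_deriv_fib(2,4,6)];
      intro continuous_intros cc ct)+
  show "cont_diff tr_re" "cont_diff tr_im"
    unfolding tr_re_def[abs_def] tr_im_def[abs_def]
    by (intro cont_diff_add cont_diff_diff cont_diff_mult cont_diff_coeffs f)+
qed

lemma cont_\<Phi>: "continuous_on UNIV \<Phi>"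
  unfolding \<Phi>_def by (intro continuous_intros cont_fib cont_coord(2) cont_S)

lemma fibre_coord_\<Phi>: "cmod (fibre_coord (\<Phi> q)) * P (S (fst q)) = exp (2 * fst (snd q))"
proof -
  have "cmod (fibre_coord (\<Phi> q)) = \<bar>exp (2 * fst (snd q)) / P (S (fst q))\<bar>"
    by (simp only: fibre_coord_def \<Phi>_nth cmod_def complex.sel fib_norm real_sqrt_abs)
  then show ?thesis using P_pos[of "S (fst q)"] by simp
qed

lemma \<Phi>_in_domain: "\<Phi> q \<in> fibre_domain"
proof -
  have "cmod (fibre_coord (\<Phi> q)) * P (S (fst q)) \<noteq> 0" by (simp add: fibre_coord_\<Phi>)
  then show ?thesis by (auto simp: fibre_domain_def)
qed

text \<open>Under \<open>\<Phi>\<close> the coordinate fields become \<open>P\<close> times the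
  horizontal lift of the unit tangent, twice the radial field of the fibre, and its rotation
  field.\<close>

lemma dir_deriv_\<Phi>:
  assumes f: "\<And>y. y \<in> fibre_domain \<Longrightarrow> f differentiable (at y)"
  shows "dir_deriv dx (\<lambda>q. f (\<Phi> q)) (\<lambda>q. P (S (fst q)) * (pderiv_at 1 f (\<Phi> q) - tr_re q * pderiv_at 2 f (\<Phi> q) - tr_im q * pderiv_at 3 f (\<Phi> q)))"
    "dir_deriv dy (\<lambda>q. f (\<Phi> q)) (\<lambda>q. 2 * (fib_re q * pderiv_at 2 f (\<Phi> q) + fib_im q * pderiv_at 3 f (\<Phi> q)))"
    "dir_deriv dz (\<lambda>q. f (\<Phi> q)) (\<lambda>q. - fib_im q * pderiv_at 2 f (\<Phi> q) + fib_re q * pderiv_at 3 f (\<Phi> q))"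
proof -
  have chain: "dir_deriv e (\<lambda>q. f (\<Phi> q)) (\<lambda>q. s' q * pderiv_at 1 f (\<Phi> q) + a' q * pderiv_at 2 f (\<Phi> q) + b' q * pderiv_at 3 f (\<Phi> q))"
    if "dir_deriv e (\<lambda>q. S (fst q)) s'" "dir_deriv e fib_re a'" "dir_deriv e fib_im b'" for e s' a' b'
    unfolding dir_deriv_def
  proof
    fix q
    let ?D = "frechet_derivative f (at (\<Phi> q))"
    have d: "(f has_derivative ?D) (at (\<Phi> (q + 0 *\<^sub>R e)))"
      using f[OF \<Phi>_in_domain[of q]] by (simp add: frechet_derivative_works)
    have "((\<lambda>h. \<Phi> (q + h *\<^sub>R e)) has_derivative (\<lambda>h. h *\<^sub>R (s' q *\<^sub>R axis 1 1 + a' q *\<^sub>R axis 2 1 + b' q *\<^sub>R axis 3 1))) (at 0)"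
    proof -
      have "((\<lambda>h. \<Phi> (q + h *\<^sub>R e)) has_vector_derivative s' q *\<^sub>R axis 1 1 + a' q *\<^sub>R axis 2 1 + b' q *\<^sub>R axis 3 1) (at 0)"
        unfolding \<Phi>_def
        using that[unfolded dir_deriv_def, rule_format, of q, unfolded has_real_derivative_iff_has_vector_derivative]
        by (intro has_vector_derivative_add bounded_linear.has_vector_derivative[OF bounded_linear_scaleR_left])
      then show ?thesis by (simp add: has_vector_derivative_def)
    qed
    from has_derivative_compose[OF this d]
    have *: "((\<lambda>h. f (\<Phi> (q + h *\<^sub>R e))) has_derivative (\<lambda>h. ?D (h *\<^sub>R (s' q *\<^sub>R axis 1 1 + a' q *\<^sub>R axis 2 1 + b' q *\<^sub>R axis 3 1)))) (at 0)" .
    have lin: "linear ?D" using d has_derivative_linear by blast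
    have "?D (h *\<^sub>R (s' q *\<^sub>R axis 1 1 + a' q *\<^sub>R axis 2 1 + b' q *\<^sub>R axis 3 1))
      = (s' q * pderiv_at 1 f (\<Phi> q) + a' q * pderiv_at 2 f (\<Phi> q) + b' q * pderiv_at 3 f (\<Phi> q)) * h" for h
      by (simp add: linear_scale[OF lin] linear_add[OF lin] pderiv_at_def algebra_simps)
    then show "((\<lambda>h. f (\<Phi> (q + h *\<^sub>R e))) has_real_derivative
      s' q * pderiv_at 1 f (\<Phi> q) + a' q * pderiv_at 2 f (\<Phi> q) + b' q * pderiv_at 3 f (\<Phi> q)) (at 0)"
      unfolding has_field_derivative_def by (intro has_derivative_eq_rhs[OF *] ext)
  qed
  show "dir_deriv dx (\<lambda>q. f (\<Phi> q)) (\<lambda>q. P (S (fst q)) * (pderiv_at 1 f (\<Phi> q) - tr_re q * pderiv_at 2 f (\<Phi> q) - tr_im q * pderiv_at 3 f (\<Phi> q)))"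
    by (rule dir_deriv_eq[OF chain[OF dir_deriv_coord(1)[OF S[folded P_def]] dir_deriv_fib(1,2)]]) (simp add: algebra_simps)
  show "dir_deriv dy (\<lambda>q. f (\<Phi> q)) (\<lambda>q. 2 * (fib_re q * pderiv_at 2 f (\<Phi> q) + fib_im q * pderiv_at 3 f (\<Phi> q)))"
    by (rule dir_deriv_eq[OF chain[OF dir_deriv_coord_const(3) dir_deriv_fib(3,4)]]) (simp add: algebra_simps)
  show "dir_deriv dz (\<lambda>q. f (\<Phi> q)) (\<lambda>q. - fib_im q * pderiv_at 2 f (\<Phi> q) + fib_re q * pderiv_at 3 f (\<Phi> q))"
    by (rule dir_deriv_eq[OF chain[OF dir_deriv_coord_const(4) dir_deriv_fib(5,6)]]) (simp add: algebra_simps)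
qed

lemma cont_diff_\<Phi>:
  assumes f: "\<And>y. y \<in> fibre_domain \<Longrightarrow> f differentiable (at y)"
    and fc: "\<And>i. continuous_on fibre_domain (pderiv_at i f)"
  shows "cont_diff (\<lambda>q. f (\<Phi> q))"
proof -
  have cp: "continuous_on UNIV (\<lambda>q. pderiv_at i f (\<Phi> q))" for i
    by (rule continuous_on_compose2[OF fc cont_\<Phi>]) (use \<Phi>_in_domain in auto)
  have "continuous_on fibre_domain f"
    using f by (meson continuous_at_imp_continuous_on differentiable_imp_continuous_within)
  then have cf: "continuous_on UNIV (\<lambda>q. f (\<Phi> q))"
    by (rule continuous_on_compose2[OF _ cont_\<Phi>]) (use \<Phi>_in_domain in auto)
  show ?thesis
    by (rule cont_diffI[OF cf dir_deriv_\<Phi>(1)[OF f] dir_deriv_\<Phi>(2)[OF f] dir_deriv_\<Phi>(3)[OF f]], assumption, assumption, assumption)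
      (intro continuous_intros cp cont_fib cont_diff_fib[THEN cont_diff_continuous] cont_diff_coeffs[THEN cont_diff_continuous])+
qed

end

subsection \<open>The Laplace equation in adapted coordinates\<close>

lemma differentiable_vec_nth: "(\<lambda>y :: real ^ 'n. y $ i) differentiable (at y)"
  by (rule bounded_linear_imp_differentiable) (rule bounded_linear_vec_nth)

context curve_chart
begin

text \<open>\<open>chart_rad\<close> is the function \<open>k\<close> at a point of the chart, and
  \<open>chart_re + i * chart_im\<close> is the connection term
  \<open>(k1 + i * k2) * \<gamma>\<close> there.\<close>

definition "chart_rad t y = sqrt (radius t (cmod (fibre_coord y) * P (y $ 1)))"
definition "chart_re y = k1 (y $ 1) * y $ 2 - k2 (y $ 1) * y $ 3"
definition "chart_im y = k1 (y $ 1) * y $ 3 + k2 (y $ 1) * y $ 2"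

lemma chart_rad_pos: "y \<in> fibre_domain \<Longrightarrow> 0 < chart_rad t y"
  using P_pos[of "y $ 1"] by (simp add: chart_rad_def fibre_domain_def radius_pos)

lemma chart_rad_sq: "y \<in> fibre_domain \<Longrightarrow> (chart_rad t y)\<^sup>2 = radius t (cmod (fibre_coord y) * P (y $ 1))"
  by (simp add: chart_rad_def radius_def)

lemma hyp_metric_chart:
  assumes y: "y \<in> fibre_domain"
  shows "hyp_metric c t y = fibre_metric (P (y $ 1)) ((chart_rad t y)\<^sup>2) (chart_re y) (chart_im y)"
proof -
  define v where "v = 2 * cnj (c (y $ 1)) * c' (y $ 1) / of_real (P (y $ 1)) * fibre_coord y"
  have "2 * cnj (c (y $ 1)) * c' (y $ 1) / of_real (P (y $ 1)) = Complex (k1 (y $ 1)) (k2 (y $ 1))"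
    by (simp add: complex_eq_iff k1_def k2_def Re_divide_of_real Im_divide_of_real)
  then have v: "Re v = chart_re y" "Im v = chart_im y"
    by (simp_all add: v_def chart_re_def chart_im_def fibre_coord_def)
  show ?thesis
    using hyp_metric_eq[OF c unit, of y t] y v by (simp add: fibre_domain_def chart_rad_sq v_def P_def)
qed

lemma vol_density_chart:
  assumes y: "y \<in> fibre_domain"
  shows "vol_density (hyp_metric c t) y = P (y $ 1) / (sqrt 2 * chart_rad t y)"
  using chart_rad_pos[OF y, of t] P_pos[of "y $ 1"]
  by (simp add: vol_density_def hyp_metric_chart[OF y] det_fibre_metric real_sqrt_mult)

lemma differentiable_chart:
  assumes y: "y \<in> fibre_domain"
  shows "(\<lambda>y. P (y $ 1)) differentiable (at y)" "chart_rad t differentiable (at y)"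
    "chart_re differentiable (at y)" "chart_im differentiable (at y)"
proof -
  obtain k1' k2' where k: "\<And>s. (k1 has_real_derivative k1' s) (at s)" "\<And>s. (k2 has_real_derivative k2' s) (at s)"
    using DERIV_k by blast
  note d = differentiable_compose_DERIV[OF differentiable_vec_nth]
  show p: "(\<lambda>y. P (y $ 1)) differentiable (at y)" by (rule d[OF DERIV_P])
  have kd: "(\<lambda>y. k1 (y $ 1)) differentiable (at y)" "(\<lambda>y. k2 (y $ 1)) differentiable (at y)"
    by (rule d[OF k(1)] d[OF k(2)])+
  show "chart_re differentiable (at y)" "chart_im differentiable (at y)"
    unfolding chart_re_def[abs_def] chart_im_def[abs_def]
    by (intro differentiable_add differentiable_diff differentiable_mult kd differentiable_vec_nth)+
  have y0: "fibre_coord y \<noteq> 0" using y by (simp add: fibre_domain_def)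
  have "((\<lambda>y. norm (fibre_coord y)) has_derivative (\<lambda>v. fibre_coord v \<bullet> sgn (fibre_coord y))) (at y)"
    using has_derivative_compose[OF bounded_linear_imp_has_derivative[OF fibre_coord_bounded_linear] has_derivative_norm[OF y0]] .
  then have n: "(\<lambda>y. cmod (fibre_coord y)) differentiable (at y)" by (auto simp: differentiable_def)
  have u0: "cmod (fibre_coord y) * P (y $ 1) \<noteq> 0" using y0 P_pos[of "y $ 1"] by simp
  have "(\<lambda>y. radius t (cmod (fibre_coord y) * P (y $ 1))) differentiable (at y)"
    by (rule differentiable_compose_DERIV[OF differentiable_mult[OF n p] DERIV_radius[OF u0]])
  from differentiable_compose_DERIV[OF this DERIV_real_sqrt[OF radius_pos[OF u0]]]
  show "chart_rad t differentiable (at y)" by (simp add: chart_rad_def[abs_def])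
qed

definition "chart_flux t W y = (P (y $ 1)) ^ 3 * (1 / (2 * sqrt 2)) * inverse ((chart_rad t y) ^ 3) *
  (pderiv_at 1 W y - chart_re y * pderiv_at 2 W y - chart_im y * pderiv_at 3 W y)"

definition "fibre_flux t W i y = sqrt 2 * chart_rad t y * inverse (P (y $ 1)) * pderiv_at i W y"

text \<open>In the frame dual to the sheared coframe the metric is diagonal. Thus the gradient flux
  consists of a horizontal part, along the first basis vector minus the connection term, and a
  vertical part with one weight for both fibre directions.\<close>

lemma riem_grad_chart:
  assumes y: "y \<in> fibre_domain"
  shows "vol_density (hyp_metric c t) y * riem_grad (hyp_metric c t) W y $ 1 = chart_flux t W y"
    "vol_density (hyp_metric c t) y * riem_grad (hyp_metric c t) W y $ 2 = fibre_flux t W 2 y - chart_re y * chart_flux t W y"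
    "vol_density (hyp_metric c t) y * riem_grad (hyp_metric c t) W y $ 3 = fibre_flux t W 3 y - chart_im y * chart_flux t W y"
proof -
  define p r s m n where "p = P (y $ 1)" and "r = chart_rad t y" and "s = sqrt 2" and "m = chart_re y" and "n = chart_im y"
  have pos: "p > 0" "r > 0" "s > 0" "s * s = 2" using P_pos[of "y $ 1"] chart_rad_pos[OF y, of t] by (auto simp: p_def r_def s_def)
  have inv: "matrix_inv (hyp_metric c t y) = fibre_metric_inv p (r\<^sup>2) m n"
    unfolding hyp_metric_chart[OF y] using pos by (simp add: matrix_inv_fibre_metric p_def r_def m_def n_def)
  have vol: "vol_density (hyp_metric c t) y = p / (s * r)" by (simp add: vol_density_chart[OF y] p_def r_def s_def)
  have e1: "p / (s * r) * (p\<^sup>2 / (2 * r\<^sup>2)) = p ^ 3 * (1 / (2 * s)) * inverse (r ^ 3)"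
    using pos by (simp add: field_simps power2_eq_square power3_eq_cube)
  have e2: "p / (s * r) * (1 / (p\<^sup>2 / (2 * r\<^sup>2))) = s * r * inverse p"
  proof -
    have "p / (s * r) * (1 / (p\<^sup>2 / (2 * r\<^sup>2))) = (s * s) * r / (s * p)"
      using pos(1-3) unfolding pos(4) by (simp add: field_simps power2_eq_square)
    also have "\<dots> = s * r * inverse p" using pos(1-3) by (simp add: field_simps)
    finally show ?thesis .
  qed
  define f where "f = p\<^sup>2 / (2 * r\<^sup>2)"
  define V where "V = p / (s * r)"
  note defs = riem_grad_def inv vol fibre_metric_inv_def Let_def f_def[symmetric] matrix_vector_mult_def sum_3
  have E: "V * f = p ^ 3 * (1 / (2 * s)) * inverse (r ^ 3)" "V * (1 / f) = s * r * inverse p"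
    using e1 e2 by (simp_all only: f_def V_def)
  have C: "chart_flux t W y = V * f * (pderiv_at 1 W y - m * pderiv_at 2 W y - n * pderiv_at 3 W y)"
    unfolding E by (simp add: chart_flux_def p_def r_def s_def m_def n_def)
  have G: "fibre_flux t W i y = V * (1 / f) * pderiv_at i W y" for i
    unfolding E by (simp add: fibre_flux_def p_def r_def s_def)
  show "vol_density (hyp_metric c t) y * riem_grad (hyp_metric c t) W y $ 1 = chart_flux t W y"
    "vol_density (hyp_metric c t) y * riem_grad (hyp_metric c t) W y $ 2 = fibre_flux t W 2 y - chart_re y * chart_flux t W y"
    "vol_density (hyp_metric c t) y * riem_grad (hyp_metric c t) W y $ 3 = fibre_flux t W 3 y - chart_im y * chart_flux t W y"
    unfolding C G m_def[symmetric] n_def[symmetric] defs V_def[symmetric]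
    by (simp_all add: algebra_simps)
qed

text \<open>The horizontal field has its own divergence: \<open>chart_re\<close> differentiated in
  its first fibre coordinate and \<open>chart_im\<close> in its second both give \<open>k1\<close>,
  whence the term with \<open>2 * k1\<close>.\<close>

lemma divergence_chart:
  assumes W: "\<And>i y. y \<in> fibre_domain \<Longrightarrow> pderiv_at i W differentiable (at y)"
    and harm: "riem_laplacian (hyp_metric c t) W y = 0" and y: "y \<in> fibre_domain"
  shows "chart_flux t W differentiable (at y)" "fibre_flux t W i differentiable (at y)"
    "(pderiv_at 1 (chart_flux t W) y - chart_re y * pderiv_at 2 (chart_flux t W) y - chart_im y * pderiv_at 3 (chart_flux t W) y
      - 2 * k1 (y $ 1) * chart_flux t W y) + pderiv_at 2 (fibre_flux t W 2) y + pderiv_at 3 (fibre_flux t W 3) y = 0"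
proof -
  note dc = differentiable_chart[OF y]
  have inv: "(\<lambda>y. inverse ((chart_rad t y) ^ 3)) differentiable (at y)" "(\<lambda>y. inverse (P (y $ 1))) differentiable (at y)"
    using chart_rad_pos[OF y, of t] P_pos[of "y $ 1"]
    by (auto intro!: differentiable_inverse differentiable_power dc)
  show F: "chart_flux t W differentiable (at y)" and G: "fibre_flux t W i differentiable (at y)" for i
    unfolding chart_flux_def[abs_def] fibre_flux_def[abs_def]
    by (intro differentiable_mult differentiable_diff differentiable_power differentiable_const inv dc W y)+
  have flux: "vol_density (hyp_metric c t) y \<noteq> 0"
    using chart_rad_pos[OF y, of t] P_pos[of "y $ 1"] by (simp add: vol_density_chart[OF y])
  have "pderiv_at 1 (\<lambda>z. vol_density (hyp_metric c t) z * riem_grad (hyp_metric c t) W z $ 1) y = pderiv_at 1 (chart_flux t W) y"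
    by (rule pderiv_at_cong_open[OF open_fibre_domain y riem_grad_chart(1) F])
  moreover have "pderiv_at 2 (\<lambda>z. vol_density (hyp_metric c t) z * riem_grad (hyp_metric c t) W z $ 2) y =
      pderiv_at 2 (\<lambda>y. fibre_flux t W 2 y - chart_re y * chart_flux t W y) y"
    by (rule pderiv_at_cong_open[OF open_fibre_domain y riem_grad_chart(2)]) (assumption | intro differentiable_diff differentiable_mult F G dc)+
  moreover have "pderiv_at 3 (\<lambda>z. vol_density (hyp_metric c t) z * riem_grad (hyp_metric c t) W z $ 3) y =
      pderiv_at 3 (\<lambda>y. fibre_flux t W 3 y - chart_im y * chart_flux t W y) y"
    by (rule pderiv_at_cong_open[OF open_fibre_domain y riem_grad_chart(3)]) (assumption | intro differentiable_diff differentiable_mult F G dc)+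
  moreover have "pderiv_at 2 (\<lambda>y. fibre_flux t W 2 y - chart_re y * chart_flux t W y) y =
      pderiv_at 2 (fibre_flux t W 2) y - (chart_re y * pderiv_at 2 (chart_flux t W) y + pderiv_at 2 chart_re y * chart_flux t W y)"
    by (subst pderiv_at_diff[OF G differentiable_mult[OF dc(3) F]], subst pderiv_at_mult[OF dc(3) F]) (rule refl)
  moreover have "pderiv_at 3 (\<lambda>y. fibre_flux t W 3 y - chart_im y * chart_flux t W y) y =
      pderiv_at 3 (fibre_flux t W 3) y - (chart_im y * pderiv_at 3 (chart_flux t W) y + pderiv_at 3 chart_im y * chart_flux t W y)"
    by (subst pderiv_at_diff[OF G differentiable_mult[OF dc(4) F]], subst pderiv_at_mult[OF dc(4) F]) (rule refl)
  moreover have "pderiv_at 2 chart_re y = k1 (y $ 1)"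
    by (rule pderiv_at_eqI[OF dc(3)]) (auto simp: chart_re_def axis_def intro!: derivative_eq_intros)
  moreover have "pderiv_at 3 chart_im y = k1 (y $ 1)"
    by (rule pderiv_at_eqI[OF dc(4)]) (auto simp: chart_im_def axis_def intro!: derivative_eq_intros)
  moreover have "(\<Sum>i\<in>UNIV. pderiv_at i (\<lambda>z. vol_density (hyp_metric c t) z * riem_grad (hyp_metric c t) W z $ i) y) = 0"
    using harm flux by (simp add: riem_laplacian_def riem_div_def)
  ultimately show "(pderiv_at 1 (chart_flux t W) y - chart_re y * pderiv_at 2 (chart_flux t W) y - chart_im y * pderiv_at 3 (chart_flux t W) y
      - 2 * k1 (y $ 1) * chart_flux t W y) + pderiv_at 2 (fibre_flux t W 2) y + pderiv_at 3 (fibre_flux t W 3) y = 0"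
    by (simp add: sum_3 algebra_simps)
qed

end

definition cone_rad :: "real \<Rightarrow> real \<Rightarrow> real" where
  "cone_rad t y = sqrt (radius t (exp (2 * y)))"

lemma cone_rad_pos: "0 < cone_rad t y"
  by (simp add: cone_rad_def radius_pos)

text \<open>This derivative is also the coefficient of the second \<open>x\<close>-derivative in the
  transported equation, which explains the common factor of \<open>u11\<close> and \<open>u2\<close>
  there.\<close>

lemma DERIV_cone_rad: "(cone_rad t has_real_derivative exp (4 * y) / cone_rad t y ^ 3) (at y)"
proof -
  define u where "u = exp (2 * y)"
  have u: "u \<noteq> 0" "u * u = exp (4 * y)" by (simp_all add: u_def flip: exp_add)
  have r: "0 < radius t u" using radius_pos[OF u(1)] .
  have e: "((\<lambda>y. exp (2 * y)) has_real_derivative u * 2) (at y)"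
    by (auto intro!: derivative_eq_intros simp: u_def)
  have "((\<lambda>y. radius t (exp (2 * y))) has_real_derivative (u / radius t u) * (u * 2)) (at y)"
    by (rule DERIV_chain2[where f="radius t" and g="\<lambda>y. exp (2 * y)", OF _ e]) (use DERIV_radius[OF u(1)] in \<open>simp add: u_def\<close>)
  then have "((\<lambda>y. sqrt (radius t (exp (2 * y)))) has_real_derivative
      (inverse (sqrt (radius t u)) / 2) * ((u / radius t u) * (u * 2))) (at y)"
    by (rule DERIV_chain2[where f=sqrt and g="\<lambda>y. radius t (exp (2 * y))", rotated])
      (use DERIV_real_sqrt[OF r] in \<open>simp add: u_def\<close>)
  moreover have "(inverse (sqrt (radius t u)) / 2) * ((u / radius t u) * (u * 2)) = exp (4 * y) / sqrt (radius t u) ^ 3"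
  proof -
    have "radius t u = sqrt (radius t u) * sqrt (radius t u)" using r by simp
    then show ?thesis using r u(2) by (simp add: power3_eq_cube field_simps)
  qed
  ultimately show ?thesis by (simp add: cone_rad_def[abs_def] u_def)
qed

context curve_chart
begin

lemma chart_rad_\<Phi>: "chart_rad t (\<Phi> q) = cone_rad t (fst (snd q))"
  using fibre_coord_\<Phi>[of q] by (simp add: chart_rad_def cone_rad_def \<Phi>_nth)

lemma chart_tr_\<Phi>: "chart_re (\<Phi> q) = tr_re q" "chart_im (\<Phi> q) = tr_im q"
  by (simp_all add: chart_re_def chart_im_def tr_re_def tr_im_def \<Phi>_nth)

lemma \<Phi>_periodic: "\<Phi> (x, y, z + 2 * pi) = \<Phi> (x, y, z)"
proof -
  have "z + 2 * pi - \<theta> x = (z - \<theta> x) + 2 * pi" by simp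
  then have "cos (z + 2 * pi - \<theta> x) = cos (z - \<theta> x)" "sin (z + 2 * pi - \<theta> x) = sin (z - \<theta> x)"
    by (simp_all only: cos_periodic sin_periodic)
  then show ?thesis by (simp add: \<Phi>_def fib_re_def fib_im_def)
qed

text \<open>The fluxes composed with \<open>\<Phi>\<close> are explicit multiples of
  \<open>u1\<close>, \<open>u2\<close> and \<open>u3\<close>. Differentiating these expressions by
  the product rule and by \<open>dir_deriv_\<Phi>\<close> must give the same result; the identities
  \<open>X1\<close>, \<open>X2\<close> and \<open>X3\<close> obtained in this way express the
  divergence through \<open>u11\<close>, \<open>u22\<close> and \<open>u33\<close>.\<close>

lemma transported_pde:
  assumes W: "\<And>y. y \<in> fibre_domain \<Longrightarrow> W differentiable (at y)"
    and W1: "\<And>i y. y \<in> fibre_domain \<Longrightarrow> pderiv_at i W differentiable (at y)"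
    and W2: "\<And>i j. continuous_on fibre_domain (pderiv_at j (pderiv_at i W))"
    and harm: "\<And>y. y \<in> fibre_domain \<Longrightarrow> riem_laplacian (hyp_metric c t) W y = 0"
  obtains u1 u2 u3 u11 u22 u33 u12 u32 where
    "jet2_mixed (\<lambda>q. W (\<Phi> q)) u1 u2 u3 u11 u22 u33 u12 u32"
    "\<And>x y z. exp (4 * y) / cone_rad t y ^ 3 * (u11 (x, y, z) + u2 (x, y, z)) + cone_rad t y * u22 (x, y, z)
      + 4 * cone_rad t y * u33 (x, y, z) = 0"
proof -
  define w where "w i q = pderiv_at i W (\<Phi> q)" for i q
  have cw: "cont_diff (w i)" for i unfolding w_def by (rule cont_diff_\<Phi>[OF W1 W2])
  define u1 where "u1 q = P (S (fst q)) * (w 1 q - tr_re q * w 2 q - tr_im q * w 3 q)" for q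
  define u2 where "u2 q = 2 * (fib_re q * w 2 q + fib_im q * w 3 q)" for q
  define u3 where "u3 q = fib_re q * w 3 q - fib_im q * w 2 q" for q
  have d: "dir_deriv dx (\<lambda>q. W (\<Phi> q)) u1" "dir_deriv dy (\<lambda>q. W (\<Phi> q)) u2" "dir_deriv dz (\<lambda>q. W (\<Phi> q)) u3"
    using dir_deriv_\<Phi>[OF W] by (auto simp: u1_def[abs_def] u2_def[abs_def] u3_def[abs_def] w_def algebra_simps)
  have cu: "cont_diff u1" "cont_diff u2" "cont_diff u3"
    unfolding u1_def[abs_def] u2_def[abs_def] u3_def[abs_def]
    by (intro cont_diff_add cont_diff_diff cont_diff_mult cont_diff_const cont_diff_coeffs cont_diff_fib cw)+
  have "continuous_on fibre_domain W"
    using W by (meson continuous_at_imp_continuous_on differentiable_imp_continuous_within)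
  then have c0: "continuous_on UNIV (\<lambda>q. W (\<Phi> q))"
    by (rule continuous_on_compose2[OF _ cont_\<Phi>]) (use \<Phi>_in_domain in auto)
  have ex: "\<exists>f'. dir_deriv e f f' \<and> continuous_on UNIV f'" if "cont_diff f" "e \<in> {dx, dy, dz}" for e f
    using that unfolding cont_diff_def by blast
  obtain u11 where u11: "dir_deriv dx u1 u11" "continuous_on UNIV u11" using ex[OF cu(1), of dx] by blast
  obtain u22 where u22: "dir_deriv dy u2 u22" "continuous_on UNIV u22" using ex[OF cu(2), of dy] by blast
  obtain u33 where u33: "dir_deriv dz u3 u33" "continuous_on UNIV u33" using ex[OF cu(3), of dz] by blast
  obtain u12 where u12: "dir_deriv dx u2 u12" "continuous_on UNIV u12" using ex[OF cu(2), of dx] by blast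
  obtain u21 where u21: "dir_deriv dy u1 u21" "continuous_on UNIV u21" using ex[OF cu(1), of dy] by blast
  obtain u32 where u32: "dir_deriv dz u2 u32" "continuous_on UNIV u32" using ex[OF cu(2), of dz] by blast
  obtain u23 where u23: "dir_deriv dy u3 u23" "continuous_on UNIV u23" using ex[OF cu(3), of dy] by blast
  note cc = cu[THEN cont_diff_continuous]
  have m12: "u21 = u12"
    by (rule dir_deriv_mixed[OF d(1,2) u21(1) u12(1) cc(2) u21(2) u12(2)])
  have m32: "u23 = u32"
    by (rule dir_deriv_mixed[OF d(3,2) u23(1) u32(1) cc(2) u23(2) u32(2)])
  have jet: "jet2_mixed (\<lambda>q. W (\<Phi> q)) u1 u2 u3 u11 u22 u33 u12 u32"
    by unfold_locales
      (fact d c0 cc u11 u22 u33 u12 u32 u21[unfolded m12] u23[unfolded m32] | simp add: \<Phi>_periodic)+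
  have pde: "exp (4 * y) / cone_rad t y ^ 3 * (u11 (x, y, z) + u2 (x, y, z)) + cone_rad t y * u22 (x, y, z)
      + 4 * cone_rad t y * u33 (x, y, z) = 0" for x y z
  proof -
    define q where "q = (x, y, z)"
    define K where "K = cone_rad t"
    define K' where "K' = (\<lambda>y. exp (4 * y) / K y ^ 3)"
    have dK: "(K has_real_derivative K' y) (at y)" for y unfolding K_def K'_def by (rule DERIV_cone_rad)
    have Kp: "0 < K y" for y unfolding K_def by (rule cone_rad_pos)
    have div: "chart_flux t W differentiable (at y)" "\<And>i. fibre_flux t W i differentiable (at y)"
      "(pderiv_at 1 (chart_flux t W) y - chart_re y * pderiv_at 2 (chart_flux t W) y - chart_im y * pderiv_at 3 (chart_flux t W) y
        - 2 * k1 (y $ 1) * chart_flux t W y) + pderiv_at 2 (fibre_flux t W 2) y + pderiv_at 3 (fibre_flux t W 3) y = 0"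
      if "y \<in> fibre_domain" for y
      by (rule divergence_chart[OF W1 harm[OF that] that], assumption)+
    define p where "p = P (S x)"
    have p: "0 < p" unfolding p_def by (rule P_pos)
    define s where "s = sqrt 2"
    have s: "0 < s" "s * s = 2" by (auto simp: s_def)
    have F: "chart_flux t W (\<Phi> q) = (P (S (fst q)) * P (S (fst q))) * u1 q * (1 / (2 * s) * inverse (K (fst (snd q)) ^ 3))" for q
      by (simp add: chart_flux_def chart_rad_\<Phi> chart_tr_\<Phi> \<Phi>_nth u1_def w_def K_def s_def power3_eq_cube mult.assoc mult.left_commute)
    define f g where "f = (\<lambda>q. fibre_flux t W 2 (\<Phi> q))" and "g = (\<lambda>q. fibre_flux t W 3 (\<Phi> q))"
    \<comment> \<open>The radial and the angular component of the vertical flux.\<close>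
    have fg: "fib_re q * f q + fib_im q * g q = s * K (fst (snd q)) * inverse (P (S (fst q))) * (1 / 2 * u2 q)"
      "fib_re q * g q - fib_im q * f q = s * K (fst (snd q)) * inverse (P (S (fst q))) * u3 q" for q
      by (simp_all add: f_def g_def fibre_flux_def chart_rad_\<Phi> \<Phi>_nth u2_def u3_def w_def K_def s_def algebra_simps)
    have X1: "p * (pderiv_at 1 (chart_flux t W) (\<Phi> q) - tr_re q * pderiv_at 2 (chart_flux t W) (\<Phi> q) - tr_im q * pderiv_at 3 (chart_flux t W) (\<Phi> q))
      = (2 * k1 (S x) * p ^ 3 * u1 q + p\<^sup>2 * u11 q) * (1 / (2 * s) * inverse (K y ^ 3))"
    proof -
      have "dir_deriv dx (\<lambda>q. (P (S (fst q)) * P (S (fst q))) * u1 q * (1 / (2 * s) * inverse (K (fst (snd q)) ^ 3)))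
        (\<lambda>q. (2 * k1 (S (fst q)) * P (S (fst q)) ^ 3 * u1 q + (P (S (fst q)))\<^sup>2 * u11 q) * (1 / (2 * s) * inverse (K (fst (snd q)) ^ 3)))"
        by (rule dir_deriv_eq, (rule dir_deriv_mult dir_deriv_coord(1)[OF DERIV_PS] u11(1) dir_deriv_const
            dir_deriv_coord_const(2)[of "\<lambda>y. inverse (K y ^ 3)"])+)
          (simp add: algebra_simps power2_eq_square power3_eq_cube)
      then have "dir_deriv dx (\<lambda>q. chart_flux t W (\<Phi> q))
        (\<lambda>q. (2 * k1 (S (fst q)) * P (S (fst q)) ^ 3 * u1 q + (P (S (fst q)))\<^sup>2 * u11 q) * (1 / (2 * s) * inverse (K (fst (snd q)) ^ 3)))"
        by (simp only: F)
      from fun_cong[OF dir_deriv_unique[OF dir_deriv_\<Phi>(1)[of "chart_flux t W", OF div(1)] this], of q]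
      show ?thesis by (simp add: q_def p_def)
    qed
    define f2 f3 g2 g3 where "f2 = pderiv_at 2 (fibre_flux t W 2) (\<Phi> q)" and "f3 = pderiv_at 3 (fibre_flux t W 2) (\<Phi> q)"
      and "g2 = pderiv_at 2 (fibre_flux t W 3) (\<Phi> q)" and "g3 = pderiv_at 3 (fibre_flux t W 3) (\<Phi> q)"
    define a b where "a = fib_re q" and "b = fib_im q"
    note df = dir_deriv_\<Phi>[of "fibre_flux t W 2", OF div(2), folded f_def]
    note dg = dir_deriv_\<Phi>[of "fibre_flux t W 3", OF div(2), folded g_def]
    have X2: "2 * (a * f q + b * g q) + a * (2 * (a * f2 + b * f3)) + b * (2 * (a * g2 + b * g3))
      = s * inverse p * (1 / 2) * (K' y * u2 q + K y * u22 q)"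
    proof -
      have "dir_deriv dy (\<lambda>q. fib_re q * f q + fib_im q * g q)
        (\<lambda>q. (2 * fib_re q * f q + fib_re q * (2 * (fib_re q * pderiv_at 2 (fibre_flux t W 2) (\<Phi> q) + fib_im q * pderiv_at 3 (fibre_flux t W 2) (\<Phi> q))))
          + (2 * fib_im q * g q + fib_im q * (2 * (fib_re q * pderiv_at 2 (fibre_flux t W 3) (\<Phi> q) + fib_im q * pderiv_at 3 (fibre_flux t W 3) (\<Phi> q)))))"
        by (intro dir_deriv_add dir_deriv_mult dir_deriv_fib df(2) dg(2))
      moreover have "dir_deriv dy (\<lambda>q. s * K (fst (snd q)) * inverse (P (S (fst q))) * (1 / 2 * u2 q))
        (\<lambda>q. s * inverse (P (S (fst q))) * (1 / 2) * (K' (fst (snd q)) * u2 q + K (fst (snd q)) * u22 q))"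
        by (rule dir_deriv_eq, (rule dir_deriv_mult dir_deriv_const dir_deriv_coord(2)[OF dK] u22(1)
            dir_deriv_coord_const(3)[of "\<lambda>x. inverse (P (S x))"])+)
          (simp add: algebra_simps)
      ultimately have "(\<lambda>q. (2 * fib_re q * f q + fib_re q * (2 * (fib_re q * pderiv_at 2 (fibre_flux t W 2) (\<Phi> q) + fib_im q * pderiv_at 3 (fibre_flux t W 2) (\<Phi> q))))
          + (2 * fib_im q * g q + fib_im q * (2 * (fib_re q * pderiv_at 2 (fibre_flux t W 3) (\<Phi> q) + fib_im q * pderiv_at 3 (fibre_flux t W 3) (\<Phi> q)))))
        = (\<lambda>q. s * inverse (P (S (fst q))) * (1 / 2) * (K' (fst (snd q)) * u2 q + K (fst (snd q)) * u22 q))"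
        unfolding fg by (rule dir_deriv_unique)
      from fun_cong[OF this, of q] show ?thesis
        by (simp add: a_def b_def f2_def f3_def g2_def g3_def q_def p_def algebra_simps)
    qed
    have X3: "- (a * f q + b * g q) + a * (- b * g2 + a * g3) - b * (- b * f2 + a * f3) = s * inverse p * K y * u33 q"
    proof -
      have "dir_deriv dz (\<lambda>q. fib_re q * g q - fib_im q * f q)
        (\<lambda>q. ((- fib_im q) * g q + fib_re q * (- fib_im q * pderiv_at 2 (fibre_flux t W 3) (\<Phi> q) + fib_re q * pderiv_at 3 (fibre_flux t W 3) (\<Phi> q)))
          - (fib_re q * f q + fib_im q * (- fib_im q * pderiv_at 2 (fibre_flux t W 2) (\<Phi> q) + fib_re q * pderiv_at 3 (fibre_flux t W 2) (\<Phi> q))))"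
        by (intro dir_deriv_diff dir_deriv_mult dir_deriv_fib df(3) dg(3))
      moreover have "dir_deriv dz (\<lambda>q. s * K (fst (snd q)) * inverse (P (S (fst q))) * u3 q)
        (\<lambda>q. s * inverse (P (S (fst q))) * K (fst (snd q)) * u33 q)"
        by (rule dir_deriv_eq, (rule dir_deriv_mult dir_deriv_const u33(1) dir_deriv_coord_const(5)[of K]
            dir_deriv_coord_const(4)[of "\<lambda>x. inverse (P (S x))"])+)
          (simp add: algebra_simps)
      ultimately have "(\<lambda>q. ((- fib_im q) * g q + fib_re q * (- fib_im q * pderiv_at 2 (fibre_flux t W 3) (\<Phi> q) + fib_re q * pderiv_at 3 (fibre_flux t W 3) (\<Phi> q)))
          - (fib_re q * f q + fib_im q * (- fib_im q * pderiv_at 2 (fibre_flux t W 2) (\<Phi> q) + fib_re q * pderiv_at 3 (fibre_flux t W 2) (\<Phi> q))))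
        = (\<lambda>q. s * inverse (P (S (fst q))) * K (fst (snd q)) * u33 q)"
        unfolding fg by (rule dir_deriv_unique)
      from fun_cong[OF this, of q] show ?thesis
        by (simp add: a_def b_def f2_def f3_def g2_def g3_def q_def p_def algebra_simps)
    qed
    have ab: "a\<^sup>2 + b\<^sup>2 = exp (4 * y) / p\<^sup>2"
    proof -
      have "(exp (2 * y))\<^sup>2 = exp (4 * y)" by (simp add: power2_eq_square flip: exp_add)
      then show ?thesis using fib_norm[of q] by (simp add: a_def b_def q_def p_def power_divide)
    qed
    \<comment> \<open>The divergence in the fibre in polar coordinates: half of \<open>X2\<close>
      plus \<open>X3\<close>, where the terms in \<open>f3\<close> and \<open>g2\<close> cancel, as
      does the undifferentiated flux.\<close>
    have Y: "(a\<^sup>2 + b\<^sup>2) * (f2 + g3) = s * inverse p * (1 / 4 * (K' y * u2 q + K y * u22 q) + K y * u33 q)"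
    proof -
      have "(a\<^sup>2 + b\<^sup>2) * (f2 + g3) = 1 / 2 * (2 * (a * f q + b * g q) + a * (2 * (a * f2 + b * f3)) + b * (2 * (a * g2 + b * g3)))
        + (- (a * f q + b * g q) + a * (- b * g2 + a * g3) - b * (- b * f2 + a * f3))"
        by (simp add: algebra_simps power2_eq_square)
      also have "\<dots> = s * inverse p * (1 / 4 * (K' y * u2 q + K y * u22 q) + K y * u33 q)"
        unfolding X2 X3 by (simp add: algebra_simps)
      finally show ?thesis .
    qed
    have D: "(pderiv_at 1 (chart_flux t W) (\<Phi> q) - tr_re q * pderiv_at 2 (chart_flux t W) (\<Phi> q) - tr_im q * pderiv_at 3 (chart_flux t W) (\<Phi> q)
      - 2 * k1 (S x) * chart_flux t W (\<Phi> q)) + f2 + g3 = 0"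
      using div(3)[OF \<Phi>_in_domain, of q] by (simp add: chart_tr_\<Phi> \<Phi>_nth f2_def g3_def q_def)
    define L where "L = 1 / (2 * s) * inverse (K y ^ 3)"
    define Z where "Z = pderiv_at 1 (chart_flux t W) (\<Phi> q) - tr_re q * pderiv_at 2 (chart_flux t W) (\<Phi> q) - tr_im q * pderiv_at 3 (chart_flux t W) (\<Phi> q)"
    have C: "chart_flux t W (\<Phi> q) = p * p * u1 q * L"
      using F[of q] by (simp only: L_def p_def q_def fst_conv snd_conv)
    have X1': "p * Z = (2 * k1 (S x) * p ^ 3 * u1 q + p\<^sup>2 * u11 q) * L"
      using X1 by (simp only: L_def Z_def)
    have "p * (Z - 2 * k1 (S x) * chart_flux t W (\<Phi> q)) = p * Z - 2 * k1 (S x) * p * (p * p * u1 q * L)"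
      by (simp add: C algebra_simps)
    \<comment> \<open>The derivative of the weight \<open>P^2\<close> produces exactly the
      divergence of the horizontal field, so no first-order term in \<open>x\<close> is
      left.\<close>
    also have "\<dots> = p\<^sup>2 * u11 q * L"
      unfolding X1' by (simp add: algebra_simps power2_eq_square power3_eq_cube)
    finally have eq: "p * (Z - 2 * k1 (S x) * chart_flux t W (\<Phi> q)) = p\<^sup>2 * u11 q * L" .
    have "p\<^sup>2 * u11 q * L + p * (f2 + g3) = p * (Z - 2 * k1 (S x) * chart_flux t W (\<Phi> q)) + p * (f2 + g3)"
      by (simp only: eq)
    also have "\<dots> = p * ((Z - 2 * k1 (S x) * chart_flux t W (\<Phi> q)) + f2 + g3)"
      by (simp only: distrib_left add.assoc)
    also have "\<dots> = 0" by (simp only: D[folded Z_def] mult_zero_right)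
    finally have "p\<^sup>2 * u11 q * L + p * (f2 + g3) = 0" .
    then have "(a\<^sup>2 + b\<^sup>2) * (p\<^sup>2 * u11 q * L + p * (f2 + g3)) = 0" by simp
    then have "(a\<^sup>2 + b\<^sup>2) * p\<^sup>2 * u11 q * L + p * ((a\<^sup>2 + b\<^sup>2) * (f2 + g3)) = 0"
      by (simp only: distrib_left mult.assoc mult.left_commute[of "a\<^sup>2 + b\<^sup>2" p])
    moreover have "p * (s * inverse p * Q) = s * Q" for Q using p by simp
    moreover have "exp (4 * y) / p\<^sup>2 * p\<^sup>2 = exp (4 * y)" using p by simp
    ultimately have "exp (4 * y) * u11 q * L + s * (1 / 4 * (K' y * u2 q + K y * u22 q) + K y * u33 q) = 0"
      by (simp only: Y[unfolded ab] ab)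
    then have "(2 * s) * (exp (4 * y) * u11 q * L + s * (1 / 4 * (K' y * u2 q + K y * u22 q) + K y * u33 q)) = 0" by simp
    moreover have "(2 * s) * (exp (4 * y) * u11 q * L) = exp (4 * y) / K y ^ 3 * u11 q"
      using s Kp[of y] by (simp add: L_def field_simps)
    moreover have "(2 * s) * (s * (1 / 4 * (K' y * u2 q + K y * u22 q) + K y * u33 q)) = K' y * u2 q + K y * u22 q + 4 * K y * u33 q"
    proof -
      have "(2 * s) * (s * (1 / 4 * (K' y * u2 q + K y * u22 q) + K y * u33 q)) = 2 * (s * s) * (1 / 4 * (K' y * u2 q + K y * u22 q) + K y * u33 q)" by simp
      then show ?thesis unfolding s by simp
    qed
    ultimately have "exp (4 * y) / K y ^ 3 * u11 q + (K' y * u2 q + K y * u22 q + 4 * K y * u33 q) = 0"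
      by (simp only: distrib_left)
    then show ?thesis by (simp add: K'_def K_def q_def algebra_simps add_divide_distrib)
  qed
  show thesis by (rule that[OF jet pde])
qed

end

subsection \<open>Change of variables\<close>

abbreviation triple_of :: "real ^ 3 \<Rightarrow> real \<times> real \<times> real" where
  "triple_of v \<equiv> (v $ 1, v $ 2, v $ 3)"

text \<open>Iterated integrals are taken on the product of three lines, the change of variables on
  \<open>real ^ 3\<close>; the identification preserves boxes and their content.\<close>

lemma has_integral_triple_of:
  fixes f :: "real \<times> real \<times> real \<Rightarrow> real"
  assumes "(f has_integral I) (cbox (a1, a2, a3) (b1, b2, b3))"
  shows "((\<lambda>v. f (triple_of v)) has_integral I) (cbox (vector [a1, a2, a3]) (vector [b1, b2, b3]))"
proof -
  define h :: "real \<times> real \<times> real \<Rightarrow> real ^ 3" where "h = (\<lambda>(x, y, z). vector [x, y, z])"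
  have hg: "h (triple_of v) = v" for v by (simp add: h_def vec_eq_iff forall_3)
  have gh: "triple_of (h x) = x" for x by (cases x) (simp add: h_def)
  have mem: "v \<in> cbox a b \<longleftrightarrow> triple_of v \<in> cbox (triple_of a) (triple_of b)" for v a b :: "real ^ 3"
    by (auto simp: mem_box_cart forall_3)
  have g: "triple_of ` cbox u v = cbox (triple_of u) (triple_of v)" for u v :: "real ^ 3"
  proof (intro equalityI subsetI)
    fix x assume "x \<in> cbox (triple_of u) (triple_of v)"
    then have "h x \<in> cbox u v" unfolding mem gh by simp
    then show "x \<in> triple_of ` cbox u v" using gh by (metis (no_types, lifting) imageI)
  qed (auto simp: mem_box_cart forall_3)
  have h: "h ` cbox u v = cbox (h u) (h v)" for u v
  proof (intro equalityI subsetI)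
    fix x assume "x \<in> cbox (h u) (h v)"
    then have "triple_of x \<in> cbox u v" unfolding mem[of x "h u" "h v"] gh .
    then show "x \<in> h ` cbox u v" using hg by (metis (no_types, lifting) imageI)
  next
    fix x assume "x \<in> h ` cbox u v"
    then show "x \<in> cbox (h u) (h v)" unfolding mem[of x "h u" "h v"] gh by (auto simp: gh)
  qed
  have r: "Henstock_Kurzweil_Integration.content (triple_of ` cbox u v) = 1 * Henstock_Kurzweil_Integration.content (cbox u v)" for u v :: "real ^ 3"
  proof (cases "cbox u v = {}")
    case False
    then obtain w where "w \<in> cbox u v" by blast
    then have le: "u $ i \<le> v $ i" for i unfolding mem_box_cart by (meson order_trans)
    have p3: "prod f (UNIV :: 3 set) = f 1 * f 2 * f 3" for f :: "3 \<Rightarrow> real"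
      unfolding UNIV_3 by (simp add: mult.assoc)
    show ?thesis
      unfolding g using le content_cbox_cart[OF False] by (simp add: p3 content_Pair content_real)
  qed simp
  have cg: "continuous (at x) (\<lambda>v :: real ^ 3. triple_of v)" for x
    by (intro continuous_intros continuous_component)
  have "((\<lambda>v. f (triple_of v)) has_integral (1 / 1) *\<^sub>R I) (h ` cbox (a1, a2, a3) (b1, b2, b3))"
    by (rule has_integral_twiddle[OF zero_less_one hg gh cg _ _ r assms]) (use g h in blast)+
  then show ?thesis unfolding h by (simp add: h_def)
qed

text \<open>The integrand is embedded in \<open>real ^ 1\<close>, and the single component of the
  vector-valued formula is read off.\<close>

lemma has_integral_change_of_variables_real:
  fixes f :: "real ^ 'm::{finite,wellorder} \<Rightarrow> real" and g :: "real ^ 'm::_ \<Rightarrow> real ^ 'm::_"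
  assumes S: "S \<in> sets lebesgue"
    and der: "\<And>x. x \<in> S \<Longrightarrow> (g has_derivative g' x) (at x within S)"
    and inj: "inj_on g S"
    and h: "(\<lambda>x. \<bar>det (matrix (g' x))\<bar> * f (g x)) absolutely_integrable_on S"
  shows "(f has_integral integral S (\<lambda>x. \<bar>det (matrix (g' x))\<bar> * f (g x))) (g ` S)"
proof -
  define F where "F = (\<lambda>y. f y *\<^sub>R (1 :: real ^ 1))"
  let ?h = "\<lambda>x. \<bar>det (matrix (g' x))\<bar> * f (g x)"
  have bl: "bounded_linear (\<lambda>x. x *\<^sub>R (1 :: real ^ 1))" by (rule bounded_linear_scaleR_left)
  have ai: "(\<lambda>x. \<bar>det (matrix (g' x))\<bar> *\<^sub>R F (g x)) absolutely_integrable_on S"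
    using absolutely_integrable_linear[OF h bl] by (simp add: o_def F_def)
  define b where "b = integral S (\<lambda>x. \<bar>det (matrix (g' x))\<bar> *\<^sub>R F (g x))"
  from ai have "F absolutely_integrable_on (g ` S) \<and> integral (g ` S) F = b"
    using has_absolute_integral_change_of_variables[OF S der inj, of F b] by (simp add: b_def)
  then have "(F has_integral b) (g ` S)"
    by (metis absolutely_integrable_on_def integrable_integral)
  from has_integral_linear[OF this bounded_linear_vec_nth[of 1]]
  have "(f has_integral b $ 1) (g ` S)" by (simp add: o_def F_def)
  moreover have "b $ 1 = integral S ?h"
  proof -
    have "?h integrable_on S" using h by (simp add: absolutely_integrable_on_def)
    from integral_linear[OF this bl]
    have "integral S (\<lambda>x. ?h x *\<^sub>R (1 :: real ^ 1)) = integral S ?h *\<^sub>R 1" by (simp only: o_def)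
    then show ?thesis by (simp add: b_def F_def)
  qed
  ultimately show ?thesis by simp
qed

context curve_chart
begin

lemma S_strict_mono: "strict_mono S"
  by (rule strict_monoI) (rule DERIV_pos_imp_increasing, assumption, use S one_add_cmod2_pos in blast)

lemma \<Phi>_inj:
  assumes "\<Phi> (x, y, z) = \<Phi> (x', y', z')" "\<bar>z - z'\<bar> < 2 * pi"
  shows "x = x' \<and> y = y' \<and> z = z'"
proof -
  have "S x = S x'" using arg_cong[OF assms(1), of "\<lambda>v. v $ 1"] by (simp add: \<Phi>_nth)
  then have x: "x = x'" using S_strict_mono by (simp add: strict_mono_eq)
  have f: "fib_re (x, y, z) = fib_re (x, y', z')" "fib_im (x, y, z) = fib_im (x, y', z')"
    using arg_cong[OF assms(1), of "\<lambda>v. v $ 2"] arg_cong[OF assms(1), of "\<lambda>v. v $ 3"] by (simp_all add: \<Phi>_nth x)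
  have P: "0 < P (S x)" by (rule P_pos)
  have "(exp (2 * y) / P (S x))\<^sup>2 = (exp (2 * y') / P (S x))\<^sup>2"
    using fib_norm[of "(x, y, z)"] fib_norm[of "(x, y', z')"] f by simp
  then have "exp (2 * y) / P (S x) = exp (2 * y') / P (S x)"
    by (rule power2_eq_imp_eq) (use P in simp_all)
  then have y: "y = y'" using P by simp
  have "cos (z - \<theta> x) = cos (z' - \<theta> x)" "sin (z - \<theta> x) = sin (z' - \<theta> x)"
    using f P y by (simp_all add: fib_re_def fib_im_def)
  then obtain n :: int where n: "z - \<theta> x = z' - \<theta> x + 2 * pi * of_int n"
    using sin_cos_eq_iff by metis
  then have "\<bar>2 * pi * of_int n\<bar> < 2 * pi * 1" using assms(2) by simp
  then have "\<bar>real_of_int n\<bar> < 1" by (simp add: abs_mult)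
  then have "n = 0" by linarith
  then show ?thesis using x y n by simp
qed

lemma has_derivative_\<Phi>:
  "((\<lambda>v. \<Phi> (triple_of v)) has_derivative (\<lambda>h. (P (S (v $ 1)) * h $ 1) *\<^sub>R axis 1 1
    + (- (P (S (v $ 1)) * tr_re (triple_of v)) * h $ 1 + 2 * fib_re (triple_of v) * h $ 2 - fib_im (triple_of v) * h $ 3) *\<^sub>R axis 2 1
    + (- (P (S (v $ 1)) * tr_im (triple_of v)) * h $ 1 + 2 * fib_im (triple_of v) * h $ 2 + fib_re (triple_of v) * h $ 3) *\<^sub>R axis 3 1)) (at v)"
proof -
  have nth: "((\<lambda>v :: real ^ 3. v $ i) has_derivative (\<lambda>h. h $ i)) (at v)" for i v
    by (rule bounded_linear_imp_has_derivative[OF bounded_linear_vec_nth])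
  have dS: "((\<lambda>v :: real ^ 3. S (v $ 1)) has_derivative (\<lambda>h. P (S (v $ 1)) * h $ 1)) (at v)"
    using has_derivative_compose[OF nth[of 1 v] S[folded P_def, unfolded has_field_derivative_def]] .
  have dT: "((\<lambda>v :: real ^ 3. \<theta> (v $ 1)) has_derivative (\<lambda>h. P (S (v $ 1)) * k2 (S (v $ 1)) * h $ 1)) (at v)"
    using has_derivative_compose[OF nth[of 1 v] DERIV_\<theta>[unfolded has_field_derivative_def]] .
  have dI: "((\<lambda>v :: real ^ 3. 1 / P (S (v $ 1))) has_derivative (\<lambda>h. - k1 (S (v $ 1)) * h $ 1)) (at v)"
    using has_derivative_compose[OF nth[of 1 v] DERIV_inv_PS[unfolded has_field_derivative_def]] .
  have dE: "((\<lambda>v :: real ^ 3. exp (2 * v $ 2)) has_derivative (\<lambda>h. exp (2 * v $ 2) * (2 * h $ 2))) (at v)"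
    by (rule has_derivative_eq_rhs[OF has_derivative_exp[OF has_derivative_mult_right[OF nth]]]) (simp add: fun_eq_iff mult.commute)
  define \<phi> where "\<phi> v = v $ 3 - \<theta> (v $ 1)" for v :: "real ^ 3"
  have d\<phi>: "(\<phi> has_derivative (\<lambda>h. h $ 3 - P (S (v $ 1)) * k2 (S (v $ 1)) * h $ 1)) (at v)"
    unfolding \<phi>_def by (rule has_derivative_diff[OF nth dT])
  have dc: "((\<lambda>v. cos (\<phi> v)) has_derivative (\<lambda>h. - sin (\<phi> v) * (h $ 3 - P (S (v $ 1)) * k2 (S (v $ 1)) * h $ 1))) (at v)"
    and ds: "((\<lambda>v. sin (\<phi> v)) has_derivative (\<lambda>h. cos (\<phi> v) * (h $ 3 - P (S (v $ 1)) * k2 (S (v $ 1)) * h $ 1))) (at v)"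
    using has_derivative_compose[OF d\<phi> DERIV_cos[unfolded has_field_derivative_def]]
      has_derivative_compose[OF d\<phi> DERIV_sin[unfolded has_field_derivative_def]] .
  have P0: "P (S x) \<noteq> 0" for x using P_pos[of "S x"] by simp
  have re: "fib_re (triple_of v) = exp (2 * v $ 2) * cos (\<phi> v) * (1 / P (S (v $ 1)))"
    and im: "fib_im (triple_of v) = exp (2 * v $ 2) * sin (\<phi> v) * (1 / P (S (v $ 1)))" for v
    by (simp_all add: fib_re_def fib_im_def \<phi>_def)
  have "((\<lambda>v. fib_re (triple_of v)) has_derivative (\<lambda>h. - (P (S (v $ 1)) * tr_re (triple_of v)) * h $ 1 + 2 * fib_re (triple_of v) * h $ 2 - fib_im (triple_of v) * h $ 3)) (at v)"
    unfolding tr_re_def re im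
    by (rule has_derivative_eq_rhs[OF has_derivative_mult[OF has_derivative_mult[OF dE dc] dI]])
      (auto simp: fun_eq_iff algebra_simps P0)
  moreover have "((\<lambda>v. fib_im (triple_of v)) has_derivative (\<lambda>h. - (P (S (v $ 1)) * tr_im (triple_of v)) * h $ 1 + 2 * fib_im (triple_of v) * h $ 2 + fib_re (triple_of v) * h $ 3)) (at v)"
    unfolding tr_im_def re im
    by (rule has_derivative_eq_rhs[OF has_derivative_mult[OF has_derivative_mult[OF dE ds] dI]])
      (auto simp: fun_eq_iff algebra_simps P0)
  ultimately show ?thesis
    unfolding \<Phi>_def fst_conv by (intro has_derivative_add has_derivative_scaleR_left dS)
qed

text \<open>The Jacobian of \<open>\<Phi>\<close> is \<open>2 * exp (4 * y) / P\<close>, and the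
  volume density along it is \<open>P / (sqrt 2 * k)\<close>; in the product \<open>P\<close>
  cancels. The inequality reflects that the image of the slab is only the part of the strip with
  \<open>y\<close> between \<open>y0\<close> and \<open>y1\<close>.\<close>

lemma slab_integral_le:
  fixes W :: "real ^ 3 \<Rightarrow> real" and p t x0 y0 y1 z0 :: real
  assumes p: "1 \<le> p" and W: "continuous_on fibre_domain W"
  shows "ennreal (integral (cbox (x0, y0, z0) (x0 + 1, y1, z0 + 2 * pi))
      (\<lambda>q. \<bar>W (\<Phi> q)\<bar> powr p * (sqrt 2 * exp (4 * fst (snd q)) / cone_rad t (fst (snd q)))))
    \<le> (\<integral>\<^sup>+ y. ennreal (\<bar>W y\<bar> powr p * vol_density (hyp_metric c t) y) *
        indicator {y \<in> fibre_domain. S x0 \<le> y $ 1 \<and> y $ 1 \<le> S (x0 + 1)} y \<partial>lborel)"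
proof -
  define g where "g = (\<lambda>q. \<bar>W (\<Phi> q)\<bar> powr p * (sqrt 2 * exp (4 * fst (snd q)) / cone_rad t (fst (snd q))))"
  define f where "f y = \<bar>W y\<bar> powr p * vol_density (hyp_metric c t) y" for y
  define D where "D v = (\<lambda>h :: real ^ 3. (P (S (v $ 1)) * h $ 1) *\<^sub>R axis 1 1
    + (- (P (S (v $ 1)) * tr_re (triple_of v)) * h $ 1 + 2 * fib_re (triple_of v) * h $ 2 - fib_im (triple_of v) * h $ 3) *\<^sub>R axis 2 1
    + (- (P (S (v $ 1)) * tr_im (triple_of v)) * h $ 1 + 2 * fib_im (triple_of v) * h $ 2 + fib_re (triple_of v) * h $ 3) *\<^sub>R (axis 3 1 :: real ^ 3))"
    for v :: "real ^ 3"
  let ?a = "vector [x0, y0, z0] :: real ^ 3" and ?b = "vector [x0 + 1, y1, z0 + 2 * pi] :: real ^ 3"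
  have cK: "continuous_on UNIV (cone_rad t)" by (rule DERIV_imp_continuous, rule DERIV_cone_rad)
  have K0: "cone_rad t y \<noteq> 0" for y using cone_rad_pos[of t y] by simp
  have cW: "continuous_on UNIV (\<lambda>q. W (\<Phi> q))"
    by (rule continuous_on_compose2[OF W cont_\<Phi>]) (use \<Phi>_in_domain in auto)
  have cg: "continuous_on UNIV g"
    unfolding g_def using p by (intro continuous_intros continuous_on_powr' cW cont_coord(1)[OF cK] ballI K0) auto
  have det: "\<bar>det (matrix (D v))\<bar> * f (\<Phi> (triple_of v)) = g (triple_of v)" for v
  proof -
    define q where "q = triple_of v"
    define pp where "pp = P (S (v $ 1))"
    have pp: "0 < pp" unfolding pp_def by (rule P_pos)
    \<comment> \<open>The matrix is block triangular. Its fibre block is spanned by twice the radial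
      and the rotated fibre vector, and so has twice the squared modulus as determinant.\<close>
    have "det (matrix (D v)) = pp * (2 * ((fib_re q)\<^sup>2 + (fib_im q)\<^sup>2))"
      by (simp add: det_3 matrix_def D_def axis_def pp_def q_def algebra_simps power2_eq_square)
    also have "\<dots> = 2 * exp (4 * v $ 2) / pp"
    proof -
      have "(exp (2 * v $ 2))\<^sup>2 = exp (4 * v $ 2)" by (simp add: power2_eq_square flip: exp_add)
      then show ?thesis using pp by (simp add: fib_norm q_def pp_def[symmetric] power_divide) (simp add: power2_eq_square)
    qed
    finally have d: "\<bar>det (matrix (D v))\<bar> = 2 * exp (4 * v $ 2) / pp" using pp by simp
    have vol: "vol_density (hyp_metric c t) (\<Phi> q) = pp / (sqrt 2 * cone_rad t (v $ 2))"
      by (simp add: vol_density_chart[OF \<Phi>_in_domain] chart_rad_\<Phi> \<Phi>_nth q_def pp_def)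
    have "2 * exp (4 * v $ 2) / pp * (pp / (sqrt 2 * cone_rad t (v $ 2))) = sqrt 2 * exp (4 * v $ 2) / cone_rad t (v $ 2)"
    proof -
      have "2 * exp (4 * v $ 2) / pp * (pp / (sqrt 2 * cone_rad t (v $ 2))) = (2 / sqrt 2) * exp (4 * v $ 2) / cone_rad t (v $ 2)"
        using pp K0[of "v $ 2"] by (simp add: field_simps)
      then show ?thesis by (simp add: real_div_sqrt)
    qed
    then have "2 * exp (4 * v $ 2) / pp * (w * (pp / (sqrt 2 * cone_rad t (v $ 2)))) = w * (sqrt 2 * exp (4 * v $ 2) / cone_rad t (v $ 2))" for w
      by (simp only: mult.left_commute[of _ w])
    then show ?thesis
      unfolding d f_def q_def[symmetric] vol by (simp only: g_def q_def fst_conv snd_conv)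
  qed
  have c3: "continuous_on UNIV (\<lambda>v. g (triple_of v))"
    by (rule continuous_on_compose2[OF cg]) (auto intro!: continuous_intros)
  \<comment> \<open>The open box is used because \<open>\<Phi>\<close> is injective only on
    \<open>z\<close>-intervals that do not contain two points at distance
    \<open>2 * pi\<close>.\<close>
  have ai: "(\<lambda>v. \<bar>det (matrix (D v))\<bar> * f (\<Phi> (triple_of v))) absolutely_integrable_on box ?a ?b"
    unfolding det
    by (rule set_integrable_subset[OF absolutely_integrable_continuous[OF continuous_on_subset[OF c3 subset_UNIV]] _ box_subset_cbox]) simp
  have inj: "inj_on (\<lambda>v. \<Phi> (triple_of v)) (box ?a ?b)"
  proof (rule inj_onI)
    fix v v' assume v: "v \<in> box ?a ?b" "v' \<in> box ?a ?b" and eq: "\<Phi> (triple_of v) = \<Phi> (triple_of v')"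
    have "\<bar>v $ 3 - v' $ 3\<bar> < 2 * pi" using v by (auto simp: mem_box_cart forall_3)
    from \<Phi>_inj[OF eq this] show "v = v'" by (simp add: vec_eq_iff forall_3)
  qed
  have "(f has_integral integral (box ?a ?b) (\<lambda>v. \<bar>det (matrix (D v))\<bar> * f (\<Phi> (triple_of v)))) ((\<lambda>v. \<Phi> (triple_of v)) ` box ?a ?b)"
  proof (rule has_integral_change_of_variables_real[OF _ _ inj ai])
    show "((\<lambda>v. \<Phi> (triple_of v)) has_derivative D v) (at v within box ?a ?b)" for v
      unfolding D_def by (rule has_derivative_at_withinI[OF has_derivative_\<Phi>])
  qed simp
  moreover have "integral (box ?a ?b) (\<lambda>v. \<bar>det (matrix (D v))\<bar> * f (\<Phi> (triple_of v))) = integral (cbox (x0, y0, z0) (x0 + 1, y1, z0 + 2 * pi)) g"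
    unfolding det integral_open_interval
    by (rule integral_unique[OF has_integral_triple_of[OF integrable_integral[OF integrable_cbox_continuous[OF cg]]]])
  ultimately have hi: "(f has_integral integral (cbox (x0, y0, z0) (x0 + 1, y1, z0 + 2 * pi)) g) ((\<lambda>v. \<Phi> (triple_of v)) ` box ?a ?b)" by simp
  have f0: "0 \<le> f y" if "y \<in> (\<lambda>v. \<Phi> (triple_of v)) ` box ?a ?b" for y
  proof -
    have "y \<in> fibre_domain" using that \<Phi>_in_domain by auto
    then show ?thesis using chart_rad_pos[of y t] P_pos[of "y $ 1"] by (simp add: f_def vol_density_chart)
  qed
  have "ennreal (integral (cbox (x0, y0, z0) (x0 + 1, y1, z0 + 2 * pi)) g)
      = (\<integral>\<^sup>+ y. ennreal (f y) * indicator ((\<lambda>v. \<Phi> (triple_of v)) ` box ?a ?b) y \<partial>lborel)"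
    by (rule nn_integral_has_integral_lebesgue'[OF f0 hi, symmetric])
  also have "\<dots> \<le> (\<integral>\<^sup>+ y. ennreal (f y) * indicator {y \<in> fibre_domain. S x0 \<le> y $ 1 \<and> y $ 1 \<le> S (x0 + 1)} y \<partial>lborel)"
  proof (intro nn_integral_mono mult_left_mono)
    have "y \<in> fibre_domain \<and> S x0 \<le> y $ 1 \<and> y $ 1 \<le> S (x0 + 1)" if y: "y \<in> (\<lambda>v. \<Phi> (triple_of v)) ` box ?a ?b" for y
    proof -
      obtain v where v: "v \<in> box ?a ?b" "y = \<Phi> (triple_of v)" using y by blast
      then have "x0 \<le> v $ 1" "v $ 1 \<le> x0 + 1" by (auto simp: mem_box_cart forall_3)
      then show ?thesis using v \<Phi>_in_domain S_strict_mono by (simp add: \<Phi>_nth strict_mono_less_eq)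
    qed
    then show "indicator ((\<lambda>v. \<Phi> (triple_of v)) ` box ?a ?b) y \<le> (indicator {y \<in> fibre_domain. S x0 \<le> y $ 1 \<and> y $ 1 \<le> S (x0 + 1)} y :: ennreal)" for y
      by (auto simp: indicator_def)
  qed simp
  finally show ?thesis by (simp add: g_def f_def)
qed

text \<open>Surjectivity of \<open>S\<close> supplies \<open>x\<close>; the modulus of the fibre
  coordinate then determines \<open>y\<close>, and its argument, corrected by
  \<open>\<theta>\<close>, gives \<open>z\<close>.\<close>

lemma \<Phi>_surj:
  assumes "surj S" "y \<in> fibre_domain"
  shows "\<exists>q. \<Phi> q = y"
proof -
  obtain x where x: "S x = y $ 1" using assms(1) by (metis surjD)
  define \<gamma> where "\<gamma> = fibre_coord y"
  have \<gamma>: "0 < cmod \<gamma>" using assms(2) by (simp add: \<gamma>_def fibre_domain_def)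
  have P: "0 < P (S x)" by (rule P_pos)
  define q where "q = (x, ln (cmod \<gamma> * P (S x)) / 2, Arg \<gamma> + \<theta> x)"
  have e: "exp (2 * fst (snd q)) = cmod \<gamma> * P (S x)" using \<gamma> P by (simp add: q_def)
  have "Re \<gamma> = cmod \<gamma> * cos (Arg \<gamma>)" "Im \<gamma> = cmod \<gamma> * sin (Arg \<gamma>)"
    using rcis_cmod_Arg[of \<gamma>] by (metis Re_rcis, metis Im_rcis)
  then have "fib_re q = Re \<gamma>" "fib_im q = Im \<gamma>"
    unfolding fib_re_def fib_im_def e using P by (simp_all add: q_def)
  then have "\<Phi> q = y"
    by (simp add: vec_eq_iff forall_3 \<Phi>_nth x q_def[symmetric]) (simp add: q_def x \<gamma>_def fibre_coord_def)
  then show ?thesis ..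
qed

end

subsection \<open>Parametrization by spherical arc length\<close>

lemma antiderivative_real:
  fixes f :: "real \<Rightarrow> real"
  assumes "continuous_on UNIV f"
  obtains F where "\<And>x. (F has_real_derivative f x) (at x)"
proof -
  have "\<exists>F. \<forall>x :: real. - \<infinity> < ereal x \<longrightarrow> ereal x < \<infinity> \<longrightarrow> (F has_vector_derivative f x) (at x)"
    by (rule einterval_antiderivative) (use assms in \<open>auto simp: continuous_on_eq_continuous_at\<close>)
  then show thesis using that by (auto simp: has_real_derivative_iff_has_vector_derivative)
qed

lemma periodic_int_multiple:
  fixes f :: "real \<Rightarrow> 'a"
  assumes "\<And>s. f (s + T) = f s"
  shows "f (s + of_int j * T) = f s"
proof (induction j rule: int_induct[where k=0])
  case (step1 i)
  then show ?case using assms[of "s + of_int i * T"] by (simp add: algebra_simps)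
next
  case (step2 i)
  then show ?case using assms[of "s + of_int (i - 1) * T"] by (simp add: algebra_simps)
qed simp

lemma periodic_continuous_bounded:
  fixes f :: "real \<Rightarrow> real"
  assumes "continuous_on UNIV f" "\<And>s. f (s + T) = f s" "0 < T"
  obtains M where "0 < M" "\<And>s. f s \<le> M"
proof -
  have "compact (f ` {0..T})" by (intro compact_continuous_image continuous_on_subset[OF assms(1)]) auto
  then obtain M where M: "\<And>y. y \<in> f ` {0..T} \<Longrightarrow> \<bar>y\<bar> \<le> M"
    by (metis compact_imp_bounded bounded_iff real_norm_def)
  have "f s \<le> \<bar>M\<bar> + 1" for s
  proof -
    define s' where "s' = s + of_int (- \<lfloor>s / T\<rfloor>) * T"
    have "s' = T * frac (s / T)" using assms(3) by (simp add: s'_def frac_def algebra_simps)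
    then have "s' \<in> {0..T}" using assms(3) frac_lt_1[of "s / T"] by (simp add: mult_left_le)
    then have "\<bar>f s'\<bar> \<le> M" using M by blast
    moreover have "f s' = f s" unfolding s'_def by (rule periodic_int_multiple[of f T]) (rule assms(2))
    ultimately show ?thesis by linarith
  qed
  then show thesis by (intro that[of "\<bar>M\<bar> + 1"]) auto
qed

text \<open>On a closed curve the spherical speed is bounded below by a positive constant. Closed
  and open curves can then be treated together on the unrolled line.\<close>

lemma periodic_imp_spherically_complete:
  assumes c: "continuous_on UNIV c" and per: "\<And>s. c (s + T) = c s" "0 < T"
  shows "spherically_complete c"
proof -
  have "continuous_on UNIV (\<lambda>s. 1 + (cmod (c s))\<^sup>2)" by (intro continuous_intros c)
  then obtain M where M: "0 < M" "\<And>s. 1 + (cmod (c s))\<^sup>2 \<le> M"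
    using periodic_continuous_bounded[of "\<lambda>s. 1 + (cmod (c s))\<^sup>2" T] per by (metis (no_types, lifting))
  let ?f = "\<lambda>s. 1 / (1 + (cmod (c s))\<^sup>2)"
  have nz: "1 + (cmod (c s))\<^sup>2 \<noteq> 0" for s using one_add_cmod2_pos[of "c s"] by simp
  have int: "?f integrable_on {a..b}" for a b
    by (intro integrable_continuous_interval continuous_intros continuous_on_subset[OF c] ballI nz) auto
  have ge: "(b - a) / M \<le> integral {a..b} ?f" if "a \<le> b" for a b
  proof -
    have "integral {a..b} (\<lambda>s. 1 / M) \<le> integral {a..b} ?f"
      by (intro integral_le int) (use M one_add_cmod2_pos in \<open>auto intro!: divide_left_mono\<close>)
    then show ?thesis using that by simp
  qed
  have ge': "r / M \<le> integral {- r..0} ?f" if "0 \<le> r" for r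
    using ge[of "- r" 0] that by simp
  have lim: "filterlim (\<lambda>r. r / M) at_top at_top"
    using M(1) filterlim_tendsto_pos_mult_at_top[OF tendsto_const, of "1 / M" "\<lambda>r. r" at_top]
    by (simp add: filterlim_ident)
  show ?thesis unfolding spherically_complete_def
    by (intro conjI filterlim_at_top_mono[OF lim] eventually_mono[OF eventually_ge_at_top[of 0]])
      (use ge[of 0] ge' in auto)
qed

text \<open>The divergence of both integrals makes the spherical arc length onto the real line, so
  its inverse is defined everywhere.\<close>

lemma spherical_arc_length_inverse:
  assumes c: "continuous_on UNIV c" and sc: "spherically_complete c"
  obtains S where "\<And>x. (S has_real_derivative 1 + (cmod (c (S x)))\<^sup>2) (at x)" "surj S"
proof -
  let ?f = "\<lambda>s. 1 / (1 + (cmod (c s))\<^sup>2)"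
  have pos: "0 < 1 + (cmod (c s))\<^sup>2" for s by (rule one_add_cmod2_pos)
  have nz: "1 + (cmod (c s))\<^sup>2 \<noteq> 0" for s using pos[of s] by simp
  have "continuous_on UNIV ?f" by (intro continuous_intros c ballI nz)
  then obtain \<sigma> where \<sigma>: "\<And>s. (\<sigma> has_real_derivative ?f s) (at s)" by (rule antiderivative_real) blast
  have mono: "strict_mono \<sigma>"
    by (rule strict_monoI) (rule DERIV_pos_imp_increasing, assumption, use \<sigma> pos in \<open>meson zero_less_divide_1_iff\<close>)
  have cont: "continuous_on S \<sigma>" for S by (rule DERIV_imp_continuous, rule \<sigma>)
  have ftc: "integral {a..b} ?f = \<sigma> b - \<sigma> a" if "a \<le> b" for a b
    by (rule integral_unique, rule fundamental_theorem_of_calculus[OF that])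
      (use \<sigma> in \<open>auto simp: has_real_derivative_iff_has_vector_derivative[symmetric] intro: DERIV_subset\<close>)
  have "surj \<sigma>"
  proof (unfold surj_def, intro allI)
    fix y
    have "eventually (\<lambda>r. y - \<sigma> 0 \<le> integral {0..r} ?f) at_top" "eventually (\<lambda>r. \<sigma> 0 - y \<le> integral {-r..0} ?f) at_top"
      using sc unfolding spherically_complete_def filterlim_at_top by blast+
    then have "eventually (\<lambda>r. 0 \<le> r \<and> y - \<sigma> 0 \<le> integral {0..r} ?f \<and> \<sigma> 0 - y \<le> integral {-r..0} ?f) at_top"
      by (intro eventually_conj eventually_ge_at_top)
    then obtain r where r: "0 \<le> r" "y - \<sigma> 0 \<le> integral {0..r} ?f" "\<sigma> 0 - y \<le> integral {-r..0} ?f"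
      by (auto simp: eventually_at_top_linorder)
    then have "\<sigma> (-r) \<le> y" "y \<le> \<sigma> r" using ftc[of 0 r] ftc[of "-r" 0] by auto
    then show "\<exists>x. y = \<sigma> x" using IVT'[of \<sigma> "-r" y r] cont r(1) by auto
  qed
  define S where "S = inv \<sigma>"
  have \<sigma>S: "\<sigma> (S x) = x" for x using \<open>surj \<sigma>\<close> by (simp add: S_def surj_f_inv_f)
  have S\<sigma>: "S (\<sigma> s) = s" for s using mono by (simp add: S_def strict_mono_imp_inj_on inv_f_f)
  have contS: "isCont S x" for x
    using isCont_inverse_function[of 1 "S x" S \<sigma>] S\<sigma> \<sigma> DERIV_isCont by (metis \<sigma>S zero_less_one)
  have "(S has_real_derivative inverse (?f (S x))) (at x)" for x
    by (rule DERIV_inverse_function[where f=\<sigma> and g=S and a="x - 1" and b="x + 1"]) (use \<sigma> nz \<sigma>S contS in auto)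
  then have "(S has_real_derivative 1 + (cmod (c (S x)))\<^sup>2) (at x)" for x by simp
  moreover have "surj S" using S\<sigma> by (metis surjI)
  ultimately show thesis by (rule that)
qed

lemma nn_integral_lborel_translate:
  fixes f :: "'a::euclidean_space \<Rightarrow> ennreal"
  assumes "f \<in> borel_measurable borel"
  shows "(\<integral>\<^sup>+ x. f (a + x) \<partial>lborel) = (\<integral>\<^sup>+ x. f x \<partial>lborel)"
proof -
  have "(\<integral>\<^sup>+ x. f x \<partial>lborel) = (\<integral>\<^sup>+ x. f x \<partial>distr lborel borel ((+) a))" by (simp add: lborel_distr_plus)
  also have "\<dots> = (\<integral>\<^sup>+ x. f (a + x) \<partial>lborel)" by (rule nn_integral_distr) (use assms in simp_all)
  finally show ?thesis by simp
qed

text \<open>A strip of bounded width meets boundedly many periods.\<close>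

lemma periodic_strip_bound:
  fixes g :: "real ^ 3 \<Rightarrow> ennreal"
  assumes meas: "g \<in> borel_measurable borel" and per: "\<And>y. g (T *\<^sub>R axis 1 1 + y) = g y" and T: "0 < T"
    and len: "b - a \<le> real N * T"
  shows "(\<integral>\<^sup>+ y. g y * indicator {y. a \<le> y $ 1 \<and> y $ 1 \<le> b} y \<partial>lborel)
    \<le> of_nat (N + 1) * (\<integral>\<^sup>+ y. g y * indicator {y. y $ 1 \<in> {0..<T}} y \<partial>lborel)"
proof -
  define J where "J j = (\<integral>\<^sup>+ y. g y * indicator {y. of_int j * T \<le> y $ 1 \<and> y $ 1 < of_int (j + 1) * T} y \<partial>lborel)" for j :: int
  have ms: "{y :: real ^ 3. r \<le> y $ 1 \<and> y $ 1 < s} \<in> sets borel" for r s by measurable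
  have mg: "(\<lambda>y. g y * indicator {y. r \<le> y $ 1 \<and> y $ 1 < s} y) \<in> borel_measurable borel" for r s
    by (intro borel_measurable_times_ennreal meas borel_measurable_indicator ms)
  have step: "J (j + 1) = J j" for j
  proof -
    let ?f = "\<lambda>y. g y * indicator {y. of_int (j + 1) * T \<le> y $ 1 \<and> y $ 1 < of_int (j + 1 + 1) * T} y"
    have "J (j + 1) = (\<integral>\<^sup>+ y. ?f (T *\<^sub>R axis 1 1 + y) \<partial>lborel)"
      unfolding J_def by (rule nn_integral_lborel_translate[symmetric]) (rule mg)
    also have "\<dots> = J j"
      unfolding J_def per by (intro nn_integral_cong) (auto simp: indicator_def axis_def algebra_simps)
    finally show ?thesis .
  qed
  have J0: "J j = J 0" for j
  proof (induction j rule: int_induct[where k=0])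
    case (step1 i) then show ?case using step[of i] by simp
  next
    case (step2 i) then show ?case using step[of "i - 1"] by simp
  qed simp
  \<comment> \<open>\<open>i\<close> is the cell containing \<open>a\<close>. A strip of length at
    most \<open>N * T\<close> ends in the cell \<open>i + N\<close> at the latest, whence
    \<open>N + 1\<close> cells.\<close>
  define i where "i = \<lfloor>a / T\<rfloor>"
  have i: "of_int i * T \<le> a" "a < of_int (i + 1) * T"
  proof -
    have "of_int i \<le> a / T" "a / T < of_int i + 1" by (auto simp: i_def)
    then show "of_int i * T \<le> a" "a < of_int (i + 1) * T" using T by (simp_all add: field_simps)
  qed
  have "(\<integral>\<^sup>+ y. g y * indicator {y. a \<le> y $ 1 \<and> y $ 1 \<le> b} y \<partial>lborel)
    \<le> (\<integral>\<^sup>+ y. (\<Sum>l\<in>{..N}. g y * indicator {y. of_int (i + int l) * T \<le> y $ 1 \<and> y $ 1 < of_int (i + int l + 1) * T} y) \<partial>lborel)"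
  proof (rule nn_integral_mono)
    fix y :: "real ^ 3"
    show "g y * indicator {y. a \<le> y $ 1 \<and> y $ 1 \<le> b} y
      \<le> (\<Sum>l\<in>{..N}. g y * indicator {y. of_int (i + int l) * T \<le> y $ 1 \<and> y $ 1 < of_int (i + int l + 1) * T} y)"
    proof (cases "a \<le> y $ 1 \<and> y $ 1 \<le> b")
      case True
      define m where "m = \<lfloor>y $ 1 / T\<rfloor>"
      have "of_int m \<le> y $ 1 / T" "y $ 1 / T < of_int m + 1" by (auto simp: m_def)
      then have m: "of_int m * T \<le> y $ 1" "y $ 1 < of_int (m + 1) * T" using T by (simp_all add: field_simps)
      have "of_int i * T < of_int (m + 1) * T" using i m True by linarith
      then have im: "i \<le> m" using T by (simp only: mult_less_cancel_right_pos of_int_less_iff)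
      have "of_int m * T \<le> a + real N * T" using m True len by linarith
      also have "\<dots> < of_int (i + 1 + int N) * T" using i by (simp add: algebra_simps)
      finally have "m < i + 1 + int N" using T by (simp only: mult_less_cancel_right_pos of_int_less_iff)
      then have l: "nat (m - i) \<in> {..N}" "i + int (nat (m - i)) = m" using im by auto
      have "g y * indicator {y. a \<le> y $ 1 \<and> y $ 1 \<le> b} y
        = g y * indicator {y. of_int (i + int (nat (m - i))) * T \<le> y $ 1 \<and> y $ 1 < of_int (i + int (nat (m - i)) + 1) * T} y"
        unfolding l(2) using True m by simp
      also have "\<dots> \<le> (\<Sum>l\<in>{..N}. g y * indicator {y. of_int (i + int l) * T \<le> y $ 1 \<and> y $ 1 < of_int (i + int l + 1) * T} y)"
        by (rule member_le_sum[OF l(1)]) auto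
      finally show ?thesis .
    qed simp
  qed
  also have "\<dots> = (\<Sum>l\<in>{..N}. J (i + int l))"
    unfolding J_def by (rule nn_integral_sum) (simp, rule mg)
  also have "\<dots> = (\<Sum>l\<in>{..N}. J 0)" by (rule sum.cong[OF refl J0])
  also have "\<dots> = of_nat (N + 1) * J 0" by simp
  also have "J 0 = (\<integral>\<^sup>+ y. g y * indicator {y. y $ 1 \<in> {0..<T}} y \<partial>lborel)"
    unfolding J_def by (intro nn_integral_cong) (simp add: indicator_def)
  finally show ?thesis .
qed

section \<open>The Liouville theorems for the transported equation\<close>

lemma cone_rad_zero: "cone_rad 0 y = exp y"
proof -
  have "radius 0 u = \<bar>u\<bar>" for u by (simp add: radius_def)
  moreover have "exp (2 * y) = (exp y)\<^sup>2" by (simp add: power2_eq_square flip: exp_add)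
  ultimately show ?thesis unfolding cone_rad_def by (simp only: real_sqrt_abs abs_power2 abs_exp_cancel)
qed

lemma cone_rad_bounds:
  assumes "t \<noteq> 0"
  shows "t\<^sup>2 \<le> (cone_rad t y)\<^sup>2" "0 \<le> y \<Longrightarrow> (cone_rad t y)\<^sup>2 \<le> (1 + t ^ 4) * exp (4 * y)"
    "0 \<le> y \<Longrightarrow> cone_rad t y \<le> (1 + t ^ 4) * exp (4 * y)" "y \<le> 0 \<Longrightarrow> cone_rad t y \<le> 1 + t ^ 4"
proof -
  have K2: "(cone_rad t y)\<^sup>2 = radius t (exp (2 * y))" by (simp add: cone_rad_def radius_def)
  have "(t\<^sup>2)\<^sup>2 \<le> (exp (2 * y))\<^sup>2 + t ^ 4" by (simp flip: power_mult)
  then show "t\<^sup>2 \<le> (cone_rad t y)\<^sup>2" unfolding K2 radius_def by (intro real_le_rsqrt)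
  have t4: "0 \<le> t ^ 4" by simp
  have rad: "radius t e \<le> (1 + t ^ 4) * E" if e: "0 \<le> e" "e \<le> E" "1 \<le> E" for e E
  proof -
    have "e\<^sup>2 + t ^ 4 \<le> E\<^sup>2 + t ^ 4 * E\<^sup>2"
      using e t4 by (intro add_mono power_mono) (auto intro: mult_right_mono[of 1 "E\<^sup>2" "t ^ 4", simplified mult.commute] simp: one_le_power mult_le_cancel_left1)
    also have "\<dots> \<le> ((1 + t ^ 4) * E)\<^sup>2"
    proof -
      have "1 + t ^ 4 \<le> (1 + t ^ 4)\<^sup>2" by (intro self_le_power) auto
      then have "(1 + t ^ 4) * E\<^sup>2 \<le> (1 + t ^ 4)\<^sup>2 * E\<^sup>2" by (rule mult_right_mono) simp
      moreover have "E\<^sup>2 + t ^ 4 * E\<^sup>2 = (1 + t ^ 4) * E\<^sup>2" by (simp add: distrib_right)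
      ultimately show ?thesis by (simp only: power_mult_distrib)
    qed
    finally show ?thesis unfolding radius_def using e t4 by (intro real_le_lsqrt) auto
  qed
  have sq: "cone_rad t y \<le> B" if "(cone_rad t y)\<^sup>2 \<le> B" "1 \<le> B" for B
  proof -
    have "B \<le> B\<^sup>2" using that(2) by (intro self_le_power) auto
    then have "(cone_rad t y)\<^sup>2 \<le> B\<^sup>2" using that(1) by linarith
    then show ?thesis by (rule power2_le_imp_le) (use that(2) in simp)
  qed
  show 2: "0 \<le> y \<Longrightarrow> (cone_rad t y)\<^sup>2 \<le> (1 + t ^ 4) * exp (4 * y)"
    unfolding K2 by (rule rad) auto
  show "0 \<le> y \<Longrightarrow> cone_rad t y \<le> (1 + t ^ 4) * exp (4 * y)"
    by (rule sq[OF 2]) (use t4 one_le_exp_iff mult_mono[of 1 "1 + t ^ 4" 1 "exp (4 * y)"] in auto)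
  show "y \<le> 0 \<Longrightarrow> cone_rad t y \<le> 1 + t ^ 4"
    by (rule sq) (use rad[of "exp (2 * y)" 1] t4 in \<open>auto simp: K2\<close>)
qed

context jet2_mixed
begin

text \<open>The coefficient of \<open>u11\<close>, which is also the derivative of \<open>k\<close>,
  is dominated by the density because \<open>k\<close> is bounded below. The function
  \<open>k\<close> itself is dominated only for nonnegative \<open>y\<close>; on the other side it
  is bounded, and \<open>loc\<close> supplies the bound on \<open>u\<close>.\<close>

lemma liouville_smooth:
  assumes p: "1 \<le> p" and t: "t \<noteq> 0"
    and pde: "\<And>x y z. exp (4 * y) / cone_rad t y ^ 3 * (u11 (x, y, z) + u2 (x, y, z)) + cone_rad t y * u22 (x, y, z)
      + 4 * cone_rad t y * u33 (x, y, z) = 0"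
    and int: "\<And>x0 y0 y1 z0. integral (cbox (x0, y0, z0) (x0 + 1, y1, z0 + 2 * pi))
      (\<lambda>q. \<bar>u q\<bar> powr p * (sqrt 2 * exp (4 * fst (snd q)) / cone_rad t (fst (snd q)))) \<le> C"
    and loc: "\<And>X. \<exists>B. \<forall>x y z. \<bar>x\<bar> \<le> X \<longrightarrow> y \<le> 0 \<longrightarrow> \<bar>u (x, y, z)\<bar> \<le> B"
  shows "u q = 0"
proof -
  let ?K = "cone_rad t"
  let ?\<mu> = "\<lambda>y. sqrt 2 * exp (4 * y) / ?K y"
  \<comment> \<open>\<open>1 / t\<^sup>2\<close> bounds \<open>1 / k^2\<close>, and
    \<open>1 + t ^ 4\<close> bounds the quotient of \<open>k^2\<close> by \<open>exp (4 * y)\<close>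
    for nonnegative \<open>y\<close>.\<close>
  define L where "L = 1 + t ^ 4 + 1 / t\<^sup>2"
  have L: "1 + t ^ 4 \<le> L" "1 / t\<^sup>2 \<le> L" "0 \<le> L" by (simp_all add: L_def)
  have Kp: "0 < ?K y" for y by (rule cone_rad_pos)
  have K0: "?K y \<noteq> 0" for y using Kp[of y] by simp
  have cK: "continuous_on UNIV ?K" by (rule DERIV_imp_continuous, rule DERIV_cone_rad)
  have c\<alpha>: "continuous_on UNIV (\<lambda>y. exp (4 * y) / ?K y ^ 3)" by (intro continuous_intros cK ballI) (simp add: K0)
  have s2: "1 \<le> sqrt 2" by simp
  have \<mu>ge: "exp (4 * y) / ?K y \<le> ?\<mu> y" for y
    using Kp[of y] s2 mult_right_mono[OF s2, of "exp (4 * y) / ?K y"] by simp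
  have \<alpha>le: "exp (4 * y) / ?K y ^ 3 \<le> L * ?\<mu> y" for y
  proof -
    have "exp (4 * y) / ?K y ^ 3 = (1 / (?K y)\<^sup>2) * (exp (4 * y) / ?K y)" by (simp add: power2_eq_square power3_eq_cube)
    also have "\<dots> \<le> (1 / t\<^sup>2) * (exp (4 * y) / ?K y)"
      using cone_rad_bounds(1)[OF t, of y] t Kp[of y] by (intro mult_right_mono divide_left_mono) auto
    also have "\<dots> \<le> L * ?\<mu> y" using L \<mu>ge[of y] Kp[of y] by (intro mult_mono) auto
    finally show ?thesis .
  qed
  have Kle: "?K y \<le> L * ?\<mu> y" if "0 \<le> y" for y
  proof -
    have "(?K y)\<^sup>2 \<le> L * exp (4 * y)"
      by (rule order_trans[OF cone_rad_bounds(2)[OF t that]]) (use L in \<open>simp add: mult_right_mono\<close>)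
    then have "?K y \<le> L * (exp (4 * y) / ?K y)" using Kp[of y] by (simp add: field_simps power2_eq_square)
    also have "\<dots> \<le> L * ?\<mu> y" by (intro mult_left_mono \<mu>ge L)
    finally show ?thesis .
  qed
  show ?thesis
  proof (rule liouville_convex[where p=p and C=C and k="?K" and k'="\<lambda>y. exp (4 * y) / ?K y ^ 3"
      and \<alpha>="\<lambda>y. exp (4 * y) / ?K y ^ 3" and \<beta>="\<lambda>y. 4 * ?K y" and \<mu>="?\<mu>" and \<mu>min="1 / (1 + t ^ 4)" and d=0 and m=0 and K=L])
    show "exp (4 * y) / ?K y ^ 3 * u11 (x, y, z) + (?K y * u22 (x, y, z) + (exp (4 * y) / ?K y ^ 3 + 0) * u2 (x, y, z))
        + 4 * ?K y * u33 (x, y, z) = 0 * u (x, y, z)" for x y z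
      using pde[of y x z] by (simp only: distrib_left add_0_right mult_zero_left)
    show "1 / (1 + t ^ 4) \<le> ?\<mu> y" if "0 \<le> y" for y
    proof -
      have "1 / (1 + t ^ 4) \<le> exp (4 * y) / ?K y"
        using cone_rad_bounds(3)[OF t that] Kp[of y] by (simp add: field_simps add_pos_nonneg)
      then show ?thesis using \<mu>ge[of y] by linarith
    qed
    show "\<bar>exp (4 * y) / ?K y ^ 3\<bar> + \<bar>0\<bar> \<le> L * ?\<mu> y" for y using \<alpha>le[of y] Kp[of y] by simp
    show "\<exists>M. \<forall>x y z. \<bar>x\<bar> \<le> X \<longrightarrow> ?K y * \<bar>u (x, y, z)\<bar> powr p \<le> M + L * (\<bar>u (x, y, z)\<bar> powr p * ?\<mu> y)" for X
    proof -
      obtain B where B: "\<forall>x y z. \<bar>x\<bar> \<le> X \<longrightarrow> y \<le> 0 \<longrightarrow> \<bar>u (x, y, z)\<bar> \<le> B" using loc by blast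
      have "?K y * \<bar>u (x, y, z)\<bar> powr p \<le> (1 + t ^ 4) * \<bar>B\<bar> powr p + L * (\<bar>u (x, y, z)\<bar> powr p * ?\<mu> y)" if x: "\<bar>x\<bar> \<le> X" for x y z
      proof (cases "0 \<le> y")
        case True
        have "?K y * \<bar>u (x, y, z)\<bar> powr p \<le> (L * ?\<mu> y) * \<bar>u (x, y, z)\<bar> powr p" by (intro mult_right_mono Kle True) auto
        also have "\<dots> \<le> (1 + t ^ 4) * \<bar>B\<bar> powr p + L * (\<bar>u (x, y, z)\<bar> powr p * ?\<mu> y)" by (simp add: mult_ac add_increasing)
        finally show ?thesis .
      next
        case False
        then have "\<bar>u (x, y, z)\<bar> \<le> \<bar>B\<bar>" using B x by (meson abs_ge_self nle_le order_trans)
        then have "\<bar>u (x, y, z)\<bar> powr p \<le> \<bar>B\<bar> powr p" using p by (intro powr_mono2) auto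
        then have "?K y * \<bar>u (x, y, z)\<bar> powr p \<le> (1 + t ^ 4) * \<bar>B\<bar> powr p"
          using cone_rad_bounds(4)[OF t, of y] False Kp[of y] by (intro mult_mono) auto
        moreover have "0 \<le> L * (\<bar>u (x, y, z)\<bar> powr p * ?\<mu> y)" using L Kp[of y] by simp
        ultimately show ?thesis by linarith
      qed
      then show ?thesis by blast
    qed
  qed (use p Kp K0 c\<alpha> cK DERIV_cone_rad L \<alpha>le int in \<open>auto intro!: continuous_intros add_pos_nonneg less_imp_le[OF Kp] simp: less_imp_le[OF Kp]\<close>)
qed

text \<open>At \<open>t = 0\<close> the density is \<open>sqrt 2 * exp (3 * y)\<close>, so the
  weight \<open>exp (3 / p * y)\<close> turns the weighted bound into one for Lebesgue measure. The
  lost factor \<open>sqrt 2\<close> is at least 1, so \<open>C\<close> can be kept.\<close>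

lemma liouville_singular:
  assumes p: "1 \<le> p"
    and pde: "\<And>q. u11 q + u2 q + u22 q + 4 * u33 q = 0"
    and int: "\<And>x0 y0 y1 z0. integral (cbox (x0, y0, z0) (x0 + 1, y1, z0 + 2 * pi))
      (\<lambda>q. \<bar>u q\<bar> powr p * (sqrt 2 * exp (4 * fst (snd q)) / cone_rad 0 (fst (snd q)))) \<le> C"
  shows "u q = 0"
proof -
  define a where "a = 3 / p"
  define e where "e = (\<lambda>q :: real \<times> real \<times> real. exp (a * fst (snd q)))"
  have e: "dir_deriv dx e (\<lambda>q. 0)" "dir_deriv dz e (\<lambda>q. 0)" "dir_deriv dy e (\<lambda>q. a * e q)"
  proof -
    show "dir_deriv dx e (\<lambda>q. 0)" "dir_deriv dz e (\<lambda>q. 0)"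
      unfolding e_def by (rule dir_deriv_coord_const(2)[of "\<lambda>y. exp (a * y)"] dir_deriv_coord_const(5)[of "\<lambda>y. exp (a * y)"])+
    show "dir_deriv dy e (\<lambda>q. a * e q)"
      unfolding e_def by (rule dir_deriv_coord(2)[where A="\<lambda>y. exp (a * y)" and A'="\<lambda>y. a * exp (a * y)"])
        (auto intro!: derivative_eq_intros)
  qed
  have ce: "continuous_on UNIV e" unfolding e_def by (intro continuous_intros)
  have x: "dir_deriv dx (\<lambda>q. e q * f q) (\<lambda>q. e q * f' q)" if "dir_deriv dx f f'" for f f'
    by (rule dir_deriv_eq[OF dir_deriv_mult[OF e(1) that]]) simp
  have z: "dir_deriv dz (\<lambda>q. e q * f q) (\<lambda>q. e q * f' q)" if "dir_deriv dz f f'" for f f'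
    by (rule dir_deriv_eq[OF dir_deriv_mult[OF e(2) that]]) simp
  have y: "dir_deriv dy (\<lambda>q. e q * f q) (\<lambda>q. e q * (a * f q + f' q))" if "dir_deriv dy f f'" for f f'
    by (rule dir_deriv_eq[OF dir_deriv_mult[OF e(3) that]]) (simp add: algebra_simps)
  interpret V: jet2_mixed "\<lambda>q. e q * u q" "\<lambda>q. e q * u1 q" "\<lambda>q. e q * (a * u q + u2 q)" "\<lambda>q. e q * u3 q"
    "\<lambda>q. e q * u11 q" "\<lambda>q. e q * (a * (a * u q + u2 q) + (a * u2 q + u22 q))" "\<lambda>q. e q * u33 q"
    "\<lambda>q. e q * (a * u1 q + u12 q)" "\<lambda>q. e q * (a * u3 q + u32 q)"
  proof
    show "e (x, y, z + 2 * pi) * u (x, y, z + 2 * pi) = e (x, y, z) * u (x, y, z)" for x y z by (simp add: e_def per)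
    show "dir_deriv dy (\<lambda>q. e q * (a * u q + u2 q)) (\<lambda>q. e q * (a * (a * u q + u2 q) + (a * u2 q + u22 q)))"
      by (intro y dir_deriv_add der dir_deriv_eq[OF dir_deriv_mult[OF dir_deriv_const der(2)]]) simp
    show "dir_deriv dx (\<lambda>q. e q * (a * u q + u2 q)) (\<lambda>q. e q * (a * u1 q + u12 q))"
      by (intro x dir_deriv_add mixed dir_deriv_eq[OF dir_deriv_mult[OF dir_deriv_const der(1)]]) simp
    show "dir_deriv dz (\<lambda>q. e q * (a * u q + u2 q)) (\<lambda>q. e q * (a * u3 q + u32 q))"
      by (intro z dir_deriv_add mixed dir_deriv_eq[OF dir_deriv_mult[OF dir_deriv_const der(3)]]) simp
  qed (intro x y z der mixed continuous_intros cont cont_mixed ce)+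
  have "e q * u q = 0"
  proof (rule V.liouville_cone[OF p a_def])
    show "e q * u11 q + e q * (a * (a * u q + u2 q) + (a * u2 q + u22 q)) + (1 - 2 * a) * (e q * (a * u q + u2 q)) + 4 * (e q * u33 q)
      = (a - a\<^sup>2) * (e q * u q)" for q
    proof -
      have "e q * u11 q + e q * (a * (a * u q + u2 q) + (a * u2 q + u22 q)) + (1 - 2 * a) * (e q * (a * u q + u2 q)) + 4 * (e q * u33 q)
        = (a - a\<^sup>2) * (e q * u q) + e q * (u11 q + u2 q + u22 q + 4 * u33 q)"
        by (simp add: algebra_simps power2_eq_square)
      then show ?thesis by (simp add: pde)
    qed
    fix x0 y0 y1 z0 :: real
    let ?D = "cbox (x0, y0, z0) (x0 + 1, y1, z0 + 2 * pi)"
    have eq: "\<bar>u q\<bar> powr p * (sqrt 2 * exp (4 * fst (snd q)) / cone_rad 0 (fst (snd q))) = sqrt 2 * \<bar>e q * u q\<bar> powr p" for q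
    proof -
      have "\<bar>e q * u q\<bar> powr p = e q powr p * \<bar>u q\<bar> powr p" by (simp add: abs_mult powr_mult e_def)
      also have "e q powr p = exp (3 * fst (snd q))" using p by (simp add: e_def a_def powr_def)
      also have "exp (3 * fst (snd q)) = exp (4 * fst (snd q)) / exp (fst (snd q))" by (simp flip: exp_diff)
      finally show ?thesis by (simp add: cone_rad_zero)
    qed
    have cv: "continuous_on UNIV (\<lambda>q. \<bar>e q * u q\<bar> powr p)"
      using p by (auto intro!: continuous_intros continuous_on_powr' V.cont)
    have "0 \<le> integral ?D (\<lambda>q. \<bar>e q * u q\<bar> powr p)"
      by (rule integral_nonneg[OF integrable_cbox_continuous[OF cv]]) simp
    then have "integral ?D (\<lambda>q. \<bar>e q * u q\<bar> powr p) \<le> sqrt 2 * integral ?D (\<lambda>q. \<bar>e q * u q\<bar> powr p)"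
      by (simp add: mult_le_cancel_right1)
    also have "\<dots> \<le> C" using int[of x0 y0 z0 y1] unfolding eq by simp
    finally show "integral ?D (\<lambda>q. \<bar>e q * u q\<bar> powr p) \<le> C" .
  qed
  then show ?thesis by (simp add: e_def)
qed

end

section \<open>Transfer between the hypersurface and the adapted coordinates\<close>

context curve_chart
begin

text \<open>For a closed curve the hypothesis covers one period, but the slab may sit anywhere on
  the unrolled line. A unit step in \<open>x\<close> has bounded Euclidean length, so it meets a
  number of periods that does not depend on \<open>x0\<close>.\<close>

lemma strip_bound:
  assumes p: "1 \<le> p" and W: "continuous_on fibre_domain W"
    and T: "0 < T \<and> (\<forall>s. c (s + T) = c s) \<or> T = 0"
    and per: "\<And>y. y \<in> fibre_domain \<Longrightarrow> W (T *\<^sub>R axis 1 1 + y) = W y"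
    and fin: "(\<integral>\<^sup>+ y. ennreal (\<bar>W y\<bar> powr p * vol_density (hyp_metric c t) y)
      * indicator {y \<in> fibre_domain. y $ 1 \<in> fund_domain T} y \<partial>lborel) < \<infinity>"
  obtains C where "\<And>x0 y0 y1 z0. integral (cbox (x0, y0, z0) (x0 + 1, y1, z0 + 2 * pi))
      (\<lambda>q. \<bar>W (\<Phi> q)\<bar> powr p * (sqrt 2 * exp (4 * fst (snd q)) / cone_rad t (fst (snd q)))) \<le> C"
proof -
  define f where "f y = \<bar>W y\<bar> powr p * vol_density (hyp_metric c t) y" for y
  define g where "g y = ennreal (f y) * indicator fibre_domain y" for y
  have "continuous_on fibre_domain (\<lambda>y. \<bar>W y\<bar> powr p * (P (y $ 1) / (sqrt 2 * chart_rad t y)))"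
  proof -
    have "continuous_on fibre_domain (\<lambda>y. P (y $ 1))" "continuous_on fibre_domain (chart_rad t)"
      using differentiable_chart by (meson continuous_at_imp_continuous_on differentiable_imp_continuous_within)+
    moreover have "sqrt 2 * chart_rad t y \<noteq> 0" if "y \<in> fibre_domain" for y using chart_rad_pos[OF that, of t] by simp
    ultimately show ?thesis using p by (intro continuous_intros continuous_on_powr' W) auto
  qed
  then have "continuous_on fibre_domain f"
    by (rule continuous_on_eq) (simp add: f_def vol_density_chart)
  then have "(\<lambda>y. indicator fibre_domain y *\<^sub>R f y) \<in> borel_measurable borel"
    by (intro borel_measurable_continuous_on_indicator) (simp add: open_fibre_domain)
  then have "(\<lambda>y. ennreal (indicator fibre_domain y *\<^sub>R f y)) \<in> borel_measurable borel" by measurable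
  moreover have "(\<lambda>y. ennreal (indicator fibre_domain y *\<^sub>R f y)) = g"
    by (auto simp: g_def indicator_def)
  ultimately have gm: "g \<in> borel_measurable borel" by simp
  have fin': "(\<integral>\<^sup>+ y. g y * indicator {y. y $ 1 \<in> fund_domain T} y \<partial>lborel) < \<infinity>"
  proof -
    have "(\<integral>\<^sup>+ y. g y * indicator {y. y $ 1 \<in> fund_domain T} y \<partial>lborel)
      = (\<integral>\<^sup>+ y. ennreal (f y) * indicator {y \<in> fibre_domain. y $ 1 \<in> fund_domain T} y \<partial>lborel)"
      by (intro nn_integral_cong) (simp add: g_def indicator_def)
    then show ?thesis using fin by (simp add: f_def)
  qed
  have "\<exists>K<\<infinity>. \<forall>x0. (\<integral>\<^sup>+ y. g y * indicator {y. S x0 \<le> y $ 1 \<and> y $ 1 \<le> S (x0 + 1)} y \<partial>lborel) \<le> K"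
  proof (cases "T = 0")
    case True
    have "(\<integral>\<^sup>+ y. g y * indicator {y. S x0 \<le> y $ 1 \<and> y $ 1 \<le> S (x0 + 1)} y \<partial>lborel)
      \<le> (\<integral>\<^sup>+ y. g y * indicator {y. y $ 1 \<in> fund_domain T} y \<partial>lborel)" for x0
      by (intro nn_integral_mono mult_left_mono) (auto simp: indicator_def fund_domain_def True)
    then show ?thesis using fin' by blast
  next
    case False
    then have T: "0 < T" "\<And>s. c (s + T) = c s" using T by auto
    have Pper: "P (s + T) = P s" for s by (simp add: P_def T)
    have Pper': "P (T + s) = P s" for s using Pper[of s] by (simp only: add.commute)
    have "continuous_on UNIV P" by (rule DERIV_imp_continuous, rule DERIV_P)
    then obtain M where M: "0 < M" "\<And>s. P s \<le> M" using periodic_continuous_bounded[of P T] Pper T(1) by blast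
    \<comment> \<open>\<open>M\<close> bounds the derivative \<open>P\<close> of \<open>S\<close>,
      so a unit step in \<open>x\<close> advances the arc length by at most
      \<open>M\<close>.\<close>
    define N where "N = nat \<lceil>M / T\<rceil>"
    have "M / T \<le> real N" unfolding N_def by linarith
    then have N: "M \<le> real N * T" using T(1) by (simp add: field_simps)
    have len: "S (x0 + 1) - S x0 \<le> real N * T" for x0
    proof -
      obtain \<xi> where "S (x0 + 1) - S x0 = (x0 + 1 - x0) * P (S \<xi>)"
        using MVT2[of x0 "x0 + 1" S "\<lambda>x. P (S x)"] S[folded P_def] by auto
      then show ?thesis using M(2)[of "S \<xi>"] N by simp
    qed
    have gper: "g (T *\<^sub>R axis 1 1 + y) = g y" for y
    proof -
      have n: "(T *\<^sub>R axis 1 1 + y) $ 1 = y $ 1 + T" "fibre_coord (T *\<^sub>R axis 1 1 + y) = fibre_coord y"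
        by (simp_all add: axis_def fibre_coord_def)
      have d: "T *\<^sub>R axis 1 1 + y \<in> fibre_domain \<longleftrightarrow> y \<in> fibre_domain" by (simp add: fibre_domain_def n)
      show ?thesis
      proof (cases "y \<in> fibre_domain")
        case True
        then show ?thesis using per[OF True] d
          by (simp add: g_def f_def vol_density_chart chart_rad_def n Pper Pper')
      qed (simp add: g_def d)
    qed
    have "fund_domain T = {0..<T}" using T by (simp add: fund_domain_def)
    then have "of_nat (N + 1) * (\<integral>\<^sup>+ y. g y * indicator {y. y $ 1 \<in> {0..<T}} y \<partial>lborel) < \<infinity>"
      using fin' of_nat_less_top[of "N + 1"] by (simp only: ennreal_mult_less_top infinity_ennreal_def simp_thms)
    then show ?thesis using periodic_strip_bound[OF gm gper T(1) len] by blast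
  qed
  then obtain K where K: "K < \<infinity>"
    "\<And>x0. (\<integral>\<^sup>+ y. g y * indicator {y. S x0 \<le> y $ 1 \<and> y $ 1 \<le> S (x0 + 1)} y \<partial>lborel) \<le> K" by blast
  show thesis
  proof (rule that[of "enn2real K"])
    fix x0 y0 y1 z0 :: real
    let ?I = "integral (cbox (x0, y0, z0) (x0 + 1, y1, z0 + 2 * pi))
      (\<lambda>q. \<bar>W (\<Phi> q)\<bar> powr p * (sqrt 2 * exp (4 * fst (snd q)) / cone_rad t (fst (snd q))))"
    have "ennreal ?I \<le> (\<integral>\<^sup>+ y. ennreal (f y) * indicator {y \<in> fibre_domain. S x0 \<le> y $ 1 \<and> y $ 1 \<le> S (x0 + 1)} y \<partial>lborel)"
      unfolding f_def by (rule slab_integral_le[OF p W])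
    also have "\<dots> = (\<integral>\<^sup>+ y. g y * indicator {y. S x0 \<le> y $ 1 \<and> y $ 1 \<le> S (x0 + 1)} y \<partial>lborel)"
      by (intro nn_integral_cong) (simp add: g_def indicator_def)
    also have "\<dots> \<le> K" by (rule K(2))
    also have "K = ennreal (enn2real K)" using K(1) by simp
    finally show "?I \<le> enn2real K" by (simp add: ennreal_le_iff)
  qed
qed

text \<open>For \<open>y \<le> 0\<close> the fibre coordinate has modulus
  \<open>exp (2 * y) / P\<close>, at most 1. The region therefore lies in a compact set of the chart
  that includes the zero section, on which \<open>W\<close> is continuous.\<close>

lemma bounded_below:
  assumes W: "continuous_on UNIV (W :: real ^ 3 \<Rightarrow> real)"
  shows "\<exists>B. \<forall>x y z. \<bar>x\<bar> \<le> X \<longrightarrow> y \<le> 0 \<longrightarrow> \<bar>W (\<Phi> (x, y, z))\<bar> \<le> B"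
proof -
  let ?D = "cbox (vector [S (- X), - 1, - 1]) (vector [S X, 1, 1]) :: (real ^ 3) set"
  have "bounded (W ` ?D)"
    by (intro compact_imp_bounded compact_continuous_image continuous_on_subset[OF W] compact_cbox) auto
  then obtain B where B: "\<And>y. y \<in> ?D \<Longrightarrow> \<bar>W y\<bar> \<le> B" by (auto simp: bounded_iff)
  have "\<Phi> (x, y, z) \<in> ?D" if "\<bar>x\<bar> \<le> X" "y \<le> 0" for x y z
  proof -
    have P1: "1 \<le> P (S x)" by (simp add: P_def)
    have "exp (2 * y) \<le> 1" using that(2) by simp
    then have "exp (2 * y) \<le> P (S x)" using P1 by linarith
    then have "exp (2 * y) / P (S x) \<le> 1" using P1 by (simp add: divide_le_eq_1)
    then have "(exp (2 * y) / P (S x))\<^sup>2 \<le> 1" using P1 by (intro power_le_one) auto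
    then have "(fib_re (x, y, z))\<^sup>2 + (fib_im (x, y, z))\<^sup>2 \<le> 1" by (simp add: fib_norm)
    then have "(fib_re (x, y, z))\<^sup>2 \<le> 1" "(fib_im (x, y, z))\<^sup>2 \<le> 1"
      using zero_le_power2[of "fib_re (x, y, z)"] zero_le_power2[of "fib_im (x, y, z)"] by linarith+
    then have "\<bar>fib_re (x, y, z)\<bar> \<le> 1" "\<bar>fib_im (x, y, z)\<bar> \<le> 1" by (simp_all add: abs_square_le_1)
    moreover have "S (- X) \<le> S x" "S x \<le> S X"
      using that(1) S_strict_mono by (simp_all add: strict_mono_less_eq)
    ultimately show ?thesis by (simp add: mem_box_cart forall_3 \<Phi>_nth abs_le_iff)
  qed
  then show ?thesis using B by blast
qed

end

theorem corollary4:
  fixes p t T :: real and c :: "real \<Rightarrow> complex" and w :: "real \<times> h2 \<Rightarrow> real"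
  assumes "p \<ge> 1"
    and "unit_speed_curve c"
    and "T > 0 \<and> (\<forall>s. c (s + T) = c s) \<or> T = 0 \<and> spherically_complete c"
    and "hyp_function T c t w"
    and "hyp_smooth c t w"
    and "hyp_harmonic c t w"
    and "hyp_Lp p T c t w"
  shows "\<forall>m \<in> hypersurface c t. w m = 0"
proof -
  obtain c' c'' where c: "\<And>s. (c has_vector_derivative c' s) (at s)" "\<And>s. (c' has_vector_derivative c'' s) (at s)"
    "continuous_on UNIV c''" "\<And>s. cmod (c' s) = 1"
    using unit_speed_curve_derivatives[OF assms(2)] by blast
  have cc: "continuous_on UNIV c" "continuous_on UNIV c'"
    by (intro continuous_at_imp_continuous_on ballI has_vector_derivative_continuous[OF c(1)] has_vector_derivative_continuous[OF c(2)])+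
  have "spherically_complete c"
    using assms(3) periodic_imp_spherically_complete[OF cc(1)] by blast
  then obtain S where S: "\<And>x. (S has_real_derivative 1 + (cmod (c (S x)))\<^sup>2) (at x)" and surjS: "surj S"
    using spherical_arc_length_inverse[OF cc(1)] by blast
  have cS: "continuous_on UNIV S" by (rule DERIV_imp_continuous, rule S)
  have "continuous_on UNIV (\<lambda>x. 2 * Im (cnj (c (S x)) * c' (S x)))"
    by (intro continuous_intros continuous_on_compose2[OF cc(1) cS] continuous_on_compose2[OF cc(2) cS]) auto
  then obtain \<theta> where \<theta>: "\<And>x. (\<theta> has_real_derivative 2 * Im (cnj (c (S x)) * c' (S x))) (at x)"
    by (rule antiderivative_real) blast
  interpret curve_chart c c' c'' S \<theta>
    by unfold_locales (fact c S \<theta>)+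
  define W where "W = w \<circ> hyp_param c"
  have dom: "fibre_domain \<subseteq> hyp_coords c t"
    by (auto simp: hyp_coords_eq fibre_domain_def fibre_coord_def complex_eq_iff)
  have "Ck_on (Suc (Suc 0)) (hyp_coords c t) W"
    using assms(5) unfolding hyp_smooth_def smooth_on_def W_def by blast
  then have W: "\<And>y. y \<in> hyp_coords c t \<Longrightarrow> W differentiable (at y)"
    "\<And>y i. y \<in> hyp_coords c t \<Longrightarrow> pderiv_at i W differentiable (at y)"
    "\<And>i j. continuous_on (hyp_coords c t) (pderiv_at j (pderiv_at i W))"
    by (simp_all add: pderiv_at_def[abs_def])
  have cW: "continuous_on (hyp_coords c t) W"
    using W(1) by (meson continuous_at_imp_continuous_on differentiable_imp_continuous_within)
  have harm: "riem_laplacian (hyp_metric c t) W y = 0" if "y \<in> fibre_domain" for y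
    using assms(6) dom that unfolding hyp_harmonic_def W_def by blast
  obtain u1 u2 u3 u11 u22 u33 u12 u32 where jet: "jet2_mixed (\<lambda>q. W (\<Phi> q)) u1 u2 u3 u11 u22 u33 u12 u32"
    and pde: "\<And>x y z. exp (4 * y) / cone_rad t y ^ 3 * (u11 (x, y, z) + u2 (x, y, z)) + cone_rad t y * u22 (x, y, z)
      + 4 * cone_rad t y * u33 (x, y, z) = 0"
    by (rule transported_pde[of W t]) (use W dom harm continuous_on_subset in blast)+
  have per: "W (T *\<^sub>R axis 1 1 + y) = W y" if y: "y \<in> fibre_domain" for y
  proof -
    have "c (y $ 1 + T) = c (y $ 1)" using assms(3) by auto
    then have "hyp_param c (T *\<^sub>R axis 1 1 + y) = (fst (hyp_param c y) + T, snd (hyp_param c y))"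
      by (simp add: hyp_param_def hyp_immersion_def axis_def add.commute)
    moreover have "hyp_param c y \<in> hypersurface c t" using y dom by (auto simp: hyp_coords_def)
    ultimately show ?thesis using assms(4) by (auto simp: W_def hyp_function_def case_prod_beta)
  qed
  have fin: "(\<integral>\<^sup>+ y. ennreal (\<bar>W y\<bar> powr p * vol_density (hyp_metric c t) y)
      * indicator {y \<in> fibre_domain. y $ 1 \<in> fund_domain T} y \<partial>lborel) < \<infinity>"
  proof -
    have "(\<integral>\<^sup>+ y. ennreal (\<bar>W y\<bar> powr p * vol_density (hyp_metric c t) y)
        * indicator {y \<in> fibre_domain. y $ 1 \<in> fund_domain T} y \<partial>lborel)
      \<le> (\<integral>\<^sup>+ y. ennreal (\<bar>W y\<bar> powr p * vol_density (hyp_metric c t) y)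
        * indicator {y \<in> hyp_coords c t. y $ 1 \<in> fund_domain T} y \<partial>lborel)"
      using dom by (intro nn_integral_mono mult_left_mono) (auto simp: indicator_def)
    also have "\<dots> < \<infinity>" using assms(7) by (simp add: hyp_Lp_def W_def)
    finally show ?thesis .
  qed
  obtain C where C: "\<And>x0 y0 y1 z0. integral (cbox (x0, y0, z0) (x0 + 1, y1, z0 + 2 * pi))
      (\<lambda>q. \<bar>W (\<Phi> q)\<bar> powr p * (sqrt 2 * exp (4 * fst (snd q)) / cone_rad t (fst (snd q)))) \<le> C"
    by (rule strip_bound[OF assms(1) continuous_on_subset[OF cW dom] _ per fin]) (use assms(3) in auto)
  interpret J: jet2_mixed "\<lambda>q. W (\<Phi> q)" u1 u2 u3 u11 u22 u33 u12 u32 by (rule jet)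
  have "W (\<Phi> q) = 0" for q
  proof (cases "t = 0")
    case False
    then have "continuous_on UNIV W" using cW by (simp add: hyp_coords_eq)
    then show ?thesis
      by (intro J.liouville_smooth[OF assms(1) False pde C] bounded_below)
  next
    case True
    \<comment> \<open>At \<open>t = 0\<close> all coefficients of the transported equation share the
      factor \<open>exp y\<close>.\<close>
    have "u11 q + u2 q + u22 q + 4 * u33 q = 0" for q
    proof -
      obtain x y z where q: "q = (x, y, z)" by (cases q)
      have e: "exp (4 * y) / exp y ^ 3 = exp y"
      proof -
        have "exp (4 * y) = exp y * exp y ^ 3" by (simp add: power3_eq_cube flip: exp_add)
        then show ?thesis by simp
      qed
      have "exp y * (u11 q + u2 q + u22 q + 4 * u33 q) = 0"
        using pde[of y x z] unfolding True cone_rad_zero e q by (simp add: algebra_simps)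
      then show ?thesis by simp
    qed
    then show ?thesis by (rule J.liouville_singular[OF assms(1) _ C[unfolded True]])
  qed
  then have W0: "W y = 0" if "y \<in> fibre_domain" for y
    using \<Phi>_surj[OF surjS that] by metis
  \<comment> \<open>Points of the zero section are outside the image of \<open>\<Phi>\<close>. They
    are reached by continuity along the first real direction of the fibre.\<close>
  have "W y = 0" if y: "y \<in> hyp_coords c t" for y
  proof (cases "y \<in> fibre_domain")
    case False
    then have y0: "fibre_coord y = 0" by (simp add: fibre_domain_def)
    have "isCont W y" using W(1)[OF y] differentiable_imp_continuous_within by blast
    moreover have "((\<lambda>h. y + h *\<^sub>R axis 2 1) \<longlongrightarrow> y + 0 *\<^sub>R axis 2 1) (at 0)" by (intro tendsto_intros)
    ultimately have "((\<lambda>h. W (y + h *\<^sub>R axis 2 1)) \<longlongrightarrow> W y) (at 0)"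
      by (intro isCont_tendsto_compose[of y W]) auto
    moreover have "W (y + h *\<^sub>R axis 2 1) = 0" if "h \<noteq> 0" for h
      using y0 that by (intro W0) (simp add: fibre_domain_def fibre_coord_def complex_eq_iff axis_def)
    then have "((\<lambda>h. W (y + h *\<^sub>R axis 2 1)) \<longlongrightarrow> 0) (at 0)"
      by (intro tendsto_eventually) (auto simp: eventually_at_filter)
    ultimately show ?thesis using tendsto_unique trivial_limit_at by blast
  qed (rule W0)
  then have Wz: "w (hyp_param c y) = 0" if "y \<in> hyp_coords c t" for y
    using that by (simp add: W_def)
  show ?thesis
  proof
    fix m assume "m \<in> hypersurface c t"
    then obtain y where "y \<in> hyp_coords c t" "m = hyp_param c y"
      using bij_betw_imp_surj_on[OF bij_betw_hyp_param[of c t]] by blast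
    then show "w m = 0" by (simp only: Wz)
  qed
qed

end
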